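(* Let Assumptions 1, 2, 3 (stated in the context) hold, let $i\in\mathcal V$, let $\ell\le k$ be the prediction horizon and let $\kappa\ge\kappa_0$. Let $q^c$ be the solution vector containing the primal and dual variables of the centralized problem $\tilde\Psi_t^\ell(x,\zeta;g)$ and let $q^d$ be that of the truncated problem $\tilde\psi_t^\ell(x,\zeta,\mathcal N^\kappa_{\mathcal G}[i];g)$, with $\zeta=w_{t:t+\ell-1}$. Then $$\|q^c[i]-q^d[i]\|\le\Gamma\left(\|x\|+D_\ell\right)\delta_{\mathcal S}^\kappa,$$ where $q[i]$ denotes all entries of $q$ corresponding to node $i$ (including all time steps), $D_\ell:=\max_{t\in[T-1]}\sum_{\tau=0}^{\ell-1}\|w_{t+\tau}\|$, and $$\delta_{\mathcal S}:=\frac{\rho+1}{2},\qquad\Gamma:=\frac{4\alpha^2\delta_{\mathcal S}L}{(1-\delta_{\mathcal S})^2}\left(\sup_{d\in\mathbb Z_+}\left(\rho/\delta_{\mathcal S}\right)^dp(d)\right)^2p(1).$$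
   Context: Notation. $[T]=\{0,1,\dots,T\}$; $v_{0:T}$ denotes $(v_0,\dots,v_T)$; $\|\cdot\|$ is the Euclidean norm of vectors and operator norm of matrices; $\sigma_{min}$ is the minimum singular value; $M^\dagger$ is the Moore-Penrose pseudo-inverse. System. $\mathcal G=(\mathcal V,\mathcal E)$ is a graph with $N$ nodes and shortest-path distance $d_{\mathcal G}$; $\mathcal N_{\mathcal G}[i]=\{i\}\cup\{j:(i,j)\in\mathcal E\}$; $\mathcal N^\kappa_{\mathcal G}[i]=\{j\in\mathcal V: d_{\mathcal G}(i,j)\le\kappa\}$. Vectors and matrices are partitioned into blocks indexed by nodes: $x=(x[i])_{i\in\mathcal V}$, $M=(M[i,j])_{i,j\in\mathcal V}$. The dynamics are $x_{t+1}=Ax_t+Bu_t+w_t$ over times $t\in[T-1]$, with $A[i,j]=0$, $B[i,j]=0$ whenever $j\notin\mathcal N_{\mathcal G}[i]$. Costs are $f_t(x)=\sum_{i}f_t[i](x[i])$ and $c_t(u)=\sum_i c_t[i](u[i])$. Disturbances $w_s$ with $s\ge T$ are taken to be $0$; $t$ is such that $t+\ell\le T$. Truncation. $M^{(i,\kappa)}[j,l]=M[j,l]$ if $j\in\mathcal N^\kappa_{\mathcal G}[i]$ and $0$ otherwise; for vectors, $x^{(i,\kappa)}[j]=x[j]$ if $j\in\mathcal N^\kappa_{\mathcal G}[i]$ and $0$ otherwise. Centralized problem $\tilde\Psi_t^\ell(x,\zeta;g)$: minimize over $y_{0:\ell},v_{0:\ell-1}$ the objective $\hat f(z)=\sum_{\tau=0}^{\ell-1}f_{t+\tau}(y_\tau)+\sum_{\tau=1}^{\ell}c_{t+\tau}(v_{\tau-1})+g(y_\ell)$,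 $z=(y_0,v_0,\dots,y_{\ell-1},v_{\ell-1},y_\ell)$, subject to $y_{\tau+1}=Ay_\tau+Bv_\tau+\zeta_\tau$ ($\tau\in[\ell-1]$), $y_0=x$. The truncated problem $\tilde\psi_t^\ell(x,\zeta,\mathcal N^\kappa_{\mathcal G}[i];g)$ has the same objective with constraints $y_{\tau+1}=A^{(i,\kappa)}y_\tau+B^{(i,\kappa)}v_\tau+\zeta^{(i,\kappa)}_\tau$, $y_0=x^{(i,\kappa)}$. The terminal cost $g$ is $F$ or $f_T$. The constraints read $J(A,B)z=(x,\zeta)$, respectively $J(A^{(i,\kappa)},B^{(i,\kappa)})z=(x^{(i,\kappa)},\zeta^{(i,\kappa)})$, where $J(A,B)$ has $\ell+1$ block rows, the first being $y_0$ and the subsequent ones $-Ay_\tau-Bv_\tau+y_{\tau+1}$. The dual variables $\lambda=(\lambda_0,\dots,\lambda_\ell)$ are determined by $\nabla\hat f(z)+J^\top\lambda=0$, and $q=(z,\lambda)$; $q[i]$ collects $y_\tau[i],v_\tau[i],\lambda_\tau[i]$ for all $\tau$. $(A,B)$ is $(L,\gamma)$-stabilizable ($L>1$, $\gamma\in(0,1)$) if there is $K$ with $\|K\|\le L$ and $\|(A-BK)^t\|\le L\gamma^t$ for all $t\in\mathbb Z_+$. Assumption 1. (1) $\|A\|,\|B\|,\|B^\dagger\|\le L$. (2) With $d$ the controllability index, $\mathcal C^d=[B\ AB\ \cdots\ A^{d-1}B]$ (full row rank) satisfies $\sigma_{min}(\mathcal C^d)\ge\sigma>0$. (3) There is $\kappa_0<\mathrm{diam}(\mathcal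 G)$ such that for all $i\in\mathcal V$ and $\kappa\ge\kappa_0$, $(A^{(i,\kappa)},B^{(i,\kappa)})$ is $(L,\gamma)$-stabilizable. Assumption 2. (1) $f_t,c_t$ are $\mu$-strongly convex, $L$-smooth, twice continuously differentiable for all $t$. (2) $F$ is $\mu$-strongly convex, $L$-smooth, twice continuously differentiable and a K-function, i.e. $F(x)=\beta(\|x\|)$ with $\beta$ strictly increasing, $\beta(0)=0$. (3) $f_t,c_t$ are non-negative with $f_t(0)=c_t(0)=0$ for all $t=1,\dots,T$, and likewise for $f_0$. Assumption 3. There is a subexponential function $p(\cdot)$ (i.e. $\lim_{d\to\infty}(\log p(d))/d=0$) with $|\{j\in\mathcal V:d_{\mathcal G}(i,j)=d\}|\le p(d)$ for all $i$ and all distances $d$. Constants: $\mu_J:=\frac{(1-\gamma)^2}{L^2(1+L^2)}$, $L_H:=2L+1$, $\mu_H:=\left(\frac1\mu+\left(1+\frac{2L_H}{\mu}+\frac{L_H^2}{\mu^2}\right)\frac{L_H}{\mu_J}\right)^{-1}$, $\rho:=\left(\frac{L_H^2-\mu_H^2}{L_H^2+\mu_H^2}\right)^{1/2}$, $\alpha:=\frac{L_H}{\mu_H^2\rho}$.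
   Formalization: When the terminal cost g is F, F is additionally assumed to be a sum of node costs, F(x)=Σ_i F[i](x[i]), like f_t and c_t; for a non-separable K-function F the claimed bound fails (e.g. F(y)=|y|²/2+√(1+|y|²)−1 on a long path graph). *)

theory Defs
  imports "HOL-Analysis.Analysis" "HOL-Library.Extended_Nat"
begin

section \<open>Graphs\<close>

text \<open>
  The nodes are the elements of a finite type; an undirected graph is a symmetric relation on it.
  The distance is \<open>\<infinity>\<close> between nodes that are not connected by a path.
\<close>

definition gdist :: "('n \<times> 'n) set \<Rightarrow> 'n \<Rightarrow> 'n \<Rightarrow> enat" where
  "gdist E i j = (INF n\<in>{n. (i, j) \<in> E ^^ n}. enat n)"

definition diam :: "('n \<times> 'n) set \<Rightarrow> enat" where
  "diam E = (SUP i. SUP j. gdist E i j)"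

definition nbhd :: "('n \<times> 'n) set \<Rightarrow> 'n \<Rightarrow> 'n set" where
  "nbhd E i = {i} \<union> {j. (i, j) \<in> E}"

definition nbhd_k :: "('n \<times> 'n) set \<Rightarrow> nat \<Rightarrow> 'n \<Rightarrow> 'n set" where
  "nbhd_k E \<kappa> i = {j. gdist E i j \<le> enat \<kappa>}"

definition subexponential :: "(nat \<Rightarrow> real) \<Rightarrow> bool" where
  "subexponential p \<longleftrightarrow> (\<forall>d. 0 < p d) \<and> (\<lambda>d. ln (p d) / real d) \<longlonglongrightarrow> 0"


section \<open>Node blocks\<close>

text \<open>
  A partition of the coordinates of a vector into blocks indexed by nodes is a map \<open>own\<close> sending
  each coordinate to the node it belongs to. The block \<open>x[i]\<close> is represented by the vector
  \<open>keep own {i} x\<close>, which is \<open>x[i]\<close> padded with zeros and has the same Euclidean norm.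
\<close>

definition keep :: "('a \<Rightarrow> 'n) \<Rightarrow> 'n set \<Rightarrow> real^'a \<Rightarrow> real^'a" where
  "keep own S x = (\<chi> a. if own a \<in> S then x $ a else 0)"

definition keep_rows :: "('a \<Rightarrow> 'n) \<Rightarrow> 'n set \<Rightarrow> real^'b^'a \<Rightarrow> real^'b^'a" where
  "keep_rows own S M = (\<chi> a b. if own a \<in> S then M $ a $ b else 0)"

definition graph_structured ::
  "('n \<times> 'n) set \<Rightarrow> ('a \<Rightarrow> 'n) \<Rightarrow> ('b \<Rightarrow> 'n) \<Rightarrow> real^'b^'a \<Rightarrow> bool" where
  "graph_structured E own_row own_col M \<longleftrightarrow>
     (\<forall>a b. own_col b \<notin> nbhd E (own_row a) \<longrightarrow> M $ a $ b = 0)"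

text \<open>
  A K-function is in general not separable: if at least two nodes own coordinates, a separable
  K-function is a multiple of the squared norm.
\<close>

definition node_separable :: "('a::finite \<Rightarrow> 'n::finite) \<Rightarrow> (real^'a \<Rightarrow> real) \<Rightarrow> bool" where
  "node_separable own f \<longleftrightarrow> (\<exists>h. \<forall>x. f x = (\<Sum>i\<in>UNIV. h i (keep own {i} x)))"


section \<open>Matrices and linear systems\<close>

abbreviation opnorm :: "real^'b^'a \<Rightarrow> real" where
  "opnorm M \<equiv> onorm ((*v) M)"

definition matpow :: "real^'a^'a \<Rightarrow> nat \<Rightarrow> real^'a^'a" where
  "matpow M k = (((**) M) ^^ k) (mat 1)"

definition is_pinv :: "real^'b^'a \<Rightarrow> real^'a^'b \<Rightarrow> bool" where
  "is_pinv M X \<longleftrightarrow> M ** X ** M = M \<and> X ** M ** X = X \<and>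
     transpose (M ** X) = M ** X \<and> transpose (X ** M) = X ** M"

definition pinv :: "real^'b^'a \<Rightarrow> real^'a^'b" where
  "pinv M = (THE X. is_pinv M X)"

definition eigenvalues :: "real^'a^'a \<Rightarrow> real set" where
  "eigenvalues M = {e. \<exists>x. x \<noteq> 0 \<and> M *v x = e *\<^sub>R x}"

text \<open>
  The controllability matrix \<open>C = [B, AB, ..., A^(d-1) B]\<close> has \<open>d\<close> times as many columns as \<open>B\<close>,
  so it is not the element of a single matrix type. It is given by its blocks \<open>A^k B\<close>: full row
  rank means that the columns of all blocks span the state space, and the product of \<open>C\<close> with its
  transpose is the sum of the products of the blocks. When \<open>C\<close> has full row rank it has at least
  as many columns as rows, and its singular values are the square roots of the eigenvalues of that
  product.
\<close>

definition ctrb_block :: "real^'s^'s \<Rightarrow> real^'c^'s \<Rightarrow> nat \<Rightarrow> real^'c^'s" where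
  "ctrb_block A B k = matpow A k ** B"

definition ctrb_full_row_rank :: "real^'s^'s \<Rightarrow> real^'c^'s \<Rightarrow> nat \<Rightarrow> bool" where
  "ctrb_full_row_rank A B d \<longleftrightarrow> span (\<Union>k<d. columns (ctrb_block A B k)) = UNIV"

definition is_ctrb_index :: "real^'s^'s \<Rightarrow> real^'c^'s \<Rightarrow> nat \<Rightarrow> bool" where
  "is_ctrb_index A B d \<longleftrightarrow>
     ctrb_full_row_rank A B d \<and> (\<forall>d'<d. \<not> ctrb_full_row_rank A B d')"

definition ctrb_sigma_min :: "real^'s^'s \<Rightarrow> real^'c^'s \<Rightarrow> nat \<Rightarrow> real" where
  "ctrb_sigma_min A B d =
     Min (sqrt ` eigenvalues (\<Sum>k<d. ctrb_block A B k ** transpose (ctrb_block A B k)))"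

definition stabilizable :: "real \<Rightarrow> real \<Rightarrow> real^'s^'s \<Rightarrow> real^'c^'s \<Rightarrow> bool" where
  "stabilizable L \<gamma> A B \<longleftrightarrow>
     (\<exists>K. opnorm K \<le> L \<and> (\<forall>t. opnorm (matpow (A - B ** K) t) \<le> L * \<gamma> ^ t))"


section \<open>Cost functions\<close>

definition grad :: "('a::real_inner \<Rightarrow> real) \<Rightarrow> 'a \<Rightarrow> 'a" where
  "grad f x = (THE D. GDERIV f x :> D)"

definition strongly_convex :: "real \<Rightarrow> ('a::real_inner \<Rightarrow> real) \<Rightarrow> bool" where
  "strongly_convex m f \<longleftrightarrow>
     (\<forall>x y. \<forall>\<theta>\<in>{0..1}. f (\<theta> *\<^sub>R x + (1 - \<theta>) *\<^sub>R y)
        \<le> \<theta> * f x + (1 - \<theta>) * f y - m / 2 * \<theta> * (1 - \<theta>) * (norm (x - y))\<^sup>2)"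

definition smooth :: "real \<Rightarrow> ('a::real_inner \<Rightarrow> real) \<Rightarrow> bool" where
  "smooth L f \<longleftrightarrow> (\<forall>x. f differentiable (at x)) \<and> L-lipschitz_on UNIV (grad f)"

definition twice_cont_diff :: "('a::real_normed_vector \<Rightarrow> real) \<Rightarrow> bool" where
  "twice_cont_diff f \<longleftrightarrow>
     (\<exists>(f' :: 'a \<Rightarrow> 'a \<Rightarrow>\<^sub>L real) (f'' :: 'a \<Rightarrow> 'a \<Rightarrow>\<^sub>L ('a \<Rightarrow>\<^sub>L real)).
        (\<forall>x. (f has_derivative blinfun_apply (f' x)) (at x)) \<and>
        (\<forall>x. (f' has_derivative blinfun_apply (f'' x)) (at x)) \<and>
        continuous_on UNIV f'')"

definition regular_cost :: "real \<Rightarrow> real \<Rightarrow> ('a::real_inner \<Rightarrow> real) \<Rightarrow> bool" where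
  "regular_cost \<mu> L f \<longleftrightarrow> strongly_convex \<mu> f \<and> smooth L f \<and> twice_cont_diff f"

definition K_function :: "('a::real_normed_vector \<Rightarrow> real) \<Rightarrow> bool" where
  "K_function F \<longleftrightarrow>
     (\<exists>\<beta>. strict_mono_on {0..} \<beta> \<and> \<beta> 0 = (0::real) \<and> (\<forall>x. F x = \<beta> (norm x)))"


section \<open>The finite-horizon problem and its primal-dual solution\<close>

text \<open>
  Trajectories are functions on the natural numbers, of which only \<open>y 0, ..., y l\<close>,
  \<open>v 0, ..., v (l - 1)\<close>, \<open>lam 0, ..., lam l\<close> and \<open>\<zeta> 0, ..., \<zeta> (l - 1)\<close> are relevant.
\<close>

definition feasible ::
  "real^'s^'s \<Rightarrow> real^'c^'s \<Rightarrow> nat \<Rightarrow> real^'s \<Rightarrow> (nat \<Rightarrow> real^'s) \<Rightarrow>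
   (nat \<Rightarrow> real^'s) \<Rightarrow> (nat \<Rightarrow> real^'c) \<Rightarrow> bool" where
  "feasible A B l x \<zeta> y v \<longleftrightarrow>
     y 0 = x \<and> (\<forall>\<tau><l. y (Suc \<tau>) = A *v y \<tau> + B *v v \<tau> + \<zeta> \<tau>)"

definition objective ::
  "(nat \<Rightarrow> real^'s \<Rightarrow> real) \<Rightarrow> (nat \<Rightarrow> real^'c \<Rightarrow> real) \<Rightarrow> (real^'s \<Rightarrow> real) \<Rightarrow> nat \<Rightarrow> nat \<Rightarrow>
   (nat \<Rightarrow> real^'s) \<Rightarrow> (nat \<Rightarrow> real^'c) \<Rightarrow> real" where
  "objective f c g t l y v =
     (\<Sum>\<tau><l. f (t + \<tau>) (y \<tau>)) + (\<Sum>\<tau>=1..l. c (t + \<tau>) (v (\<tau> - 1))) + g (y l)"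

definition minimizer ::
  "(nat \<Rightarrow> real^'s \<Rightarrow> real) \<Rightarrow> (nat \<Rightarrow> real^'c \<Rightarrow> real) \<Rightarrow> (real^'s \<Rightarrow> real) \<Rightarrow>
   real^'s^'s \<Rightarrow> real^'c^'s \<Rightarrow> nat \<Rightarrow> nat \<Rightarrow> real^'s \<Rightarrow> (nat \<Rightarrow> real^'s) \<Rightarrow>
   (nat \<Rightarrow> real^'s) \<Rightarrow> (nat \<Rightarrow> real^'c) \<Rightarrow> bool" where
  "minimizer f c g A B t l x \<zeta> y v \<longleftrightarrow> feasible A B l x \<zeta> y v \<and>
     (\<forall>y' v'. feasible A B l x \<zeta> y' v' \<longrightarrow> objective f c g t l y v \<le> objective f c g t l y' v')"

text \<open>
  The constraint matrix \<open>J(A,B)\<close> by blocks: \<open>J_y A r \<tau>\<close> and \<open>J_v B r \<tau>\<close> are the blocks in block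
  row \<open>r\<close> and in the block columns of \<open>y \<tau>\<close> and of \<open>v \<tau>\<close>.
\<close>

definition J_y :: "real^'s^'s \<Rightarrow> nat \<Rightarrow> nat \<Rightarrow> real^'s^'s" where
  "J_y A r \<tau> = (if r = \<tau> then mat 1 else if r = Suc \<tau> then - A else 0)"

definition J_v :: "real^'c^'s \<Rightarrow> nat \<Rightarrow> nat \<Rightarrow> real^'c^'s" where
  "J_v B r \<tau> = (if r = Suc \<tau> then - B else 0)"

definition stationary ::
  "(nat \<Rightarrow> real^'s \<Rightarrow> real) \<Rightarrow> (nat \<Rightarrow> real^'c \<Rightarrow> real) \<Rightarrow> (real^'s \<Rightarrow> real) \<Rightarrow>
   real^'s^'s \<Rightarrow> real^'c^'s \<Rightarrow> nat \<Rightarrow> nat \<Rightarrow>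
   (nat \<Rightarrow> real^'s) \<Rightarrow> (nat \<Rightarrow> real^'c) \<Rightarrow> (nat \<Rightarrow> real^'s) \<Rightarrow> bool" where
  "stationary f c g A B t l y v lam \<longleftrightarrow>
     (\<forall>\<tau>\<le>l. grad (\<lambda>\<eta>. objective f c g t l (y(\<tau> := \<eta>)) v) (y \<tau>)
             + (\<Sum>r\<le>l. transpose (J_y A r \<tau>) *v lam r) = 0) \<and>
     (\<forall>\<tau><l. grad (\<lambda>\<eta>. objective f c g t l y (v(\<tau> := \<eta>))) (v \<tau>)
             + (\<Sum>r\<le>l. transpose (J_v B r \<tau>) *v lam r) = 0)"

definition primal_dual_solution ::
  "(nat \<Rightarrow> real^'s \<Rightarrow> real) \<Rightarrow> (nat \<Rightarrow> real^'c \<Rightarrow> real) \<Rightarrow> (real^'s \<Rightarrow> real) \<Rightarrow>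
   real^'s^'s \<Rightarrow> real^'c^'s \<Rightarrow> nat \<Rightarrow> nat \<Rightarrow> real^'s \<Rightarrow> (nat \<Rightarrow> real^'s) \<Rightarrow>
   (nat \<Rightarrow> real^'s) \<Rightarrow> (nat \<Rightarrow> real^'c) \<Rightarrow> (nat \<Rightarrow> real^'s) \<Rightarrow> bool" where
  "primal_dual_solution f c g A B t l x \<zeta> y v lam \<longleftrightarrow>
     minimizer f c g A B t l x \<zeta> y v \<and> stationary f c g A B t l y v lam"

lemma feasible_iff_J:
  fixes A :: "real^'s^'s" and B :: "real^'c^'s"
  shows "feasible A B l x \<zeta> y v \<longleftrightarrow>
    (\<forall>r\<le>l. (\<Sum>\<tau>\<le>l. J_y A r \<tau> *v y \<tau>) + (\<Sum>\<tau><l. J_v B r \<tau> *v v \<tau>)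
            = (case r of 0 \<Rightarrow> x | Suc \<tau> \<Rightarrow> \<zeta> \<tau>))"
proof -
  have neg: "(- M) *v u = - (M *v u)" for M :: "real^'a^'b" and u
    by (simp add: matrix_vector_mult_def vec_eq_iff sum_negf)
  have y0: "(\<Sum>\<tau>\<le>l. J_y A 0 \<tau> *v y \<tau>) = y 0"
  proof -
    have "(\<Sum>\<tau>\<le>l. J_y A 0 \<tau> *v y \<tau>) = (\<Sum>\<tau>\<le>l. if \<tau> = 0 then y \<tau> else 0)"
      by (intro sum.cong) (auto simp: J_y_def)
    then show ?thesis by (simp add: sum.delta)
  qed
  have v0: "(\<Sum>\<tau><l. J_v B 0 \<tau> *v v \<tau>) = 0"
    by (simp add: J_v_def)
  have yS: "(\<Sum>\<tau>\<le>l. J_y A (Suc r) \<tau> *v y \<tau>) = y (Suc r) - A *v y r" if "r < l" for r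
  proof -
    have "(\<Sum>\<tau>\<le>l. J_y A (Suc r) \<tau> *v y \<tau>)
        = (\<Sum>\<tau>\<le>l. (if \<tau> = Suc r then y \<tau> else 0) + (if \<tau> = r then - (A *v y \<tau>) else 0))"
      by (intro sum.cong) (auto simp: J_y_def neg)
    then show ?thesis using that by (simp add: sum.distrib sum.delta)
  qed
  have vS: "(\<Sum>\<tau><l. J_v B (Suc r) \<tau> *v v \<tau>) = - (B *v v r)" if "r < l" for r
  proof -
    have "(\<Sum>\<tau><l. J_v B (Suc r) \<tau> *v v \<tau>) = (\<Sum>\<tau><l. if \<tau> = r then - (B *v v \<tau>) else 0)"
      by (intro sum.cong) (auto simp: J_v_def neg)
    then show ?thesis using that by (simp add: sum.delta)
  qed
  have split: "(\<forall>r\<le>l. P r) \<longleftrightarrow> P 0 \<and> (\<forall>r<l. P (Suc r))" for P :: "nat \<Rightarrow> bool"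
    by (metis Suc_le_eq not0_implies_Suc zero_le)
  show ?thesis
    unfolding split feasible_def by (auto simp: y0 v0 yS vS algebra_simps)
qed

text \<open>
  \<open>node_norm xn un i l y v lam\<close> is the norm of \<open>q[i]\<close> for \<open>q = (y, v, lam)\<close>.
\<close>

definition node_norm ::
  "('s \<Rightarrow> 'n) \<Rightarrow> ('c \<Rightarrow> 'n) \<Rightarrow> 'n \<Rightarrow> nat \<Rightarrow>
   (nat \<Rightarrow> real^'s) \<Rightarrow> (nat \<Rightarrow> real^'c) \<Rightarrow> (nat \<Rightarrow> real^'s) \<Rightarrow> real" where
  "node_norm xn un i l y v lam =
     sqrt ((\<Sum>\<tau>\<le>l. (norm (keep xn {i} (y \<tau>)))\<^sup>2) + (\<Sum>\<tau><l. (norm (keep un {i} (v \<tau>)))\<^sup>2)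
           + (\<Sum>\<tau>\<le>l. (norm (keep xn {i} (lam \<tau>)))\<^sup>2))"

definition dist_budget :: "(nat \<Rightarrow> real^'s) \<Rightarrow> nat \<Rightarrow> nat \<Rightarrow> real" where
  "dist_budget w T l = Max ((\<lambda>t. \<Sum>\<tau><l. norm (w (t + \<tau>))) ` {0..T - 1})"


section \<open>Constants\<close>

definition mu_J :: "real \<Rightarrow> real \<Rightarrow> real" where
  "mu_J L \<gamma> = (1 - \<gamma>)\<^sup>2 / (L\<^sup>2 * (1 + L\<^sup>2))"

definition L_H :: "real \<Rightarrow> real" where
  "L_H L = 2 * L + 1"

definition mu_H :: "real \<Rightarrow> real \<Rightarrow> real \<Rightarrow> real" where
  "mu_H L \<gamma> \<mu> =
     inverse (1 / \<mu> + (1 + 2 * L_H L / \<mu> + (L_H L)\<^sup>2 / \<mu>\<^sup>2) * (L_H L / mu_J L \<gamma>))"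

definition decay_rho :: "real \<Rightarrow> real \<Rightarrow> real \<Rightarrow> real" where
  "decay_rho L \<gamma> \<mu> =
     sqrt (((L_H L)\<^sup>2 - (mu_H L \<gamma> \<mu>)\<^sup>2) / ((L_H L)\<^sup>2 + (mu_H L \<gamma> \<mu>)\<^sup>2))"

definition decay_alpha :: "real \<Rightarrow> real \<Rightarrow> real \<Rightarrow> real" where
  "decay_alpha L \<gamma> \<mu> = L_H L / ((mu_H L \<gamma> \<mu>)\<^sup>2 * decay_rho L \<gamma> \<mu>)"

definition delta_S :: "real \<Rightarrow> real \<Rightarrow> real \<Rightarrow> real" where
  "delta_S L \<gamma> \<mu> = (decay_rho L \<gamma> \<mu> + 1) / 2"

definition Gamma_const :: "real \<Rightarrow> real \<Rightarrow> real \<Rightarrow> (nat \<Rightarrow> real) \<Rightarrow> real" where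
  "Gamma_const L \<gamma> \<mu> p =
     4 * (decay_alpha L \<gamma> \<mu>)\<^sup>2 * delta_S L \<gamma> \<mu> * L / (1 - delta_S L \<gamma> \<mu>)\<^sup>2
     * (SUP d. (decay_rho L \<gamma> \<mu> / delta_S L \<gamma> \<mu>) ^ d * p d)\<^sup>2 * p 1"

end

theory Submission
  imports Defs "HOL-Library.Poly_Mapping"
begin

text \<open>
  Both solutions satisfy an optimality system with a saddle point operator \<open>H\<close>, in which the gradient
  differences are written as \<open>G\<close> applied to the difference of the solutions, with \<open>G\<close> symmetric,
  node-local and between \<open>\<mu>\<close> and \<open>L\<close>. The operator \<open>H\<close> couples only neighbouring nodes, and its
  singular values lie between \<open>mu_H\<close> and \<open>L_H\<close>. The difference \<open>e\<close> of the two solutions solves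
  \<open>H e = r\<close>, where the residual \<open>r\<close> only involves nodes at distance at least \<open>\<kappa>\<close> from \<open>i\<close> and is bounded
  by the norm of the truncated solution, hence by the data. About \<open>\<kappa> / 2\<close> steps of the Neumann
  iteration for \<open>H\<^sup>2\<close>, each contracting by \<open>\<rho>\<^sup>2\<close>, do not propagate \<open>r\<close> to node \<open>i\<close>, so the block of
  \<open>e\<close> at \<open>i\<close> is of order \<open>\<rho>\<^sup>\<kappa>\<close>. The supremum and \<open>p 1\<close> in \<open>\<Gamma>\<close> only matter through being at least
  \<open>1\<close> unless the truncation changes nothing in the component of \<open>i\<close>, when the error vanishes.
\<close>

section \<open>Finitely supported sequences as an inner product space\<close>

\<comment> \<open>\<open>H\<close> is indefinite, so an iteration with \<open>I - c H\<close> does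
  not contract. The square of \<open>H\<close> is positive definite with spectrum between the
  squares of \<open>mu_H\<close> and \<open>L_H\<close>, and the best step size for it gives a
  contraction factor that is exactly the square of \<rho>. One step with the square of
  \<open>H\<close> spreads information over two edges, which makes \<rho> the rate per edge. Two
  obstacles shape the rest. The gradients are nonlinear; a secant operator between two given points
  makes the difference of two solutions satisfy an exact linear system without losing symmetry or
  locality. As all costs are minimal at 0, the same device with the zero trajectory as second point
  bounds a single solution by its data. Moreover, no constant may depend on the horizon: the lower
  bound for \<open>H\<close> rests on a right inverse of \<open>J\<close> whose norm is controlled
  by the geometric decay of a closed loop, uniformly in the number of time steps.\<close>
alias lookup = Poly_Mapping.lookup
alias keys = Poly_Mapping.keys

text \<open>The horizon \<open>l\<close> is a variable of the statement and so cannot be the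
  dimension of a vector type. Finitely supported sequences house the trajectories of every horizon
  in one inner product space.\<close>

instantiation poly_mapping :: (type, real_vector) real_vector
begin

lift_definition scaleR_poly_mapping :: "real \<Rightarrow> ('a \<Rightarrow>\<^sub>0 'b) \<Rightarrow> 'a \<Rightarrow>\<^sub>0 'b"
  is "\<lambda>r f k. r *\<^sub>R f k"
  by (erule finite_subset[rotated]) auto

instance
  by standard (transfer; simp add: fun_eq_iff algebra_simps)+

end

lemma lookup_scaleR [simp]: "lookup (r *\<^sub>R f) k = r *\<^sub>R lookup f k"
  by transfer simp

instantiation poly_mapping :: (type, real_inner) real_inner
begin

definition inner_poly_mapping_def:
  "inner f g = (\<Sum>k\<in>keys f. inner (lookup f k) (lookup g k))" for f g :: "'a \<Rightarrow>\<^sub>0 'b"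

definition norm_poly_mapping_def:
  "norm f = sqrt (inner f f)" for f :: "'a \<Rightarrow>\<^sub>0 'b"

definition sgn_poly_mapping_def:
  "sgn f = inverse (norm f) *\<^sub>R f" for f :: "'a \<Rightarrow>\<^sub>0 'b"

definition dist_poly_mapping_def:
  "dist f g = norm (f - g)" for f g :: "'a \<Rightarrow>\<^sub>0 'b"

definition uniformity_poly_mapping_def [code del]:
  "(uniformity :: (('a \<Rightarrow>\<^sub>0 'b) \<times> ('a \<Rightarrow>\<^sub>0 'b)) filter) =
    (INF e\<in>{0 <..}. principal {(x, y). dist x y < e})"

definition open_poly_mapping_def [code del]:
  "open U \<longleftrightarrow> (\<forall>x\<in>U. eventually (\<lambda>(x', y). x' = x \<longrightarrow> y \<in> U) uniformity)"
  for U :: "('a \<Rightarrow>\<^sub>0 'b) set"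

lemma inner_poly_mapping_superset:
  fixes f g :: "'a \<Rightarrow>\<^sub>0 'b"
  assumes "finite K" "keys f \<subseteq> K"
  shows "inner f g = (\<Sum>k\<in>K. inner (lookup f k) (lookup g k))"
  unfolding inner_poly_mapping_def
  by (rule sum.mono_neutral_left) (use assms in \<open>auto simp: in_keys_iff\<close>)

instance
proof
  fix f g h :: "'a \<Rightarrow>\<^sub>0 'b" and r :: real
  show "dist f g = norm (f - g)" by (rule dist_poly_mapping_def)
  show "sgn f = inverse (norm f) *\<^sub>R f" by (rule sgn_poly_mapping_def)
  show "(uniformity :: (('a \<Rightarrow>\<^sub>0 'b) \<times> ('a \<Rightarrow>\<^sub>0 'b)) filter)
      = (INF e\<in>{0 <..}. principal {(x, y). dist x y < e})"
    by (rule uniformity_poly_mapping_def)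
  show "open U \<longleftrightarrow> (\<forall>x\<in>U. eventually (\<lambda>(x', y). x' = x \<longrightarrow> y \<in> U) uniformity)"
    for U :: "('a \<Rightarrow>\<^sub>0 'b) set"
    by (rule open_poly_mapping_def)
  show "norm f = sqrt (inner f f)" by (rule norm_poly_mapping_def)
  let ?K = "keys f \<union> keys g \<union> keys (f + g) \<union> keys (r *\<^sub>R f)"
  have inner_eq: "inner a b = (\<Sum>k\<in>?K. inner (lookup a k) (lookup b k))"
    if "keys a \<subseteq> ?K" for a b :: "'a \<Rightarrow>\<^sub>0 'b"
    using that by (intro inner_poly_mapping_superset) auto
  show "inner f g = inner g f"
    by (simp add: inner_eq Un_assoc le_supI1 le_supI2 inner_commute)
  have "inner (f + g) h = (\<Sum>k\<in>?K. inner (lookup (f + g) k) (lookup h k))"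
    by (intro inner_eq) auto
  also have "\<dots> = (\<Sum>k\<in>?K. inner (lookup f k) (lookup h k))
      + (\<Sum>k\<in>?K. inner (lookup g k) (lookup h k))"
    by (simp add: lookup_add inner_add_left sum.distrib)
  also have "\<dots> = inner f h + inner g h"
    by (intro arg_cong2[where f = "(+)"] inner_eq[symmetric]) auto
  finally show "inner (f + g) h = inner f h + inner g h" .
  have "inner (r *\<^sub>R f) h = (\<Sum>k\<in>?K. inner (lookup (r *\<^sub>R f) k) (lookup h k))"
    by (intro inner_eq) auto
  also have "\<dots> = r * (\<Sum>k\<in>?K. inner (lookup f k) (lookup h k))"
    by (simp add: sum_distrib_left)
  also have "\<dots> = r * inner f h"
    by (intro arg_cong2[where f = "(*)"] inner_eq[symmetric]) auto
  finally show "inner (r *\<^sub>R f) h = r * inner f h" .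
  show "0 \<le> inner f f"
    unfolding inner_poly_mapping_def by (intro sum_nonneg) simp
  show "inner f f = 0 \<longleftrightarrow> f = 0"
    unfolding inner_poly_mapping_def
    by (subst sum_nonneg_eq_0_iff) (auto simp: in_keys_iff poly_mapping_eq_iff fun_eq_iff)
qed

end

definition trunc :: "nat \<Rightarrow> (nat \<Rightarrow> 'a) \<Rightarrow> nat \<Rightarrow>\<^sub>0 'a::zero" where
  "trunc n f = Abs_poly_mapping (\<lambda>k. if k < n then f k else 0)"

lemma lookup_trunc [simp]: "lookup (trunc n f) k = (if k < n then f k else 0)"
  unfolding trunc_def by (subst lookup_Abs_poly_mapping) (auto intro: finite_subset[of _ "{..<n}"])

lemma trunc_add: "trunc n (\<lambda>k. f k + g k) = trunc n f + trunc n (g :: nat \<Rightarrow> 'a::monoid_add)"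
  by (rule poly_mapping_eqI) (simp add: lookup_add)

lemma trunc_diff: "trunc n (\<lambda>k. f k - g k) = trunc n f - trunc n (g :: nat \<Rightarrow> 'a::ab_group_add)"
  by (rule poly_mapping_eqI) (simp add: lookup_minus)

text \<open>Spectral estimates are stated relative to such subspaces: the operators below ignore
  entries far beyond the horizon, so on the whole space they have a kernel and no lower
  bound.\<close>

definition supported :: "nat \<Rightarrow> (nat \<Rightarrow>\<^sub>0 'a::zero) set" where
  "supported n = {f. \<forall>k\<ge>n. lookup f k = 0}"

lemma trunc_in_supported [simp]: "trunc n f \<in> supported n"
  by (simp add: supported_def)

lemma trunc_lookup: "f \<in> supported n \<Longrightarrow> trunc n (lookup f) = f"
  by (rule poly_mapping_eqI) (simp add: supported_def)

lemma subspace_supported: "subspace (supported n :: (nat \<Rightarrow>\<^sub>0 'a::real_vector) set)"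
  by (simp add: subspace_def supported_def lookup_add)

lemma inner_supported:
  assumes "f \<in> supported n"
  shows "inner f g = (\<Sum>k<n. inner (lookup f k) (lookup g k))"
  by (rule inner_poly_mapping_superset)
     (use assms in \<open>auto simp: supported_def in_keys_iff not_le[symmetric]\<close>)

lemma inner_trunc: "inner (trunc n f) (trunc n g) = (\<Sum>k<n. inner (f k) (g k))"
  by (simp add: inner_supported[of _ n])

lemma norm_trunc: "norm (trunc n f) = L2_set (\<lambda>k. norm (f k)) {..<n}"
  by (simp add: norm_eq_sqrt_inner inner_trunc L2_set_def)

lemma norm_supported: "f \<in> supported n \<Longrightarrow> norm f = L2_set (\<lambda>k. norm (lookup f k)) {..<n}"
  by (metis norm_trunc trunc_lookup)

section \<open>Self-adjoint operators\<close>

text \<open>Polarization writes \<open>H x \<bullet> y\<close> as a difference of two values of the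
  quadratic form. For \<open>y\<close> parallel to \<open>H x\<close> and as long as
  \<open>x\<close>, the parallelogram law turns the bounds on these values into
  \<open>r * (norm x)\<^sup>2\<close>.\<close>

lemma selfadjoint_norm_le:
  fixes H :: "'a::real_inner \<Rightarrow> 'a"
  assumes lin: "linear H" and V: "subspace V" "\<And>x. x \<in> V \<Longrightarrow> H x \<in> V"
    and sym: "\<And>x y. x \<in> V \<Longrightarrow> y \<in> V \<Longrightarrow> H x \<bullet> y = x \<bullet> H y"
    and bound: "\<And>x. x \<in> V \<Longrightarrow> \<bar>H x \<bullet> x\<bar> \<le> r * (norm x)\<^sup>2"
    and x: "x \<in> V"
  shows "norm (H x) \<le> r * norm x"
proof (cases "H x = 0")
  case True
  have "0 \<le> r * (norm x)\<^sup>2" using bound[OF x] by linarith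
  then show ?thesis
    using True by (cases "x = 0") (auto simp: zero_le_mult_iff)
next
  case False
  then have nz: "norm (H x) > 0" and xnz: "norm x > 0"
    using linear_0[OF lin] by auto
  define y where "y = (norm x / norm (H x)) *\<^sub>R H x"
  have y: "y \<in> V" unfolding y_def by (intro subspace_scale V x)
  have ny: "norm y = norm x" using nz by (simp add: y_def)
  have "4 * (H x \<bullet> y) = H (x + y) \<bullet> (x + y) - H (x - y) \<bullet> (x - y)"
    using sym[OF x y] by (simp add: linear_add[OF lin] linear_diff[OF lin] algebra_simps inner_commute)
  also have "\<dots> \<le> r * (norm (x + y))\<^sup>2 + r * (norm (x - y))\<^sup>2"
    using bound[of "x + y"] bound[of "x - y"] subspace_add[OF V(1) x y] subspace_diff[OF V(1) x y]
    by linarith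
  also have "\<dots> = 4 * (r * (norm x)\<^sup>2)"
    using ny unfolding power2_norm_eq_inner
    by (simp add: norm_eq_sqrt_inner algebra_simps inner_commute)
  finally have "H x \<bullet> y \<le> r * (norm x)\<^sup>2" by simp
  moreover have "H x \<bullet> y = norm x * norm (H x)"
    using nz by (simp add: y_def dot_square_norm power2_eq_square)
  ultimately show ?thesis
    using xnz by (simp add: power2_eq_square)
qed

text \<open>
  The sets \<open>Z n\<close> play the role of the vectors vanishing within distance less than \<open>n\<close> of a fixed
  node, so \<open>H\<close> couples neighbours only. With \<open>c = 2 / (M\<^sup>2 + m\<^sup>2)\<close> the map \<open>P = I - c H\<^sup>2\<close> is a
  contraction, and \<open>e - P\<^sup>n e\<close> is a polynomial in \<open>H\<close> of degree at most \<open>2 n - 1\<close>, applied to \<open>H e\<close>.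
\<close>

lemma banded_inverse_decay:
  fixes H :: "'a::real_inner \<Rightarrow> 'a" and Z :: "nat \<Rightarrow> 'a set"
  assumes lin: "linear H" and V: "subspace V" "\<And>x. x \<in> V \<Longrightarrow> H x \<in> V"
    and sym: "\<And>x y. x \<in> V \<Longrightarrow> y \<in> V \<Longrightarrow> H x \<bullet> y = x \<bullet> H y"
    and lower: "\<And>x. x \<in> V \<Longrightarrow> m * norm x \<le> norm (H x)"
    and upper: "\<And>x. x \<in> V \<Longrightarrow> norm (H x) \<le> M * norm x"
    and m: "0 < m" "0 \<le> M"
    and Z: "\<And>n. subspace (Z n)" "\<And>n. Z (Suc n) \<subseteq> Z n"
      "\<And>n x. x \<in> V \<Longrightarrow> x \<in> Z (Suc n) \<Longrightarrow> H x \<in> Z n"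
    and e: "e \<in> V" "H e \<in> Z \<kappa>" and n: "2 * n \<le> \<kappa>"
  obtains e' where "e' \<in> V" "e - e' \<in> Z 1"
    "norm e' \<le> ((M\<^sup>2 - m\<^sup>2) / (M\<^sup>2 + m\<^sup>2)) ^ n * norm e"
proof -
  define c where "c = 2 / (M\<^sup>2 + m\<^sup>2)"
  define q where "q = (M\<^sup>2 - m\<^sup>2) / (M\<^sup>2 + m\<^sup>2)"
  define P where "P x = x - c *\<^sub>R H (H x)" for x
  have pos: "M\<^sup>2 + m\<^sup>2 > 0" using m by (simp add: add_nonneg_pos)
  \<comment> \<open>The choice of \<open>c\<close> balances the two ends: the interval from
    \<open>m\<^sup>2\<close> to \<open>M\<^sup>2\<close> is mapped to the symmetric interval from
    \<open>-q\<close> to \<open>q\<close>.\<close>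
  have q1: "1 - c * M\<^sup>2 = - q" "1 - c * m\<^sup>2 = q"
    using pos[THEN less_imp_neq] by (auto simp: c_def q_def field_simps)
  have linP: "linear P"
    unfolding P_def
    by (intro linear_compose_sub linear_id[unfolded id_def] linear_compose_scale_right
        linear_compose[OF lin lin, unfolded o_def])
  have PV: "P x \<in> V" if "x \<in> V" for x
    unfolding P_def using that by (intro subspace_diff subspace_scale V)
  have P_norm: "norm (P x) \<le> q * norm x" if x: "x \<in> V" for x
  proof (rule selfadjoint_norm_le[OF linP V(1) PV _ _ x])
    show "P a \<bullet> b = a \<bullet> P b" if "a \<in> V" "b \<in> V" for a b
      using that sym[of "H a" b] sym[of a "H b"] V(2)
      by (simp add: P_def inner_diff_left inner_diff_right)
    show "\<bar>P a \<bullet> a\<bar> \<le> q * (norm a)\<^sup>2" if a: "a \<in> V" for a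
    proof -
      have eq: "P a \<bullet> a = (norm a)\<^sup>2 - c * (norm (H a))\<^sup>2"
        using sym[of "H a" a] V(2) a
        by (simp add: P_def inner_diff_left power2_norm_eq_inner)
      have c0: "c \<ge> 0" using pos by (simp add: c_def)
      have "(m * norm a)\<^sup>2 \<le> (norm (H a))\<^sup>2"
        using lower[OF a] m by (intro power_mono) auto
      then have 1: "c * (m\<^sup>2 * (norm a)\<^sup>2) \<le> c * (norm (H a))\<^sup>2"
        using c0 by (intro mult_left_mono) (simp_all add: power_mult_distrib)
      have "(norm (H a))\<^sup>2 \<le> (M * norm a)\<^sup>2"
        using upper[OF a] by (intro power_mono) auto
      then have 2: "c * (norm (H a))\<^sup>2 \<le> c * (M\<^sup>2 * (norm a)\<^sup>2)"
        using c0 by (intro mult_left_mono) (simp_all add: power_mult_distrib)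
      have 3: "(norm a)\<^sup>2 - c * (M\<^sup>2 * (norm a)\<^sup>2) = (1 - c * M\<^sup>2) * (norm a)\<^sup>2"
        "(norm a)\<^sup>2 - c * (m\<^sup>2 * (norm a)\<^sup>2) = (1 - c * m\<^sup>2) * (norm a)\<^sup>2"
        by (simp_all add: algebra_simps)
      show ?thesis
        using 1 2 3 unfolding eq q1 by (simp add: abs_le_iff)
    qed
  qed
  have antimono: "Z b \<subseteq> Z a" if "a \<le> b" for a b
    using lift_Suc_antimono_le[of Z] Z(2) that by blast
  \<comment> \<open>The index starts at \<open>\<kappa> + 1\<close> instead of
    \<open>\<kappa>\<close> because \<open>e - P e = c H (H e)\<close> and one of the two factors is
    already contained in the hypothesis on \<open>H e\<close>. It is still at least 1 when
    \<open>2 * j\<close> reaches \<open>\<kappa>\<close>.\<close>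
  have step: "(P ^^ j) e \<in> V \<and> e - (P ^^ j) e \<in> Z (\<kappa> + 1 - 2 * j) \<and> norm ((P ^^ j) e) \<le> q ^ j * norm e"
    if "2 * j \<le> \<kappa>" for j
    using that
  proof (induction j)
    case 0
    then show ?case using e Z(1) by (simp add: subspace_0)
  next
    case (Suc j)
    define y where "y = (P ^^ j) e"
    have IH: "y \<in> V" "e - y \<in> Z (\<kappa> + 1 - 2 * j)" "norm y \<le> q ^ j * norm e"
      using Suc by (auto simp: y_def)
    define k where "k = \<kappa> - 1 - 2 * j"
    have k: "\<kappa> + 1 - 2 * j = Suc (Suc k)" "\<kappa> + 1 - 2 * Suc j = k"
      using Suc.prems by (auto simp: k_def)
    have eyV: "e - y \<in> V" using e IH V by (simp add: subspace_diff)
    have "H (e - y) \<in> Z (Suc k)" using Z(3)[OF eyV] IH(2) unfolding k by blast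
    then have "H (H (e - y)) \<in> Z k" using Z(3) V(2)[OF eyV] by blast
    moreover have "e - y \<in> Z k" using IH(2) antimono[of k "Suc (Suc k)"] unfolding k by auto
    ultimately have 1: "P (e - y) \<in> Z k"
      unfolding P_def by (simp add: subspace_diff[OF Z(1)] subspace_scale[OF Z(1)])
    have "Suc k \<le> \<kappa>" using Suc.prems by (simp add: k_def)
    then have "H e \<in> Z (Suc k)" using e(2) antimono by blast
    then have "H (H e) \<in> Z k" using Z(3) V(2) e(1) by blast
    then have "P (e - y) + c *\<^sub>R H (H e) \<in> Z k"
      using 1 by (simp add: subspace_add[OF Z(1)] subspace_scale[OF Z(1)])
    moreover have "P (e - y) + c *\<^sub>R H (H e) = e - P y"
      unfolding linear_diff[OF linP] by (simp add: P_def)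
    ultimately have 2: "e - P y \<in> Z k" by simp
    have "norm (P y) \<le> q * norm y" by (rule P_norm) fact
    \<comment> \<open>The relation \<open>m \<le> M\<close> is not among the hypotheses;
      \<open>0 \<le> q\<close> is read off from \<open>P_norm\<close> at a nonzero vector.\<close>
    also have "\<dots> \<le> q * (q ^ j * norm e)"
    proof (cases "norm y = 0")
      case True
      show ?thesis
      proof (cases "e = 0")
        case False
        have "0 \<le> q * norm e" using P_norm[OF e(1)] norm_ge_zero order_trans by blast
        then have "0 \<le> q" using False by (simp add: zero_le_mult_iff)
        then show ?thesis using True by simp
      qed (use True in simp)
    next
      case False
      have "0 \<le> q * norm y" using P_norm[OF IH(1)] norm_ge_zero order_trans by blast
      then have "0 \<le> q" using False by (simp add: zero_le_mult_iff)
      then show ?thesis using IH(3) by (rule mult_left_mono[rotated])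
    qed
    finally show ?case
      using 2 PV[OF IH(1)] unfolding k(2) by (simp add: y_def mult.assoc)
  qed
  have "\<kappa> + 1 - 2 * n \<ge> 1" using n by simp
  then have "e - (P ^^ n) e \<in> Z 1"
    using step[OF n] antimono by blast
  then show ?thesis
    using that[of "(P ^^ n) e"] step[OF n] by (simp add: q_def)
qed

section \<open>Saddle point operators\<close>

definition kkt :: "('z \<Rightarrow> 'z) \<Rightarrow> ('z \<Rightarrow> 'w) \<Rightarrow> ('w \<Rightarrow> 'z) \<Rightarrow> 'z \<times> 'w \<Rightarrow> 'z::real_inner \<times> 'w::real_inner" where
  "kkt G J Jt q = (G (fst q) + Jt (snd q), J (fst q))"

text \<open>\<open>m\<close> bounds \<open>J Jt\<close> from below and becomes \<open>mu_J\<close>.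
  The bound on \<open>h\<close> is the one that \<open>J_op_norm_le\<close> provides; it lies below
  \<open>L_H L\<close>, and this gap is what leaves room for the block \<open>G\<close> in the upper
  bound of \<open>H\<close>.\<close>

locale saddle =
  fixes G :: "'z::real_inner \<Rightarrow> 'z" and J :: "'z \<Rightarrow> 'w::real_inner" and Jt :: "'w \<Rightarrow> 'z"
    and U :: "'z set" and W :: "'w set" and \<mu> L h m :: real
  assumes linear: "linear G" "linear J" "linear Jt"
    and subspaces: "subspace U" "subspace W"
    and maps: "\<And>z. z \<in> U \<Longrightarrow> G z \<in> U" "\<And>z. z \<in> U \<Longrightarrow> J z \<in> W" "\<And>w. w \<in> W \<Longrightarrow> Jt w \<in> U"
    and G_sym: "\<And>z z'. z \<in> U \<Longrightarrow> z' \<in> U \<Longrightarrow> G z \<bullet> z' = z \<bullet> G z'"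
    and adjoint: "\<And>z w. z \<in> U \<Longrightarrow> w \<in> W \<Longrightarrow> J z \<bullet> w = z \<bullet> Jt w"
    and G_lower: "\<And>z. z \<in> U \<Longrightarrow> \<mu> * (norm z)\<^sup>2 \<le> G z \<bullet> z"
    and G_upper: "\<And>z. z \<in> U \<Longrightarrow> G z \<bullet> z \<le> L * (norm z)\<^sup>2"
    and J_upper: "\<And>z. z \<in> U \<Longrightarrow> norm (J z) \<le> h * norm z"
    and Jt_lower: "\<And>w. w \<in> W \<Longrightarrow> m * (norm w)\<^sup>2 \<le> (norm (Jt w))\<^sup>2"
    and pos: "0 < \<mu>" "1 < L" "0 < m" "m < 1 / 2"
    and h: "0 \<le> h" "h \<le> 1 + sqrt 2 * L"
begin

abbreviation "H \<equiv> kkt G J Jt"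

lemma linear_H: "linear H"
  unfolding kkt_def
  by (intro linearI)
     (simp_all add: linear_add[OF linear(1)] linear_add[OF linear(2)] linear_add[OF linear(3)]
       linear_cmul[OF linear(1)] linear_cmul[OF linear(2)] linear_cmul[OF linear(3)] algebra_simps)

lemma subspace_UW: "subspace (U \<times> W)"
  using subspaces by (rule subspace_Times)

lemma H_maps: "q \<in> U \<times> W \<Longrightarrow> H q \<in> U \<times> W"
  unfolding kkt_def by (auto intro!: subspace_add subspaces maps)

lemma H_sym: "q \<in> U \<times> W \<Longrightarrow> q' \<in> U \<times> W \<Longrightarrow> H q \<bullet> q' = q \<bullet> H q'"
  unfolding kkt_def inner_prod_def
  using adjoint[of "fst q" "snd q'"] adjoint[of "fst q'" "snd q"] G_sym[of "fst q" "fst q'"]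
  by (auto simp: inner_add_left inner_add_right inner_commute)

lemma h_le: "h \<le> L_H L"
proof -
  have "sqrt 2 \<le> 2" by (rule real_le_lsqrt) auto
  then have "sqrt 2 * L \<le> 2 * L" using pos by (intro mult_right_mono) auto
  then show ?thesis using h by (simp add: L_H_def)
qed

text \<open>
  The norm of the matrix \<open>[[L, h], [h, 0]]\<close> is at most \<open>2 L + 1\<close> because \<open>h\<^sup>2 \<le> (L + 1) (2 L + 1)\<close>.
\<close>

lemma H_upper:
  assumes "q \<in> U \<times> W"
  shows "norm (H q) \<le> L_H L * norm q"
proof (rule selfadjoint_norm_le[OF linear_H subspace_UW H_maps H_sym _ assms])
  fix q assume q: "q \<in> U \<times> W"
  obtain z w where [simp]: "q = (z, w)" and z: "z \<in> U" and w: "w \<in> W"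
    using q by auto
  have "H q \<bullet> q = G z \<bullet> z + 2 * (J z \<bullet> w)"
    using adjoint[OF z w]
    by (simp add: kkt_def inner_add_left inner_add_right inner_commute[of w] inner_commute[of z])
  moreover have "0 \<le> G z \<bullet> z"
    using G_lower[OF z] pos by (meson order_trans mult_nonneg_nonneg less_imp_le zero_le_power2)
  moreover note G_upper[OF z]
  moreover have "\<bar>J z \<bullet> w\<bar> \<le> h * norm z * norm w"
    using Cauchy_Schwarz_ineq2[of "J z" w] J_upper[OF z]
    by (meson order_trans mult_right_mono norm_ge_zero)
  ultimately have "\<bar>H q \<bullet> q\<bar> \<le> L * (norm z)\<^sup>2 + 2 * (h * norm z * norm w)"
    by linarith
  also have "\<dots> \<le> L_H L * ((norm z)\<^sup>2 + (norm w)\<^sup>2)"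
  proof -
    define a b where "a = norm z" and "b = norm w"
    have ab: "0 \<le> a" "0 \<le> b" by (auto simp: a_def b_def)
    have "h\<^sup>2 \<le> (1 + sqrt 2 * L)\<^sup>2" using h by (intro power_mono)
    also have "\<dots> = 1 + 2 * sqrt 2 * L + 2 * L\<^sup>2"
      by (simp add: power2_sum power_mult_distrib)
    also have "\<dots> \<le> (L + 1) * (2 * L + 1)"
    proof -
      have "sqrt 2 \<le> 3 / 2" by (rule real_le_lsqrt) (auto simp: power2_eq_square)
      then have "sqrt 2 * (2 * L) \<le> 3 / 2 * (2 * L)" using pos by (intro mult_right_mono) auto
      then show ?thesis by (simp add: algebra_simps power2_eq_square)
    qed
    finally have h2: "h\<^sup>2 \<le> (L + 1) * (2 * L + 1)" .
    have "(2 * L + 1) * (2 * (h * a * b)) \<le> (h * a)\<^sup>2 + ((2 * L + 1) * b)\<^sup>2"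
      using zero_le_power2[of "h * a - (2 * L + 1) * b"]
      by (simp add: power2_eq_square algebra_simps)
    also have "\<dots> \<le> (L + 1) * (2 * L + 1) * a\<^sup>2 + ((2 * L + 1) * b)\<^sup>2"
      using h2 by (simp add: power_mult_distrib mult_right_mono)
    also have "\<dots> = (2 * L + 1) * ((L + 1) * a\<^sup>2 + (2 * L + 1) * b\<^sup>2)"
      by (simp add: power2_eq_square algebra_simps)
    finally have "2 * (h * a * b) \<le> (L + 1) * a\<^sup>2 + (2 * L + 1) * b\<^sup>2"
      using pos by simp
    then show ?thesis
      unfolding a_def[symmetric] b_def[symmetric] L_H_def by (simp add: algebra_simps)
  qed
  also have "\<dots> = L_H L * (norm q)\<^sup>2"
    by (simp add: norm_Pair)
  finally show "\<bar>H q \<bullet> q\<bar> \<le> L_H L * (norm q)\<^sup>2" .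
qed

text \<open>As operators, \<open>G\<^sup>2 \<le> L G\<close>. It follows by testing the positivity
  of \<open>G\<close> at the gradient step \<open>z - G z / L\<close>.\<close>

lemma G_cocoercive:
  assumes z: "z \<in> U"
  shows "(norm (G z))\<^sup>2 \<le> L * (G z \<bullet> z)"
proof -
  have Gz: "G z \<in> U" using maps z by auto
  define s where "s = 1 / L"
  have s: "s > 0" "s * L = 1" using pos by (auto simp: s_def)
  define y where "y = z - s *\<^sub>R G z"
  have y: "y \<in> U" unfolding y_def by (intro subspace_diff subspace_scale subspaces z Gz)
  have "0 \<le> G y \<bullet> y"
    using G_lower[OF y] pos by (meson order_trans mult_nonneg_nonneg less_imp_le zero_le_power2)
  also have "G y \<bullet> y = G z \<bullet> z - 2 * s * (norm (G z))\<^sup>2 + s\<^sup>2 * (G (G z) \<bullet> G z)"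
    using G_sym[OF Gz z] unfolding y_def power2_norm_eq_inner
    by (simp add: linear_diff[OF linear(1)] linear_cmul[OF linear(1)] inner_diff_left
        inner_diff_right power2_eq_square algebra_simps inner_commute)
  also have "\<dots> \<le> G z \<bullet> z - 2 * s * (norm (G z))\<^sup>2 + s\<^sup>2 * (L * (norm (G z))\<^sup>2)"
    using G_upper[OF Gz] by (simp add: mult_left_mono)
  also have "\<dots> = G z \<bullet> z - s * (norm (G z))\<^sup>2"
    using s by (simp add: power2_eq_square algebra_simps)
  finally have "s * (norm (G z))\<^sup>2 \<le> G z \<bullet> z" by simp
  then have "L * (s * (norm (G z))\<^sup>2) \<le> L * (G z \<bullet> z)" using pos by (intro mult_left_mono) auto
  then show ?thesis using pos by (simp add: s_def)
qed

text \<open>The dual part \<open>w\<close> is controlled first. The energy identity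
  \<open>G z \<bullet> z = a \<bullet> z - b \<bullet> w\<close> bounds
  \<open>G z \<bullet> z\<close> by terms that are only linear in the norm of \<open>w\<close>, and
  cocoercivity passes this on to the square of the norm of \<open>G z\<close>. As
  \<open>Jt w = a - G z\<close>, the lower bound on \<open>Jt\<close> becomes a quadratic inequality
  for the norm of \<open>w\<close>. The primal part then follows from \<open>G_lower\<close>. The
  bracket in the constant is the square of \<open>X = 1 + L_H L / \<mu>\<close>: one factor comes
  from \<open>w\<close>, the other from passing to \<open>q\<close>.\<close>

lemma H_lower:
  assumes "q \<in> U \<times> W"
  shows "norm q \<le> (1 / \<mu> + (1 + 2 * L_H L / \<mu> + (L_H L)\<^sup>2 / \<mu>\<^sup>2) * (L_H L / m)) * norm (H q)"
proof -
  obtain z w where q: "q = (z, w)" and z: "z \<in> U" and w: "w \<in> W"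
    using assms by auto
  define a b where "a = G z + Jt w" and "b = J z"
  define r where "r = norm (H q)"
  have "H q = (a, b)" by (simp add: q kkt_def a_def b_def)
  then have ar: "norm a \<le> r" "norm b \<le> r"
    unfolding r_def by (simp_all add: norm_fst_le norm_snd_le)
  have r0: "0 \<le> r" by (simp add: r_def)
  define N where "N = norm w"
  define X where "X = 1 + L_H L / \<mu>"
  have LH: "3 \<le> L_H L" "2 * L = L_H L - 1" using pos by (auto simp: L_H_def)
  have X1: "1 < X" using LH pos by (simp add: X_def)
  have N0: "0 \<le> N" by (simp add: N_def)
  have JtN: "norm (Jt w) \<le> h * N"
  proof (cases "Jt w = 0")
    case False
    have "(norm (Jt w))\<^sup>2 = J (Jt w) \<bullet> w"
      using adjoint[OF maps(3)[OF w] w] by (simp add: power2_norm_eq_inner)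
    also have "\<dots> \<le> (h * norm (Jt w)) * N"
      unfolding N_def using norm_cauchy_schwarz J_upper[OF maps(3)[OF w]]
      by (meson order_trans mult_right_mono norm_ge_zero)
    finally show ?thesis using False by (simp add: power2_eq_square)
  qed (use h N0 in simp)
  have zle: "\<mu> * norm z \<le> r + h * N"
  proof (cases "z = 0")
    case False
    have "\<mu> * (norm z)\<^sup>2 \<le> (a - Jt w) \<bullet> z"
      using G_lower[OF z] by (simp add: a_def)
    also have "\<dots> \<le> norm (a - Jt w) * norm z" by (rule norm_cauchy_schwarz)
    also have "\<dots> \<le> (r + h * N) * norm z"
      using ar JtN norm_triangle_ineq4[of a "Jt w"] by (intro mult_right_mono) auto
    finally show ?thesis using False by (simp add: power2_eq_square)
  qed (use h N0 r0 in simp)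
  then have zle': "norm z \<le> (r + h * N) / \<mu>"
    using pos by (simp add: field_simps)
  have hX: "1 + h / \<mu> \<le> X" using h_le pos by (simp add: X_def divide_right_mono)
  have "G z \<bullet> z = a \<bullet> z - b \<bullet> w"
    using adjoint[OF z w]
    by (simp add: a_def b_def inner_add_left inner_add_right inner_commute[of w] inner_commute[of z])
  also have "\<dots> \<le> norm a * norm z + norm b * norm w"
    using norm_cauchy_schwarz[of a z] Cauchy_Schwarz_ineq2[of b w] by linarith
  also have "\<dots> \<le> r * ((r + h * N) / \<mu>) + r * N"
    unfolding N_def[symmetric] using ar zle' N0 r0
    by (intro add_mono mult_mono) (auto simp: N_def)
  also have "\<dots> = r\<^sup>2 / \<mu> + N * r * (1 + h / \<mu>)"
    using pos by (simp add: field_simps power2_eq_square)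
  also have "\<dots> \<le> r\<^sup>2 / \<mu> + N * r * X"
    using hX N0 r0 by (intro add_left_mono mult_left_mono) auto
  finally have Gz: "G z \<bullet> z \<le> r\<^sup>2 / \<mu> + N * r * X" .
  have "m * N\<^sup>2 \<le> (norm (Jt w))\<^sup>2" using Jt_lower[OF w] by (simp add: N_def)
  also have "\<dots> = (norm (a - G z))\<^sup>2" by (simp add: a_def)
  also have "\<dots> \<le> (norm a + norm (G z))\<^sup>2" by (intro power_mono norm_triangle_ineq4) simp
  also have "\<dots> \<le> 2 * (norm a)\<^sup>2 + 2 * (norm (G z))\<^sup>2"
    using zero_le_power2[of "norm a - norm (G z)"] by (simp add: power2_eq_square algebra_simps)
  also have "\<dots> \<le> 2 * r\<^sup>2 + 2 * (L * (r\<^sup>2 / \<mu> + N * r * X))"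
  proof -
    have "(norm a)\<^sup>2 \<le> r\<^sup>2" using ar by (intro power_mono) auto
    moreover have "L * (G z \<bullet> z) \<le> L * (r\<^sup>2 / \<mu> + N * r * X)"
      using Gz pos by (intro mult_left_mono) auto
    ultimately show ?thesis using G_cocoercive[OF z] by linarith
  qed
  also have "\<dots> = 2 * r\<^sup>2 + (L_H L - 1) * (r\<^sup>2 / \<mu>) + (L_H L - 1) * (N * r * X)"
    unfolding LH(2)[symmetric] by (simp add: algebra_simps)
  also have "\<dots> \<le> r\<^sup>2 * (1 + X) + (L_H L - 1) * (N * r * X)"
  proof -
    have "(L_H L - 1) * (r\<^sup>2 / \<mu>) \<le> L_H L * (r\<^sup>2 / \<mu>)"
      using pos by (intro mult_right_mono) auto
    then show ?thesis by (simp add: X_def algebra_simps)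
  qed
  finally have main: "m * N\<^sup>2 \<le> r\<^sup>2 * (1 + X) + (L_H L - 1) * (N * r * X)" .
  \<comment> \<open>If this failed, \<open>m * N\<^sup>2\<close> would exceed
    \<open>X * L_H L * r * N\<close>, and what remains in \<open>main\<close> after cancelling
    \<open>L_H L - 1\<close> of these terms forces \<open>N < 2 * r\<close>. But
    \<open>X > 1\<close>, \<open>L_H L \<ge> 3\<close> and \<open>m < 1 / 2\<close> would give
    \<open>N > 6 * r\<close>.\<close>
  have NX: "N \<le> X * L_H L / m * r"
  proof (rule ccontr)
    assume "\<not> ?thesis"
    then have gt: "X * L_H L * r < m * N" using pos by (simp add: field_simps)
    have "0 \<le> X * L_H L * r" using X1 LH r0 by simp
    then have Npos: "N > 0" using gt pos by (metis less_eq_real_def mult_pos_pos not_less zero_less_mult_pos order_le_less_trans)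
    have "X * L_H L * r * N < m * N * N" using gt Npos by simp
    then have "X * L_H L * r * N < r\<^sup>2 * (1 + X) + (L_H L - 1) * (N * r * X)"
      using main by (simp add: power2_eq_square)
    then have 1: "X * N * r < r\<^sup>2 * (1 + X)" by (simp add: algebra_simps)
    then have rpos: "r > 0" using r0 by (cases "r = 0") auto
    have "r * (X * N) < r * (r * (1 + X))" using 1 by (simp add: power2_eq_square mult_ac)
    then have "X * N < r * (1 + X)" using rpos by (simp only: mult_less_cancel_left_pos)
    also have "\<dots> \<le> r * (2 * X)" using X1 rpos by (intro mult_left_mono) auto
    finally have N2: "N < 2 * r" using X1 by simp
    have "3 * r \<le> X * L_H L * r"
      using X1 LH rpos mult_mono[of 1 X 3 "L_H L"] by (intro mult_right_mono) auto
    also have "\<dots> < m * N" by (rule gt)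
    also have "\<dots> \<le> 1 / 2 * N" using pos N0 by (intro mult_right_mono) auto
    finally show False using N2 rpos by linarith
  qed
  have "norm q \<le> norm z + norm w" unfolding q by (rule norm_Pair_le)
  also have "\<dots> \<le> r / \<mu> + N * (1 + h / \<mu>)"
    using zle' by (simp add: N_def algebra_simps add_divide_distrib)
  also have "\<dots> \<le> r / \<mu> + (X * L_H L / m * r) * X"
  proof -
    have "0 \<le> 1 + h / \<mu>" using h pos by simp
    then have "N * (1 + h / \<mu>) \<le> (X * L_H L / m * r) * X"
      using NX hX N0 by (intro mult_mono) auto
    then show ?thesis by simp
  qed
  also have "\<dots> = (1 / \<mu> + X\<^sup>2 * (L_H L / m)) * r"
    by (simp add: power2_eq_square algebra_simps)
  also have "X\<^sup>2 = 1 + 2 * L_H L / \<mu> + (L_H L)\<^sup>2 / \<mu>\<^sup>2"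
    by (simp add: X_def power2_sum power_divide)
  finally show ?thesis by (simp add: r_def)
qed

end

section \<open>Node blocks and gradients\<close>

lemma keep_nth [simp]: "keep own S x $ a = (if own a \<in> S then x $ a else 0)"
  by (simp add: keep_def)

lemma linear_keep: "linear (keep own S)"
  by (rule linearI) (simp_all add: vec_eq_iff)

lemmas keep_simps [simp] =
  linear_0[OF linear_keep] linear_add[OF linear_keep] linear_diff[OF linear_keep]
  linear_neg[OF linear_keep] linear_cmul[OF linear_keep]

lemma keep_keep [simp]: "keep own S (keep own R x) = keep own (S \<inter> R) x"
  by (simp add: vec_eq_iff)

lemma keep_empty [simp]: "keep own {} x = 0"
  by (simp add: vec_eq_iff)

lemma inner_keep: "keep own S x \<bullet> y = x \<bullet> keep own S y"
  unfolding inner_vec_def by (intro sum.cong) auto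

lemma norm_keep_le: "norm (keep own S x) \<le> norm x"
  by (rule norm_le_componentwise_cart) simp

lemma sum_keep: "(\<Sum>i\<in>(UNIV :: 'n::finite set). keep own {i} x) = x"
  by (simp add: vec_eq_iff sum.delta')

lemma sum_norm_keep: "(\<Sum>i\<in>(UNIV :: 'n::finite set). (norm (keep own {i} x))\<^sup>2) = (norm x)\<^sup>2"
proof -
  have "(\<Sum>i\<in>UNIV. (norm (keep own {i} x))\<^sup>2) = (\<Sum>i\<in>UNIV. x \<bullet> keep own {i} x)"
    by (simp add: power2_norm_eq_inner inner_keep)
  then show ?thesis
    unfolding inner_sum_right[symmetric] sum_keep by (simp add: power2_norm_eq_inner)
qed

section \<open>Gradients under strong convexity and smoothness\<close>

lemma grad_eqI:
  assumes "GDERIV f x :> D"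
  shows "grad f x = D"
  unfolding grad_def
proof (rule the_equality)
  show "D' = D" if "GDERIV f x :> D'" for D'
    using has_derivative_unique[of f _ x] assms that
    unfolding gderiv_def by (metis inner_commute vector_eq_rdot)
qed (rule assms)

lemma GDERIV_grad:
  fixes f :: "'a::euclidean_space \<Rightarrow> real"
  assumes "f differentiable (at x)"
  shows "GDERIV f x :> grad f x"
proof -
  obtain f' where f': "(f has_derivative f') (at x)"
    using assms by (auto simp: differentiable_def)
  define D where "D = (\<Sum>b\<in>Basis. f' b *\<^sub>R b)"
  have "f' h = h \<bullet> D" for h
  proof -
    have "linear f'" using f' by (rule has_derivative_linear)
    then have "f' (\<Sum>b\<in>Basis. (h \<bullet> b) *\<^sub>R b) = (\<Sum>b\<in>Basis. (h \<bullet> b) * f' b)"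
      by (simp add: linear_sum linear_cmul)
    then show ?thesis
      by (simp add: D_def inner_sum_right euclidean_representation mult.commute)
  qed
  then have "f' = (\<lambda>h. h \<bullet> D)" by auto
  then have "GDERIV f x :> D" using f' by (simp add: gderiv_def)
  then show ?thesis using grad_eqI by force
qed

lemma DERIV_along_line:
  fixes f :: "'a::euclidean_space \<Rightarrow> real"
  assumes "f differentiable (at (x + s *\<^sub>R v))"
  shows "((\<lambda>s. f (x + s *\<^sub>R v)) has_real_derivative v \<bullet> grad f (x + s *\<^sub>R v)) (at s)"
proof -
  have 1: "((\<lambda>s. x + s *\<^sub>R v) has_derivative (\<lambda>h. h *\<^sub>R v)) (at s)"
    by (auto intro!: derivative_eq_intros)
  have "((\<lambda>s. f (x + s *\<^sub>R v)) has_derivative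
      (\<lambda>h. (h *\<^sub>R v) \<bullet> grad f (x + s *\<^sub>R v))) (at s)"
    using has_derivative_compose[OF 1 GDERIV_grad[OF assms, unfolded gderiv_def]] .
  then show ?thesis
    unfolding has_field_derivative_def by (simp add: mult.commute[of _ "_ \<bullet> _"])
qed

lemma grad_minimum:
  fixes f :: "'a::euclidean_space \<Rightarrow> real"
  assumes "f differentiable (at x)" "\<And>y. f x \<le> f y"
  shows "grad f x = 0"
proof -
  have "v \<bullet> grad f x = 0" for v
    using DERIV_local_min[OF DERIV_along_line[of f x 0 v], of 1] assms by simp
  then show ?thesis by (metis inner_eq_zero_iff)
qed

lemma strongly_convex_lower:
  fixes f :: "'a::euclidean_space \<Rightarrow> real"
  assumes sc: "strongly_convex \<mu> f" and diff: "\<And>x. f differentiable (at x)"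
  shows "f x + grad f x \<bullet> (y - x) + \<mu> / 2 * (norm (y - x))\<^sup>2 \<le> f y"
proof -
  define v where "v = y - x"
  have "((\<lambda>s. f (x + s *\<^sub>R v)) has_real_derivative v \<bullet> grad f x) (at 0)"
    using DERIV_along_line[of f x 0 v] diff by simp
  then have "((\<lambda>s. (f (x + s *\<^sub>R v) - f x) / s) \<longlongrightarrow> v \<bullet> grad f x) (at_right 0)"
    unfolding DERIV_def by (simp add: tendsto_mono[OF at_le[OF subset_UNIV]])
  then have lim: "((\<lambda>s. (f (x + s *\<^sub>R v) - f x) / s + \<mu> / 2 * (1 - s) * (norm v)\<^sup>2) \<longlongrightarrow>
      v \<bullet> grad f x + \<mu> / 2 * (1 - 0) * (norm v)\<^sup>2) (at_right 0)"
    by (intro tendsto_intros)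
  have "v \<bullet> grad f x + \<mu> / 2 * (1 - 0) * (norm v)\<^sup>2 \<le> f y - f x"
  proof (rule tendsto_upperbound[OF lim])
    show "\<forall>\<^sub>F s in at_right 0. (f (x + s *\<^sub>R v) - f x) / s + \<mu> / 2 * (1 - s) * (norm v)\<^sup>2 \<le> f y - f x"
    proof (rule eventually_at_rightI[of _ 1])
      fix s :: real assume s: "s \<in> {0<..<1}"
      then have "f (s *\<^sub>R y + (1 - s) *\<^sub>R x) \<le> s * f y + (1 - s) * f x - \<mu> / 2 * s * (1 - s) * (norm (y - x))\<^sup>2"
        using sc unfolding strongly_convex_def by simp
      also have "s *\<^sub>R y + (1 - s) *\<^sub>R x = x + s *\<^sub>R v" by (simp add: v_def algebra_simps)
      finally have "f (x + s *\<^sub>R v) - f x + s * (\<mu> / 2 * (1 - s) * (norm v)\<^sup>2) \<le> s * (f y - f x)"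
        by (simp add: v_def algebra_simps)
      then have "(f (x + s *\<^sub>R v) - f x + s * (\<mu> / 2 * (1 - s) * (norm v)\<^sup>2)) / s \<le> f y - f x"
        using s by (simp add: divide_le_eq mult.commute)
      then show "(f (x + s *\<^sub>R v) - f x) / s + \<mu> / 2 * (1 - s) * (norm v)\<^sup>2 \<le> f y - f x"
        using s by (simp add: add_divide_distrib)
    qed simp
  qed simp
  then show ?thesis by (simp add: v_def inner_commute)
qed

text \<open>The descent lemma; a monotone auxiliary function \<open>\<phi>\<close> takes the place
  of integrating the gradient along the segment.\<close>

lemma smooth_upper:
  fixes f :: "'a::euclidean_space \<Rightarrow> real"
  assumes "smooth L f"
  shows "f y \<le> f x + grad f x \<bullet> (y - x) + L / 2 * (norm (y - x))\<^sup>2"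
proof -
  have diff: "f differentiable (at x)" for x using assms by (simp add: smooth_def)
  define v where "v = y - x"
  define \<phi> where "\<phi> s = f (x + s *\<^sub>R v) - s * (v \<bullet> grad f x) - L / 2 * s\<^sup>2 * (norm v)\<^sup>2" for s :: real
  have "\<phi> 1 \<le> \<phi> 0"
  proof (rule DERIV_nonpos_imp_nonincreasing[of 0 1 \<phi>])
    fix s :: real assume s: "0 \<le> s" "s \<le> 1"
    define D where "D = v \<bullet> grad f (x + s *\<^sub>R v) - v \<bullet> grad f x - L * s * (norm v)\<^sup>2"
    have "(\<phi> has_real_derivative D) (at s)"
      unfolding \<phi>_def D_def by (auto intro!: derivative_eq_intros DERIV_along_line[OF diff])
    moreover have "D \<le> 0"
    proof -
      have "v \<bullet> (grad f (x + s *\<^sub>R v) - grad f x) \<le> norm v * norm (grad f (x + s *\<^sub>R v) - grad f x)"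
        by (rule norm_cauchy_schwarz)
      also have "\<dots> \<le> norm v * (L * norm (s *\<^sub>R v))"
        using assms lipschitz_onD[of L UNIV "grad f" "x + s *\<^sub>R v" x]
        by (intro mult_left_mono) (simp_all add: smooth_def dist_norm)
      finally show ?thesis
        using s by (simp add: D_def inner_diff_right power2_eq_square algebra_simps)
    qed
    ultimately show "\<exists>y. DERIV \<phi> s :> y \<and> y \<le> 0" by blast
  qed simp
  then show ?thesis by (simp add: \<phi>_def v_def inner_commute)
qed

text \<open>
  The function \<open>f - \<mu> / 2 |.|\<^sup>2\<close> is convex and \<open>(L - \<mu>)\<close>-smooth, so its gradient is cocoercive;
  the Bregman divergence \<open>D\<close> below is that of this function.
\<close>

lemma strongly_convex_smooth_cocoercive:
  fixes f :: "'a::euclidean_space \<Rightarrow> real"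
  assumes sc: "strongly_convex \<mu> f" and sm: "smooth L f"
  defines "u \<equiv> \<lambda>x y. grad f x - grad f y - \<mu> *\<^sub>R (x - y)"
  shows "0 \<le> u x y \<bullet> (x - y)" and "(norm (u x y))\<^sup>2 \<le> (L - \<mu>) * (u x y \<bullet> (x - y))"
proof -
  have diff: "f differentiable (at x)" for x using sm by (simp add: smooth_def)
  define D where "D y x = f y - f x - grad f x \<bullet> (y - x) - \<mu> / 2 * (norm (y - x))\<^sup>2" for x y
  have D0: "0 \<le> D y x" for x y
    using strongly_convex_lower[OF sc diff, of x y] by (simp add: D_def)
  have D1: "D y x \<le> (L - \<mu>) / 2 * (norm (y - x))\<^sup>2" for x y
    using smooth_upper[OF sm, of y x] by (simp add: D_def algebra_simps diff_divide_distrib)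
  have Dsum: "D y x + D x y = u y x \<bullet> (y - x)" for x y
    unfolding D_def u_def power2_norm_eq_inner
    by (simp add: inner_diff_left inner_diff_right inner_commute algebra_simps)
  show "0 \<le> u x y \<bullet> (x - y)" using D0[of x y] D0[of y x] Dsum[of x y] by linarith
  \<comment> \<open>The three-point identity for Bregman divergences, at the gradient step
    \<open>w\<close> from \<open>y\<close>: nonnegativity of \<open>D w x\<close> and the quadratic
    bound on \<open>D w y\<close> leave a lower bound for \<open>D y x\<close>. The best
    \<open>s\<close> is \<open>1 / (L - \<mu>)\<close>.\<close>
  have key: "(s - (L - \<mu>) / 2 * s\<^sup>2) * (norm (u y x))\<^sup>2 \<le> D y x" for s x y
  proof -
    define w where "w = y - s *\<^sub>R u y x"
    have "D w x = D w y + D y x + u y x \<bullet> (w - y)"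
      unfolding D_def u_def power2_norm_eq_inner
      by (simp add: inner_diff_left inner_diff_right inner_commute algebra_simps)
    also have "u y x \<bullet> (w - y) = - s * (norm (u y x))\<^sup>2"
      by (simp add: w_def power2_norm_eq_inner)
    finally have "0 \<le> D w y + D y x - s * (norm (u y x))\<^sup>2"
      using D0[of w x] by simp
    moreover have "D w y \<le> (L - \<mu>) / 2 * (s\<^sup>2 * (norm (u y x))\<^sup>2)"
      using D1[of w y] by (simp add: w_def power_mult_distrib)
    ultimately show ?thesis by (simp add: field_simps)
  qed
  have nu: "norm (u y x) = norm (u x y)" for x y
    using norm_minus_commute[of "grad f y - \<mu> *\<^sub>R y" "grad f x - \<mu> *\<^sub>R x"]
    by (simp add: u_def algebra_simps)
  have key2: "(2 * s - (L - \<mu>) * s\<^sup>2) * (norm (u x y))\<^sup>2 \<le> u x y \<bullet> (x - y)" for s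
    using key[of s x y] key[of s y x] Dsum[of x y] nu[of x y] by (simp add: field_simps)
  show "(norm (u x y))\<^sup>2 \<le> (L - \<mu>) * (u x y \<bullet> (x - y))"
  proof (cases "L - \<mu> > 0")
    case True
    then have "2 * (1 / (L - \<mu>)) - (L - \<mu>) * (1 / (L - \<mu>))\<^sup>2 = 1 / (L - \<mu>)"
      by (simp add: power2_eq_square)
    then have "1 / (L - \<mu>) * (norm (u x y))\<^sup>2 \<le> u x y \<bullet> (x - y)"
      using key2[of "1 / (L - \<mu>)"] by simp
    then show ?thesis using True by (simp add: divide_le_eq mult.commute)
  next
    case False
    have "norm (u x y) = 0"
    proof (rule ccontr)
      assume n: "norm (u x y) \<noteq> 0"
      \<comment> \<open>For \<open>L - \<mu> \<le> 0\<close> the left side of \<open>key2\<close>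
        grows at least linearly in \<open>s\<close> unless \<open>u x y\<close> is zero; this
        \<open>s\<close> makes it exceed the right side by one.\<close>
      define s where "s = (u x y \<bullet> (x - y) + 1) / (norm (u x y))\<^sup>2"
      have "s \<ge> 0" using \<open>0 \<le> u x y \<bullet> (x - y)\<close> by (simp add: s_def)
      moreover have "0 \<le> - (L - \<mu>) * s\<^sup>2" using False by (intro mult_nonneg_nonneg) auto
      ultimately have "s * (norm (u x y))\<^sup>2 \<le> (2 * s - (L - \<mu>) * s\<^sup>2) * (norm (u x y))\<^sup>2"
        by (intro mult_right_mono) (auto simp: algebra_simps)
      then show False using key2[of s] n by (simp add: s_def)
    qed
    then show ?thesis by simp
  qed
qed

lemma strongly_convex_smooth_le:
  fixes f :: "'a::euclidean_space \<Rightarrow> real"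
  assumes sc: "strongly_convex \<mu> f" and sm: "smooth L f"
  shows "\<mu> \<le> L"
proof -
  obtain b :: 'a where "b \<in> Basis" using nonempty_Basis by blast
  then have "norm (b - 0) = 1" by simp
  moreover have "f differentiable (at x)" for x using sm by (simp add: smooth_def)
  ultimately show ?thesis
    using strongly_convex_lower[OF sc, of 0 b] smooth_upper[OF sm, of b 0] by simp
qed

text \<open>The summands \<open>h i\<close> may fail to be differentiable, so nothing is
  differentiated termwise. Along a direction inside block \<open>i\<close>, the values of
  \<open>f\<close> from \<open>x\<close> and from \<open>y\<close> differ by a constant, hence the
  directional derivatives agree.\<close>

lemma node_separable_grad_local:
  assumes sep: "node_separable own f" and diff: "\<And>x. f differentiable (at x)"
    and eq: "keep own {i} x = keep own {i} y"
  shows "keep own {i} (grad f x) = keep own {i} (grad f y)"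
proof -
  obtain h where h: "f x = (\<Sum>i\<in>UNIV. h i (keep own {i} x))" for x
    using sep by (auto simp: node_separable_def)
  have "v \<bullet> keep own {i} (grad f x - grad f y) = 0" for v
  proof -
    define w where "w = keep own {i} v"
    have f_diff: "f (z + s *\<^sub>R w) - f z = h i (keep own {i} z + s *\<^sub>R w) - h i (keep own {i} z)" for z s
    proof -
      have "f (z + s *\<^sub>R w) - f z
          = (\<Sum>j\<in>UNIV. h j (keep own {j} (z + s *\<^sub>R w)) - h j (keep own {j} z))"
        by (simp add: h sum_subtractf)
      also have "\<dots> = (\<Sum>j\<in>UNIV. if j = i then h i (keep own {i} z + s *\<^sub>R w) - h i (keep own {i} z) else 0)"
        by (intro sum.cong) (auto simp: w_def)
      finally show ?thesis by simp
    qed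
    have "f (x + s *\<^sub>R w) = f (y + s *\<^sub>R w) + (f x - f y)" for s
      using f_diff[of x s] f_diff[of y s] eq by simp
    then have "((\<lambda>s. f (x + s *\<^sub>R w)) has_real_derivative w \<bullet> grad f (y + 0 *\<^sub>R w)) (at 0)"
      by (simp only:) (auto intro!: derivative_eq_intros DERIV_along_line diff)
    then have "w \<bullet> grad f x = w \<bullet> grad f y"
      using DERIV_unique[OF _ DERIV_along_line[of f x 0 w]] diff by simp
    then show ?thesis by (simp add: w_def inner_keep inner_diff_right)
  qed
  then have "keep own {i} (grad f x - grad f y) = 0" by (metis inner_eq_zero_iff)
  then show ?thesis by simp
qed

text \<open>
  A substitute for the averaged Hessian between two points: a linear map carrying the difference
  of the points to the difference of the gradients, obtained from the block-wise symmetric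
  rank-one secant update of \<open>\<mu> I\<close>.
\<close>

lemma separable_secant:
  fixes f :: "real^'a::finite \<Rightarrow> real" and own :: "'a \<Rightarrow> 'n::finite"
  assumes reg: "regular_cost \<mu> L f" and sep: "node_separable own f"
  obtains G where "linear G" "G (x - y) = grad f x - grad f y"
    "\<And>z z'. G z \<bullet> z' = z \<bullet> G z'"
    "\<And>z. \<mu> * (norm z)\<^sup>2 \<le> G z \<bullet> z" "\<And>z. G z \<bullet> z \<le> L * (norm z)\<^sup>2"
    "\<And>S z. keep own S (G z) = G (keep own S z)"
proof -
  have sc: "strongly_convex \<mu> f" and sm: "smooth L f" using reg by (auto simp: regular_cost_def)
  have diff: "f differentiable (at x)" for x using sm by (simp add: smooth_def)
  define d where "d = x - y"
  define g where "g = grad f x - grad f y"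
  define u where "u i = keep own {i} (g - \<mu> *\<^sub>R d)" for i
  \<comment> \<open>Block \<open>i\<close> of the gradient difference is itself a gradient
    difference, between the two points with all other blocks set to zero. This makes cocoercivity
    available block by block.\<close>
  have u_block: "u i = grad f (keep own {i} x) - grad f (keep own {i} y)
      - \<mu> *\<^sub>R (keep own {i} x - keep own {i} y)" for i
  proof -
    let ?g = "grad f (keep own {i} x) - grad f (keep own {i} y)"
    have "keep own {j} ?g = keep own {j} (keep own {i} g)" for j
    proof (cases "j = i")
      case True
      then show ?thesis
        using node_separable_grad_local[OF sep diff, of i "keep own {i} x" x]
          node_separable_grad_local[OF sep diff, of i "keep own {i} y" y]
        by (simp add: g_def)
    next
      case False
      then show ?thesis
        using node_separable_grad_local[OF sep diff, of j "keep own {i} x" "keep own {i} y"]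
        by simp
    qed
    then have "(\<Sum>j\<in>UNIV. keep own {j} ?g) = (\<Sum>j\<in>UNIV. keep own {j} (keep own {i} g))"
      by (rule sum.cong[OF refl])
    then have "?g = keep own {i} g" unfolding sum_keep .
    then show ?thesis by (simp add: u_def d_def)
  qed
  have ud: "u i \<bullet> (keep own {i} x - keep own {i} y) = u i \<bullet> d" for i
  proof -
    have "keep own {i} x - keep own {i} y = keep own {i} d" by (simp add: d_def)
    then show ?thesis by (simp only: u_def inner_keep keep_keep Int_absorb)
  qed
  have ud0: "0 \<le> u i \<bullet> d" for i
    using strongly_convex_smooth_cocoercive(1)[OF sc sm, of "keep own {i} x" "keep own {i} y"]
    unfolding u_block[symmetric] ud .
  have u2: "(norm (u i))\<^sup>2 \<le> (L - \<mu>) * (u i \<bullet> d)" for i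
    using strongly_convex_smooth_cocoercive(2)[OF sc sm, of "keep own {i} x" "keep own {i} y"]
    unfolding u_block[symmetric] ud .
  \<comment> \<open>Each rank-one term sends \<open>d\<close> to \<open>u i\<close> and has norm at
    most \<open>L - \<mu>\<close> by \<open>u2\<close>. If \<open>u i \<bullet> d = 0\<close>, then
    \<open>u2\<close> gives \<open>u i = 0\<close>, so the value 0 of the division is the right
    one.\<close>
  define G where "G z = \<mu> *\<^sub>R z + (\<Sum>i\<in>UNIV. (u i \<bullet> z / (u i \<bullet> d)) *\<^sub>R u i)" for z
  have linG: "linear G"
    by (rule linearI)
       (simp_all add: G_def inner_add_right add_divide_distrib scaleR_add_left sum.distrib
         scaleR_add_right scaleR_sum_right)
  have quad: "G z \<bullet> z = \<mu> * (norm z)\<^sup>2 + (\<Sum>i\<in>UNIV. (u i \<bullet> z)\<^sup>2 / (u i \<bullet> d))" for z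
    by (simp add: G_def inner_add_left inner_sum_left power2_norm_eq_inner
        power2_eq_square[of "u _ \<bullet> z"])
  have u_keep: "u i \<bullet> keep own {i} z = u i \<bullet> z" for i z
    by (simp only: u_def inner_keep keep_keep Int_absorb)
  have term_le: "(u i \<bullet> z)\<^sup>2 / (u i \<bullet> d) \<le> (L - \<mu>) * (norm (keep own {i} z))\<^sup>2" for i z
  proof (cases "u i \<bullet> d = 0")
    case True
    then show ?thesis using strongly_convex_smooth_le[OF sc sm] by simp
  next
    case False
    then have pos: "u i \<bullet> d > 0" using ud0[of i] by simp
    have "(u i \<bullet> z)\<^sup>2 \<le> (norm (u i) * norm (keep own {i} z))\<^sup>2"
      using u_keep[of i z] Cauchy_Schwarz_ineq2[of "u i" "keep own {i} z"] by (metis abs_le_square_iff abs_mult abs_norm_cancel)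
    also have "\<dots> \<le> (L - \<mu>) * (u i \<bullet> d) * (norm (keep own {i} z))\<^sup>2"
      using u2[of i] by (simp add: power_mult_distrib mult_right_mono)
    finally show ?thesis using pos by (simp add: divide_le_eq mult_ac)
  qed
  show ?thesis
  proof
    show "linear G" by (rule linG)
    have "G d = \<mu> *\<^sub>R d + (\<Sum>i\<in>UNIV. u i)"
    proof -
      have "(u i \<bullet> d / (u i \<bullet> d)) *\<^sub>R u i = u i" for i
        using u2[of i] by (cases "u i \<bullet> d = 0") simp_all
      then show ?thesis by (simp add: G_def)
    qed
    also have "(\<Sum>i\<in>UNIV. u i) = g - \<mu> *\<^sub>R d" unfolding u_def by (rule sum_keep)
    finally show "G (x - y) = grad f x - grad f y" by (simp add: d_def g_def)
    show "G z \<bullet> z' = z \<bullet> G z'" for z z'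
      by (simp add: G_def inner_add_left inner_add_right inner_sum_left inner_sum_right
          inner_commute mult.commute)
    show "\<mu> * (norm z)\<^sup>2 \<le> G z \<bullet> z" for z
      unfolding quad using ud0 by (simp add: sum_nonneg)
    show "G z \<bullet> z \<le> L * (norm z)\<^sup>2" for z
    proof -
      have "(\<Sum>i\<in>UNIV. (u i \<bullet> z)\<^sup>2 / (u i \<bullet> d)) \<le> (\<Sum>i\<in>UNIV. (L - \<mu>) * (norm (keep own {i} z))\<^sup>2)"
        by (intro sum_mono term_le)
      also have "\<dots> = (L - \<mu>) * (norm z)\<^sup>2"
        unfolding sum_distrib_left[symmetric] sum_norm_keep ..
      finally show ?thesis unfolding quad by (simp add: algebra_simps)
    qed
    show "keep own S (G z) = G (keep own S z)" for S z
    proof -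
      have "(u i \<bullet> z / (u i \<bullet> d)) *\<^sub>R keep own S (u i) = (u i \<bullet> keep own S z / (u i \<bullet> d)) *\<^sub>R u i" for i
        using u_keep[of i "keep own S z"] u_keep[of i z] by (cases "i \<in> S") (simp_all add: u_def)
      then show ?thesis
        by (simp add: G_def linear_sum[OF linear_keep] o_def)
    qed
  qed
qed

section \<open>The saddle point operator of a finite-horizon problem\<close>

lemma norm_matvec_le: "opnorm M \<le> L \<Longrightarrow> norm (M *v x) \<le> L * norm x"
  for M :: "real^'b^'a"
  by (meson matrix_vector_mul_bounded_linear mult_right_mono norm_ge_zero onorm order_trans)

lemma opnorm_nonneg: "0 \<le> opnorm M" for M :: "real^'b^'a"
  by (intro onorm_pos_le matrix_vector_mul_bounded_linear)

lemma inner_matvec: "(M *v x) \<bullet> y = x \<bullet> (transpose M *v y)" for M :: "real^'b^'a"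
  by (metis dot_lmul_matrix inner_commute transpose_matrix_vector)

lemma norm_transpose_matvec_le:
  fixes M :: "real^'b^'a"
  assumes "opnorm M \<le> L"
  shows "norm (transpose M *v x) \<le> L * norm x"
proof (cases "transpose M *v x = 0")
  case True
  then show ?thesis using assms opnorm_nonneg[of M] by simp
next
  case False
  have "(norm (transpose M *v x))\<^sup>2 = x \<bullet> (M *v (transpose M *v x))"
    by (metis inner_commute inner_matvec power2_norm_eq_inner)
  also have "\<dots> \<le> norm x * (L * norm (transpose M *v x))"
    by (meson assms mult_left_mono norm_cauchy_schwarz norm_ge_zero norm_matvec_le order_trans)
  finally show ?thesis using False by (simp add: power2_eq_square mult.commute)
qed

lemma norm_trunc_le:
  fixes f :: "nat \<Rightarrow> 'a::real_inner" and g :: "nat \<Rightarrow>\<^sub>0 'b::real_inner"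
  assumes "\<And>k. k < n \<Longrightarrow> norm (f k) \<le> c * norm (lookup g k)" "0 \<le> c"
  shows "norm (trunc n f) \<le> c * norm g"
proof -
  let ?K = "{..<n} \<union> keys g"
  have "norm (trunc n f) \<le> L2_set (\<lambda>k. c * norm (lookup g k)) {..<n}"
    unfolding norm_trunc using assms by (intro L2_set_mono) auto
  also have "\<dots> = c * L2_set (\<lambda>k. norm (lookup g k)) {..<n}"
    using assms by (intro L2_set_right_distrib[symmetric])
  also have "L2_set (\<lambda>k. norm (lookup g k)) {..<n} \<le> L2_set (\<lambda>k. norm (lookup g k)) ?K"
    unfolding L2_set_def by (intro real_sqrt_le_mono sum_mono2) auto
  also have "L2_set (\<lambda>k. norm (lookup g k)) ?K = norm g"
    unfolding L2_set_def norm_eq_sqrt_inner[of g]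
    by (subst inner_poly_mapping_superset[of ?K]) (auto simp: power2_norm_eq_inner)
  finally show ?thesis using assms(2) by (simp add: mult_left_mono)
qed

abbreviation shift :: "(nat \<Rightarrow> 'a) \<Rightarrow> nat \<Rightarrow> 'a::zero" where
  "shift f \<tau> \<equiv> (case \<tau> of 0 \<Rightarrow> 0 | Suc \<sigma> \<Rightarrow> f \<sigma>)"

lemma norm_trunc_shift: "norm (trunc (Suc n) (shift f)) = norm (trunc n f)"
  unfolding norm_trunc L2_set_def by (subst sum.lessThan_Suc_shift) simp

definition J_op :: "real^'s^'s \<Rightarrow> real^'c^'s \<Rightarrow> nat \<Rightarrow>
    (nat \<Rightarrow>\<^sub>0 real^'s) \<times> (nat \<Rightarrow>\<^sub>0 real^'c) \<Rightarrow> nat \<Rightarrow>\<^sub>0 real^'s" where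
  "J_op A B l z = trunc (Suc l) (\<lambda>\<tau>. lookup (fst z) \<tau>
     - shift (\<lambda>\<sigma>. A *v lookup (fst z) \<sigma> + B *v lookup (snd z) \<sigma>) \<tau>)"

text \<open>The first component needs no separate terminal case: on \<open>supported (Suc l)\<close>
  the entry \<open>lookup lam (Suc l)\<close> is zero.\<close>

definition Jt_op :: "real^'s^'s \<Rightarrow> real^'c^'s \<Rightarrow> nat \<Rightarrow>
    (nat \<Rightarrow>\<^sub>0 real^'s) \<Rightarrow> (nat \<Rightarrow>\<^sub>0 real^'s) \<times> (nat \<Rightarrow>\<^sub>0 real^'c)" where
  "Jt_op A B l lam =
    (trunc (Suc l) (\<lambda>\<tau>. lookup lam \<tau> - transpose A *v lookup lam (Suc \<tau>)),
     trunc l (\<lambda>\<tau>. - (transpose B *v lookup lam (Suc \<tau>))))"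

definition G_op :: "(nat \<Rightarrow> 'a \<Rightarrow> 'a) \<Rightarrow> (nat \<Rightarrow> 'b \<Rightarrow> 'b) \<Rightarrow> nat \<Rightarrow>
    (nat \<Rightarrow>\<^sub>0 'a) \<times> (nat \<Rightarrow>\<^sub>0 'b) \<Rightarrow> (nat \<Rightarrow>\<^sub>0 'a::zero) \<times> (nat \<Rightarrow>\<^sub>0 'b::zero)" where
  "G_op Gy Gv l z = (trunc (Suc l) (\<lambda>\<tau>. Gy \<tau> (lookup (fst z) \<tau>)),
     trunc l (\<lambda>\<tau>. Gv \<tau> (lookup (snd z) \<tau>)))"

definition hessian_like :: "real \<Rightarrow> real \<Rightarrow> ('a::real_inner \<Rightarrow> 'a) \<Rightarrow> bool" where
  "hessian_like \<mu> L G \<longleftrightarrow> linear G \<and> (\<forall>z z'. G z \<bullet> z' = z \<bullet> G z') \<and>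
     (\<forall>z. \<mu> * (norm z)\<^sup>2 \<le> G z \<bullet> z \<and> G z \<bullet> z \<le> L * (norm z)\<^sup>2)"

text \<open>\<open>J\<close> is the identity on the states minus a delayed copy of
  \<open>A y + B v\<close>. The factor \<open>sqrt 2\<close> comes from bounding the sum of the
  norms of \<open>y\<close> and \<open>v\<close> by the norm of the pair.\<close>

lemma J_op_norm_le:
  assumes "opnorm A \<le> L" "opnorm B \<le> L"
  shows "norm (J_op A B l z) \<le> (1 + sqrt 2 * L) * norm z"
proof -
  obtain y v where z: "z = (y, v)" by fastforce
  have L0: "0 \<le> L" using assms opnorm_nonneg order_trans by blast
  let ?s = "\<lambda>\<sigma>. A *v lookup y \<sigma> + B *v lookup v \<sigma>"
  have "J_op A B l z = trunc (Suc l) (lookup y) - trunc (Suc l) (shift ?s)"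
    unfolding J_op_def z fst_conv snd_conv trunc_diff ..
  then have "norm (J_op A B l z) \<le> norm (trunc (Suc l) (lookup y)) + norm (trunc l ?s)"
    using norm_triangle_ineq4[of "trunc (Suc l) (lookup y)" "trunc (Suc l) (shift ?s)"]
    unfolding norm_trunc_shift by (simp only:)
  also have "\<dots> \<le> norm y + (L * norm y + L * norm v)"
  proof (rule add_mono)
    show "norm (trunc (Suc l) (lookup y)) \<le> norm y"
      using norm_trunc_le[of "Suc l" "lookup y" 1 y] by simp
    have "norm (trunc l (\<lambda>\<sigma>. A *v lookup y \<sigma>)) \<le> L * norm y"
      by (rule norm_trunc_le[OF norm_matvec_le[OF assms(1)] L0])
    moreover have "norm (trunc l (\<lambda>\<sigma>. B *v lookup v \<sigma>)) \<le> L * norm v"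
      by (rule norm_trunc_le[OF norm_matvec_le[OF assms(2)] L0])
    ultimately show "norm (trunc l (\<lambda>\<sigma>. A *v lookup y \<sigma> + B *v lookup v \<sigma>)) \<le> L * norm y + L * norm v"
      unfolding trunc_add by (rule order_trans[OF norm_triangle_ineq add_mono])
  qed
  also have "\<dots> \<le> norm z + sqrt 2 * L * norm z"
  proof -
    have "(norm y + norm v)\<^sup>2 \<le> 2 * ((norm y)\<^sup>2 + (norm v)\<^sup>2)"
      using zero_le_power2[of "norm y - norm v"] by (simp add: power2_eq_square algebra_simps)
    then have "norm y + norm v \<le> sqrt (2 * ((norm y)\<^sup>2 + (norm v)\<^sup>2))"
      by (rule real_le_rsqrt)
    then have "L * (norm y + norm v) \<le> L * (sqrt 2 * norm z)"
      using L0 unfolding z norm_Pair real_sqrt_mult[symmetric] by (intro mult_left_mono)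
    then show ?thesis using norm_fst_le[of y v] by (simp add: z algebra_simps)
  qed
  finally show ?thesis by (simp add: algebra_simps)
qed

lemma J_op_adjoint:
  assumes z: "z \<in> supported (Suc l) \<times> supported l" and lam: "lam \<in> supported (Suc l)"
  shows "J_op A B l z \<bullet> lam = z \<bullet> Jt_op A B l lam"
proof -
  obtain y v where zyv: "z = (y, v)" by fastforce
  have y: "y \<in> supported (Suc l)" and v: "v \<in> supported l" using z by (auto simp: zyv)
  have lam_end: "lookup lam (Suc l) = 0" using lam by (simp add: supported_def)
  have "J_op A B l z \<bullet> lam = (\<Sum>\<tau><Suc l. lookup y \<tau> \<bullet> lookup lam \<tau>)
      - (\<Sum>\<tau><Suc l. shift (\<lambda>\<sigma>. A *v lookup y \<sigma> + B *v lookup v \<sigma>) \<tau> \<bullet> lookup lam \<tau>)"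
    unfolding J_op_def zyv fst_conv snd_conv inner_supported[OF trunc_in_supported]
    by (simp add: inner_diff_left sum_subtractf del: sum.lessThan_Suc)
  also have "(\<Sum>\<tau><Suc l. shift (\<lambda>\<sigma>. A *v lookup y \<sigma> + B *v lookup v \<sigma>) \<tau> \<bullet> lookup lam \<tau>)
      = (\<Sum>\<tau><l. (A *v lookup y \<tau> + B *v lookup v \<tau>) \<bullet> lookup lam (Suc \<tau>))"
    by (subst sum.lessThan_Suc_shift) simp
  also have "\<dots> = (\<Sum>\<tau><Suc l. lookup y \<tau> \<bullet> (transpose A *v lookup lam (Suc \<tau>)))
      + (\<Sum>\<tau><l. lookup v \<tau> \<bullet> (transpose B *v lookup lam (Suc \<tau>)))"
    by (simp add: lam_end inner_add_left inner_matvec sum.distrib)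
  finally show ?thesis
    by (simp add: zyv Jt_op_def inner_supported[OF y] inner_supported[OF v] inner_diff_right
        sum_subtractf sum_negf del: sum.lessThan_Suc)
qed

text \<open>Young's convolution inequality for a geometric kernel. The convolution \<open>a\<close>
  satisfies \<open>a \<tau> = \<gamma> * a (\<tau> - 1) + \<beta> \<tau>\<close> for positive
  \<open>\<tau>\<close>; a delay does not increase the norm, so the \<open>\<gamma>\<close>-fold
  norm of \<open>a\<close> can be absorbed on the left.\<close>

lemma geometric_convolution_L2:
  fixes \<beta> :: "nat \<Rightarrow> real"
  assumes \<gamma>: "0 < \<gamma>" "\<gamma> < 1" and \<beta>: "\<And>s. 0 \<le> \<beta> s"
  shows "L2_set (\<lambda>\<tau>. \<Sum>s\<le>\<tau>. \<gamma> ^ (\<tau> - s) * \<beta> s) {..<n} \<le> L2_set \<beta> {..<n} / (1 - \<gamma>)"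
proof -
  define a where "a \<tau> = (\<Sum>s\<le>\<tau>. \<gamma> ^ (\<tau> - s) * \<beta> s)" for \<tau>
  have rec: "a \<tau> = \<gamma> * shift a \<tau> + \<beta> \<tau>" for \<tau>
  proof (cases \<tau>)
    case (Suc \<sigma>)
    have "(\<Sum>s\<le>\<sigma>. \<gamma> ^ (Suc \<sigma> - s) * \<beta> s) = \<gamma> * a \<sigma>"
      unfolding a_def sum_distrib_left by (intro sum.cong) (auto simp: Suc_diff_le)
    then show ?thesis by (simp add: Suc a_def)
  qed (simp add: a_def)
  have "L2_set (shift a) {..<n} \<le> L2_set a {..<n}"
  proof (cases n)
    case (Suc k)
    have "(\<Sum>\<tau><Suc k. (shift a \<tau>)\<^sup>2) = (\<Sum>\<tau><k. (a \<tau>)\<^sup>2)"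
      by (subst sum.lessThan_Suc_shift) simp
    also have "\<dots> \<le> (\<Sum>\<tau><Suc k. (a \<tau>)\<^sup>2)" by simp
    finally show ?thesis unfolding L2_set_def Suc by (rule real_sqrt_le_mono)
  qed simp
  then have "\<gamma> * L2_set (shift a) {..<n} \<le> \<gamma> * L2_set a {..<n}"
    using \<gamma> by simp
  moreover have "L2_set a {..<n} \<le> \<gamma> * L2_set (shift a) {..<n} + L2_set \<beta> {..<n}"
  proof -
    have "L2_set a {..<n} = L2_set (\<lambda>\<tau>. \<gamma> * shift a \<tau> + \<beta> \<tau>) {..<n}"
      by (rule arg_cong[where f = "\<lambda>h. L2_set h {..<n}"]) (rule ext, rule rec)
    also have "\<dots> \<le> L2_set (\<lambda>\<tau>. \<gamma> * shift a \<tau>) {..<n} + L2_set \<beta> {..<n}"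
      by (rule L2_set_triangle_ineq)
    finally show ?thesis using \<gamma> by (simp add: L2_set_right_distrib)
  qed
  ultimately have "L2_set a {..<n} * (1 - \<gamma>) \<le> L2_set \<beta> {..<n}"
    by (simp add: algebra_simps)
  then show ?thesis
    using \<gamma> unfolding a_def by (simp add: le_divide_eq)
qed

text \<open>The right inverse of \<open>J\<close> is the closed-loop trajectory under the stabilizing feedback.\<close>

lemma J_op_right_inverse:
  assumes stab: "stabilizable L \<gamma> A B" and \<gamma>: "0 < \<gamma>" "\<gamma> < 1" and L: "1 < L"
    and b: "b \<in> supported (Suc l)"
  obtains z where "z \<in> supported (Suc l) \<times> supported l" "J_op A B l z = b"
    "mu_J L \<gamma> * (norm z)\<^sup>2 \<le> (norm b)\<^sup>2"
proof -
  obtain K where K: "opnorm K \<le> L" and pow: "\<And>k. opnorm (matpow (A - B ** K) k) \<le> L * \<gamma> ^ k"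
    using stab by (auto simp: stabilizable_def)
  define M where "M = A - B ** K"
  define y where "y \<tau> = (\<Sum>s\<le>\<tau>. matpow M (\<tau> - s) *v lookup b s)" for \<tau>
  have y0: "y 0 = lookup b 0" by (simp add: y_def matpow_def)
  have yS: "y (Suc \<tau>) = A *v y \<tau> - B *v (K *v y \<tau>) + lookup b (Suc \<tau>)" for \<tau>
  proof -
    have "(\<Sum>s\<le>\<tau>. matpow M (Suc \<tau> - s) *v lookup b s) = M *v y \<tau>"
      unfolding y_def linear_sum[OF matrix_vector_mul_linear]
      by (intro sum.cong) (auto simp: Suc_diff_le matpow_def matrix_vector_mul_assoc)
    moreover have "M *v y \<tau> = A *v y \<tau> - B *v (K *v y \<tau>)"
      by (simp add: M_def matrix_vector_mult_diff_rdistrib matrix_vector_mul_assoc)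
    ultimately show ?thesis by (simp add: y_def matpow_def)
  qed
  define z where "z = (trunc (Suc l) y, trunc l (\<lambda>\<tau>. - (K *v y \<tau>)))"
  have "J_op A B l z = b"
  proof (rule poly_mapping_eqI)
    show "lookup (J_op A B l z) \<tau> = lookup b \<tau>" for \<tau>
      using b by (cases \<tau>)
        (auto simp: J_op_def z_def y0 yS supported_def linear_neg[OF matrix_vector_mul_linear])
  qed
  \<comment> \<open>The origin of \<open>mu_J\<close>: the states have norm at most
    \<open>L / (1 - \<gamma>)\<close> times that of \<open>b\<close>, and the feedback makes the
    controls at most \<open>L\<close> times as large as the states.\<close>
  moreover have "mu_J L \<gamma> * (norm z)\<^sup>2 \<le> (norm b)\<^sup>2"
  proof -
    let ?a = "\<lambda>\<tau>. \<Sum>s\<le>\<tau>. \<gamma> ^ (\<tau> - s) * norm (lookup b s)"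
    have "norm (y \<tau>) \<le> L * ?a \<tau>" for \<tau>
    proof -
      have "norm (y \<tau>) \<le> (\<Sum>s\<le>\<tau>. norm (matpow M (\<tau> - s) *v lookup b s))"
        unfolding y_def by (rule norm_sum)
      also have "\<dots> \<le> (\<Sum>s\<le>\<tau>. L * \<gamma> ^ (\<tau> - s) * norm (lookup b s))"
        using pow by (intro sum_mono norm_matvec_le) (simp add: M_def)
      finally show ?thesis by (simp add: sum_distrib_left mult.assoc)
    qed
    then have "norm (trunc (Suc l) y) \<le> L2_set (\<lambda>\<tau>. L * ?a \<tau>) {..<Suc l}"
      unfolding norm_trunc by (intro L2_set_mono) auto
    also have "\<dots> = L * L2_set ?a {..<Suc l}"
      using L by (intro L2_set_right_distrib[symmetric]) auto
    also have "\<dots> \<le> L * (L2_set (\<lambda>s. norm (lookup b s)) {..<Suc l} / (1 - \<gamma>))"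
      using L \<gamma> by (intro mult_left_mono geometric_convolution_L2) auto
    also have "L2_set (\<lambda>s. norm (lookup b s)) {..<Suc l} = norm b"
      using norm_supported[OF b] ..
    finally have ny: "norm (trunc (Suc l) y) * (1 - \<gamma>) \<le> L * norm b"
      using \<gamma> by (simp add: le_divide_eq)
    have nv: "norm (trunc l (\<lambda>\<tau>. - (K *v y \<tau>))) \<le> L * norm (trunc (Suc l) y)"
      using L norm_matvec_le[OF K] by (intro norm_trunc_le) auto
    have "(norm z)\<^sup>2 = (norm (trunc (Suc l) y))\<^sup>2 + (norm (trunc l (\<lambda>\<tau>. - (K *v y \<tau>))))\<^sup>2"
      by (simp add: z_def norm_Pair)
    also have "\<dots> \<le> (norm (trunc (Suc l) y))\<^sup>2 + (L * norm (trunc (Suc l) y))\<^sup>2"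
      using nv by (intro add_left_mono power_mono) auto
    also have "\<dots> = (1 + L\<^sup>2) * (norm (trunc (Suc l) y))\<^sup>2"
      by (simp add: algebra_simps power_mult_distrib)
    finally have "(1 - \<gamma>)\<^sup>2 * (norm z)\<^sup>2 \<le> (1 - \<gamma>)\<^sup>2 * ((1 + L\<^sup>2) * (norm (trunc (Suc l) y))\<^sup>2)"
      by (intro mult_left_mono) auto
    also have "\<dots> = (1 + L\<^sup>2) * (norm (trunc (Suc l) y) * (1 - \<gamma>))\<^sup>2"
      by (simp add: power_mult_distrib)
    also have "\<dots> \<le> (1 + L\<^sup>2) * (L * norm b)\<^sup>2"
      using ny \<gamma> by (intro mult_left_mono power_mono) auto
    finally have "(1 - \<gamma>)\<^sup>2 * (norm z)\<^sup>2 \<le> (norm b)\<^sup>2 * (L\<^sup>2 * (1 + L\<^sup>2))"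
      by (simp add: power_mult_distrib mult_ac)
    moreover have "0 < L\<^sup>2 * (1 + L\<^sup>2)" using L by (simp add: add_pos_nonneg)
    ultimately show ?thesis by (simp add: mu_J_def divide_le_eq)
  qed
  moreover have "z \<in> supported (Suc l) \<times> supported l" by (simp add: z_def)
  ultimately show ?thesis using that by blast
qed

lemma mu_J_bounds:
  assumes "0 < \<gamma>" "\<gamma> < 1" "1 < L"
  shows "0 < mu_J L \<gamma>" "mu_J L \<gamma> < 1 / 2"
proof -
  have L2: "1 < L\<^sup>2" using assms by simp
  have "1 * 2 < L\<^sup>2 * (1 + L\<^sup>2)" using L2 by (intro mult_strict_mono) auto
  then have den: "2 < L\<^sup>2 * (1 + L\<^sup>2)" by simp
  have "(1 - \<gamma>)\<^sup>2 \<le> 1" using assms by (simp add: power_le_one)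
  then have "2 * (1 - \<gamma>)\<^sup>2 < L\<^sup>2 * (1 + L\<^sup>2)" using den by linarith
  then show "mu_J L \<gamma> < 1 / 2" unfolding mu_J_def using den by (simp add: divide_less_eq)
  show "0 < mu_J L \<gamma>" unfolding mu_J_def using assms den by (intro divide_pos_pos) auto
qed

lemma saddle_op:
  fixes A :: "real^'s^'s" and B :: "real^'c^'s"
  assumes A: "opnorm A \<le> L" and B: "opnorm B \<le> L" and stab: "stabilizable L \<gamma> A B"
    and \<gamma>: "0 < \<gamma>" "\<gamma> < 1" and L: "1 < L" and \<mu>: "0 < \<mu>"
    and Gy: "\<And>\<tau>. \<tau> \<le> l \<Longrightarrow> hessian_like \<mu> L (Gy \<tau>)"
    and Gv: "\<And>\<tau>. \<tau> < l \<Longrightarrow> hessian_like \<mu> L (Gv \<tau>)"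
  shows "saddle (G_op Gy Gv l) (J_op A B l) (Jt_op A B l)
    (supported (Suc l) \<times> supported l) (supported (Suc l)) \<mu> L (1 + sqrt 2 * L) (mu_J L \<gamma>)"
proof (rule saddle.intro)
  have linGy: "linear (Gy \<tau>)" if "\<tau> < Suc l" for \<tau> using Gy that by (simp add: hessian_like_def)
  have linGv: "linear (Gv \<tau>)" if "\<tau> < l" for \<tau> using Gv that by (simp add: hessian_like_def)
  show "linear (G_op Gy Gv l)"
    by (rule linearI; rule prod_eqI; rule poly_mapping_eqI)
       (simp_all add: G_op_def lookup_add
         linear_add[OF linGy] linear_cmul[OF linGy] linear_add[OF linGv] linear_cmul[OF linGv])
  show "linear (J_op A B l)"
    by (rule linearI; rule poly_mapping_eqI)
       (simp_all add: J_op_def lookup_add matrix_vector_right_distrib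
         linear_cmul[OF matrix_vector_mul_linear] scaleR_right_diff_distrib scaleR_add_right
         split: nat.split)
  show "linear (Jt_op A B l)"
    by (rule linearI; rule prod_eqI; rule poly_mapping_eqI)
       (simp_all add: Jt_op_def lookup_add matrix_vector_right_distrib
         linear_cmul[OF matrix_vector_mul_linear] scaleR_right_diff_distrib)
  show "subspace (supported (Suc l) \<times> supported l :: ((nat \<Rightarrow>\<^sub>0 real^'s) \<times> (nat \<Rightarrow>\<^sub>0 real^'c)) set)"
    by (intro subspace_Times subspace_supported)
  show "subspace (supported (Suc l) :: (nat \<Rightarrow>\<^sub>0 real^'s) set)"
    by (rule subspace_supported)
  show "G_op Gy Gv l z \<in> supported (Suc l) \<times> supported l" for z by (simp add: G_op_def)
  show "J_op A B l z \<in> supported (Suc l)" for z by (simp add: J_op_def)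
  show "Jt_op A B l w \<in> supported (Suc l) \<times> supported l" for w by (simp add: Jt_op_def)
  fix z :: "(nat \<Rightarrow>\<^sub>0 real^'s) \<times> (nat \<Rightarrow>\<^sub>0 real^'c)"
  assume z: "z \<in> supported (Suc l) \<times> supported l"
  then have z1: "fst z \<in> supported (Suc l)" and z2: "snd z \<in> supported l" by auto
  have quad: "G_op Gy Gv l z \<bullet> z' = (\<Sum>\<tau><Suc l. Gy \<tau> (lookup (fst z) \<tau>) \<bullet> lookup (fst z') \<tau>)
      + (\<Sum>\<tau><l. Gv \<tau> (lookup (snd z) \<tau>) \<bullet> lookup (snd z') \<tau>)" for z z'
    by (simp add: inner_prod_def G_op_def inner_supported[OF trunc_in_supported] del: sum.lessThan_Suc)
  have norm2: "(norm z)\<^sup>2 = (\<Sum>\<tau><Suc l. (norm (lookup (fst z) \<tau>))\<^sup>2) + (\<Sum>\<tau><l. (norm (lookup (snd z) \<tau>))\<^sup>2)"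
    by (simp add: power2_norm_eq_inner inner_prod_def inner_supported[OF z1] inner_supported[OF z2]
        del: sum.lessThan_Suc)
  show "G_op Gy Gv l z \<bullet> z' = z \<bullet> G_op Gy Gv l z'" for z'
  proof -
    have "Gy \<tau> a \<bullet> b = Gy \<tau> b \<bullet> a" if "\<tau> < Suc l" for \<tau> a b
    proof -
      have "Gy \<tau> a \<bullet> b = a \<bullet> Gy \<tau> b"
        using Gy[of \<tau>] that unfolding hessian_like_def less_Suc_eq_le by blast
      then show ?thesis by (simp only: inner_commute)
    qed
    moreover have "Gv \<tau> a \<bullet> b = Gv \<tau> b \<bullet> a" if "\<tau> < l" for \<tau> a b
    proof -
      have "Gv \<tau> a \<bullet> b = a \<bullet> Gv \<tau> b"
        using Gv[of \<tau>] that unfolding hessian_like_def by blast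
      then show ?thesis by (simp only: inner_commute)
    qed
    ultimately show ?thesis
      unfolding inner_commute[of z] quad by (intro arg_cong2[where f = "(+)"] sum.cong) auto
  qed
  have Gy': "\<mu> * (norm a)\<^sup>2 \<le> Gy \<tau> a \<bullet> a" "Gy \<tau> a \<bullet> a \<le> L * (norm a)\<^sup>2" if "\<tau> < Suc l" for \<tau> a
    using Gy[of \<tau>] that unfolding hessian_like_def less_Suc_eq_le by blast+
  have Gv': "\<mu> * (norm a)\<^sup>2 \<le> Gv \<tau> a \<bullet> a" "Gv \<tau> a \<bullet> a \<le> L * (norm a)\<^sup>2" if "\<tau> < l" for \<tau> a
    using Gv[of \<tau>] that unfolding hessian_like_def by blast+
  show "\<mu> * (norm z)\<^sup>2 \<le> G_op Gy Gv l z \<bullet> z"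
    unfolding quad norm2 distrib_left sum_distrib_left
    by (intro add_mono sum_mono Gy' Gv') auto
  show "G_op Gy Gv l z \<bullet> z \<le> L * (norm z)\<^sup>2"
    unfolding quad norm2 distrib_left sum_distrib_left
    by (intro add_mono sum_mono Gy' Gv') auto
  show "J_op A B l z \<bullet> w = z \<bullet> Jt_op A B l w" if "w \<in> supported (Suc l)" for w
    using z that by (rule J_op_adjoint)
  show "norm (J_op A B l z) \<le> (1 + sqrt 2 * L) * norm z"
    using A B by (rule J_op_norm_le)
next
  \<comment> \<open>Duality: writing \<open>w = J z\<close> with \<open>z\<close> bounded by
    \<open>w\<close> gives \<open>(norm w)\<^sup>2 = z \<bullet> Jt w\<close>, so a bounded right
    inverse of \<open>J\<close> is a lower bound for the adjoint.\<close>
  show "mu_J L \<gamma> * (norm w)\<^sup>2 \<le> (norm (Jt_op A B l w))\<^sup>2" if w: "w \<in> supported (Suc l)" for w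
  proof -
    obtain z where z: "z \<in> supported (Suc l) \<times> supported l" "J_op A B l z = w"
      "mu_J L \<gamma> * (norm z)\<^sup>2 \<le> (norm w)\<^sup>2"
      using J_op_right_inverse[OF stab \<gamma> L w] .
    have "(norm w)\<^sup>2 = z \<bullet> Jt_op A B l w"
      using J_op_adjoint[OF z(1) w, of A B] z(2) by (simp add: power2_norm_eq_inner)
    also have "\<dots> \<le> norm z * norm (Jt_op A B l w)" by (rule norm_cauchy_schwarz)
    finally have "((norm w)\<^sup>2)\<^sup>2 \<le> (norm z * norm (Jt_op A B l w))\<^sup>2" by (intro power_mono) auto
    then have "mu_J L \<gamma> * ((norm w)\<^sup>2)\<^sup>2 \<le> mu_J L \<gamma> * ((norm z)\<^sup>2 * (norm (Jt_op A B l w))\<^sup>2)"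
      using mu_J_bounds(1)[OF \<gamma> L] by (simp add: power_mult_distrib)
    also have "\<dots> \<le> (norm w)\<^sup>2 * (norm (Jt_op A B l w))\<^sup>2"
      using z(3) by (simp add: mult_right_mono flip: mult.assoc)
    finally have "(mu_J L \<gamma> * (norm w)\<^sup>2) * (norm w)\<^sup>2 \<le> (norm (Jt_op A B l w))\<^sup>2 * (norm w)\<^sup>2"
      by (simp add: power2_eq_square mult_ac)
    then show ?thesis by (cases "w = 0") auto
  qed
  show "0 < \<mu>" "1 < L" "0 < mu_J L \<gamma>" "mu_J L \<gamma> < 1 / 2"
    by (fact \<mu> L mu_J_bounds[OF \<gamma> L])+
  show "0 \<le> 1 + sqrt 2 * L" "1 + sqrt 2 * L \<le> 1 + sqrt 2 * L" using L by simp_all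
qed

section \<open>Graph distance and locality\<close>

lemma gdist_le_iff: "gdist E i j \<le> enat n \<longleftrightarrow> (\<exists>m\<le>n. (i, j) \<in> E ^^ m)"
proof
  let ?M = "enat ` {m. (i, j) \<in> E ^^ m}"
  assume le: "gdist E i j \<le> enat n"
  have "?M \<noteq> {}"
  proof
    assume "?M = {}"
    then have "gdist E i j = \<infinity>" unfolding gdist_def Inf_enat_def by simp
    then show False using le by simp
  qed
  then obtain x where "x \<in> ?M" by blast
  then have "Inf ?M \<in> ?M"
    unfolding Inf_enat_def using \<open>?M \<noteq> {}\<close> by (metis LeastI)
  then show "\<exists>m\<le>n. (i, j) \<in> E ^^ m" using le unfolding gdist_def by auto
next
  assume "\<exists>m\<le>n. (i, j) \<in> E ^^ m"
  then obtain m where m: "m \<le> n" "(i, j) \<in> E ^^ m" by blast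
  then have "gdist E i j \<le> enat m" unfolding gdist_def by (intro INF_lower) simp
  then show "gdist E i j \<le> enat n" using m(1) by (meson enat_ord_simps(1) order_trans)
qed

lemma gdist_self: "gdist E i i = 0"
  using gdist_le_iff[of E i i 0] by (simp add: zero_enat_def[symmetric])

lemma gdist_neighbour:
  assumes "gdist E i j \<le> enat n" "j' \<in> nbhd E j"
  shows "gdist E i j' \<le> enat (Suc n)"
proof -
  obtain m where m: "m \<le> n" "(i, j) \<in> E ^^ m" using assms gdist_le_iff by metis
  consider "j' = j" | "(j, j') \<in> E" using assms(2) by (auto simp: nbhd_def)
  then show ?thesis
  proof cases
    case 1
    then show ?thesis using m unfolding gdist_le_iff by (meson le_SucI)
  next
    case 2
    then have "(i, j') \<in> E ^^ Suc m" using m by auto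
    then show ?thesis using m unfolding gdist_le_iff by (meson Suc_le_mono)
  qed
qed

text \<open>The strict inequality fixes the counting: index 0 gives the empty set and hence no
  condition, index 1 gives the node \<open>i\<close> alone, and one application of a
  graph-structured matrix costs exactly one unit.\<close>

definition dist_less :: "('n \<times> 'n) set \<Rightarrow> 'n \<Rightarrow> nat \<Rightarrow> 'n set" where
  "dist_less E i n = {j. gdist E i j < enat n}"

lemma dist_less_Suc: "dist_less E i (Suc n) = nbhd_k E n i"
proof -
  have "x < enat (Suc n) \<longleftrightarrow> x \<le> enat n" for x by (cases x) auto
  then show ?thesis by (simp add: dist_less_def nbhd_k_def)
qed

lemma dist_less_mono: "m \<le> n \<Longrightarrow> dist_less E i m \<subseteq> dist_less E i n"
  unfolding dist_less_def using enat_ord_simps(1) order_less_le_trans by blast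

lemma dist_less_neighbour: "j \<in> dist_less E i n \<Longrightarrow> nbhd E j \<subseteq> nbhd_k E n i"
proof (cases n)
  case 0
  then show "j \<in> dist_less E i n \<Longrightarrow> ?thesis"
    by (simp add: dist_less_def zero_enat_def[symmetric])
next
  case (Suc m)
  then show "j \<in> dist_less E i n \<Longrightarrow> ?thesis"
    by (auto simp: dist_less_Suc nbhd_k_def intro: gdist_neighbour)
qed

text \<open>As there are finitely many nodes, the component of \<open>i\<close> is a ball, and its
  radius may be chosen as large as desired. A hypothesis on all sufficiently large balls thus
  applies to the component.\<close>

lemma component_eq_nbhd_k:
  fixes i :: "'n::finite"
  obtains \<kappa>' where "\<kappa> \<le> \<kappa>'" "nbhd_k E \<kappa>' i = {j. \<exists>m. (i, j) \<in> E ^^ m}"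
proof -
  \<comment> \<open>For an unreachable \<open>j\<close> this is an arbitrary number, which can only
    enlarge \<open>\<kappa>'\<close>; a larger radius adds no node outside the component.\<close>
  define r where "r j = (SOME m. (i, j) \<in> E ^^ m)" for j
  define \<kappa>' where "\<kappa>' = Max (insert \<kappa> (range r))"
  have "r j \<le> \<kappa>'" for j unfolding \<kappa>'_def by (rule Max_ge) auto
  moreover have "(i, j) \<in> E ^^ r j" if "(i, j) \<in> E ^^ m" for j m
    using that unfolding r_def by (rule someI)
  ultimately have "nbhd_k E \<kappa>' i = {j. \<exists>m. (i, j) \<in> E ^^ m}"
    unfolding nbhd_k_def gdist_le_iff by blast
  moreover have "\<kappa> \<le> \<kappa>'" by (simp add: \<kappa>'_def)
  ultimately show ?thesis using that by blast
qed

text \<open>This serves to show \<open>1 \<le> p 1\<close>. A path leaving the ball must use an edge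
  between distinct nodes; loops are possible in \<open>E\<close>, hence the comparison with
  \<open>Id\<close>.\<close>

lemma sphere_one_nonempty:
  assumes "j \<notin> nbhd_k E n i" "(i, j) \<in> E ^^ m"
  obtains a b where "gdist E a b = enat 1"
proof -
  have "\<exists>a b. (a, b) \<in> E \<and> a \<noteq> b"
  proof (rule ccontr)
    assume "\<not> ?thesis"
    then have "E \<subseteq> Id" by auto
    then have "i = j" using assms(2) by (induction m arbitrary: j) auto
    then show False using assms(1) by (simp add: nbhd_k_def gdist_self)
  qed
  then obtain a b where ab: "(a, b) \<in> E" "a \<noteq> b" by blast
  have "gdist E a b \<le> enat 1" unfolding gdist_le_iff using ab by (intro exI[of _ 1]) auto
  moreover have "\<not> gdist E a b \<le> enat 0" unfolding gdist_le_iff using ab by auto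
  ultimately have "gdist E a b = enat 1" by (cases "gdist E a b") auto
  then show ?thesis by (rule that)
qed

section \<open>Locality of graph-structured matrices\<close>

lemma graph_structured_transpose:
  "sym E \<Longrightarrow> graph_structured E own1 own2 M \<Longrightarrow> graph_structured E own2 own1 (transpose M)"
  unfolding graph_structured_def transpose_def nbhd_def sym_def by simp metis

lemma graph_structured_local:
  assumes M: "graph_structured E own1 own2 M" and R: "\<And>j. j \<in> S \<Longrightarrow> nbhd E j \<subseteq> R"
    and z: "keep own2 R z = 0"
  shows "keep own1 S (M *v z) = 0"
proof -
  have "M $ a $ b * z $ b = 0" if "own1 a \<in> S" for a b
  proof (cases "own2 b \<in> R")
    case True
    then have "z $ b = 0" using z by (auto simp: vec_eq_iff split: if_splits)
    then show ?thesis by simp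
  next
    case False
    then show ?thesis using M R[OF that] by (auto simp: graph_structured_def)
  qed
  then show ?thesis by (auto simp: vec_eq_iff matrix_vector_mult_def intro!: sum.neutral)
qed

text \<open>By symmetry of \<open>E\<close> the complement of a neighbour-closed set is
  neighbour-closed too, so \<open>M\<close> is block diagonal with respect to \<open>C\<close> and
  its complement.\<close>

lemma keep_matvec_commute:
  assumes M: "graph_structured E own1 own2 M" and E: "sym E"
    and C: "\<And>j. j \<in> C \<Longrightarrow> nbhd E j \<subseteq> C"
  shows "keep own1 C (M *v z) = M *v keep own2 C z"
proof -
  have "own1 a \<in> C \<longleftrightarrow> own2 b \<in> C" if "M $ a $ b \<noteq> 0" for a b
  proof -
    have "own2 b \<in> nbhd E (own1 a)" using M that by (auto simp: graph_structured_def)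
    moreover then have "own1 a \<in> nbhd E (own2 b)" using E by (auto simp: nbhd_def sym_def)
    ultimately show ?thesis using C by blast
  qed
  then have eq: "M $ a $ b * (if own2 b \<in> C then z $ b else 0)
      = (if own1 a \<in> C then M $ a $ b * z $ b else 0)" for a b
    by (cases "M $ a $ b = 0") auto
  show ?thesis
    by (simp add: vec_eq_iff matrix_vector_mult_def eq)
qed

lemma keep_rows_matvec: "keep_rows own S M *v z = keep own S (M *v z)"
  by (simp add: vec_eq_iff keep_rows_def matrix_vector_mult_def)

text \<open>Truncation deletes rows, so its adjoint ignores multipliers outside \<open>S\<close>.
  This is why the multipliers of the truncated problem outside its neighbourhood enter the
  residual.\<close>

lemma transpose_keep_rows_matvec: "transpose (keep_rows own S M) *v z = transpose M *v keep own S z"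
  by (auto simp: vec_eq_iff keep_rows_def matrix_vector_mult_def transpose_def intro!: sum.cong)

lemma opnorm_keep_rows_le:
  fixes M :: "real^'b^'a"
  assumes "opnorm M \<le> L"
  shows "opnorm (keep_rows own S M) \<le> L"
  by (rule onorm_le)
     (metis assms keep_rows_matvec norm_keep_le norm_matvec_le order_trans)

lemma graph_structured_keep_rows:
  "graph_structured E own1 own2 M \<Longrightarrow> graph_structured E own1 own2 (keep_rows own1 S M)"
  by (simp add: graph_structured_def keep_rows_def)

section \<open>The optimality conditions\<close>

text \<open>Here \<open>lam\<close> is a plain function with an arbitrary value at
  \<open>Suc l\<close>, hence the case distinction in the state equation; after truncation that
  value is zero.\<close>

definition optimality_system ::
  "(nat \<Rightarrow> real^'s \<Rightarrow> real) \<Rightarrow> (nat \<Rightarrow> real^'c \<Rightarrow> real) \<Rightarrow> real^'s^'s \<Rightarrow> real^'c^'s \<Rightarrow> nat \<Rightarrow>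
   real^'s \<Rightarrow> (nat \<Rightarrow> real^'s) \<Rightarrow> (nat \<Rightarrow> real^'s) \<Rightarrow> (nat \<Rightarrow> real^'c) \<Rightarrow> (nat \<Rightarrow> real^'s) \<Rightarrow> bool" where
  "optimality_system hy hv A B l x \<zeta> y v lam \<longleftrightarrow> feasible A B l x \<zeta> y v \<and>
     (\<forall>\<tau>\<le>l. grad (hy \<tau>) (y \<tau>) + (lam \<tau> - (if \<tau> < l then transpose A *v lam (Suc \<tau>) else 0)) = 0) \<and>
     (\<forall>\<tau><l. grad (hv \<tau>) (v \<tau>) - transpose B *v lam (Suc \<tau>) = 0)"

lemma grad_add_const:
  fixes h :: "'a::euclidean_space \<Rightarrow> real"
  assumes "h differentiable (at x)" "\<And>\<eta>. k \<eta> = h \<eta> + a"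
  shows "grad k x = grad h x"
proof (rule grad_eqI)
  have "GDERIV (\<lambda>\<eta>. h \<eta> + a) x :> grad h x + 0"
    by (intro GDERIV_add GDERIV_const GDERIV_grad assms)
  moreover have "k = (\<lambda>\<eta>. h \<eta> + a)" using assms(2) by (rule ext)
  ultimately show "GDERIV k x :> grad h x" by simp
qed

lemma matvec_neg_left: "(- M) *v z = - (M *v z)" for M :: "real^'b^'a"
  by (simp add: matrix_vector_mult_def vec_eq_iff sum_negf)

lemma primal_dual_optimality_system:
  fixes A :: "real^'s^'s" and B :: "real^'c^'s"
  assumes sol: "primal_dual_solution f c g A B t l x \<zeta> y v lam"
    and df: "\<And>\<tau> z. \<tau> < l \<Longrightarrow> f (t + \<tau>) differentiable (at z)"
    and dc: "\<And>\<tau> z. \<tau> < l \<Longrightarrow> c (t + Suc \<tau>) differentiable (at z)"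
    and dg: "\<And>z. g differentiable (at z)"
  shows "optimality_system (\<lambda>\<tau>. if \<tau> < l then f (t + \<tau>) else g) (\<lambda>\<tau>. c (t + Suc \<tau>)) A B l x \<zeta> y v lam"
proof -
  have c_sum: "(\<Sum>\<tau>=1..l. c (t + \<tau>) (v' (\<tau> - 1))) = (\<Sum>\<tau><l. c (t + Suc \<tau>) (v' \<tau>))" for v' :: "nat \<Rightarrow> real^'c"
    by (rule sum.reindex_bij_witness[of _ Suc "\<lambda>\<tau>. \<tau> - 1"]) auto
  have transpose_zero: "transpose (0 :: real^'b^'a) = 0"
    by (simp add: transpose_def vec_eq_iff)
  have transpose_neg: "transpose (- M) = - transpose M" for M :: "real^'b^'a"
    by (simp add: transpose_def vec_eq_iff)
  \<comment> \<open>The block column of \<open>y \<tau>\<close> meets only the rows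
    \<open>\<tau>\<close> and \<open>Suc \<tau>\<close>, and for \<open>\<tau> = l\<close> the
    second of these does not exist.\<close>
  have Jy: "(\<Sum>r\<le>l. transpose (J_y A r \<tau>) *v lam r)
      = lam \<tau> - (if \<tau> < l then transpose A *v lam (Suc \<tau>) else 0)" if "\<tau> \<le> l" for \<tau>
  proof -
    have "(\<Sum>r\<le>l. transpose (J_y A r \<tau>) *v lam r)
        = (\<Sum>r\<le>l. (if r = \<tau> then lam r else 0) + (if r = Suc \<tau> then - (transpose A *v lam r) else 0))"
      by (intro sum.cong)
         (auto simp: J_y_def transpose_neg matvec_neg_left transpose_mat transpose_zero
           simp del: transpose_matrix_vector)
    then show ?thesis using that by (simp add: sum.distrib sum.delta)
  qed
  have Jv: "(\<Sum>r\<le>l. transpose (J_v B r \<tau>) *v lam r) = - (transpose B *v lam (Suc \<tau>))" if "\<tau> < l" for \<tau>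
  proof -
    have "(\<Sum>r\<le>l. transpose (J_v B r \<tau>) *v lam r)
        = (\<Sum>r\<le>l. if r = Suc \<tau> then - (transpose B *v lam r) else 0)"
      by (intro sum.cong)
         (auto simp: J_v_def transpose_neg matvec_neg_left transpose_zero
           simp del: transpose_matrix_vector)
    then show ?thesis using that by (simp add: sum.delta)
  qed
  have gy: "grad (\<lambda>\<eta>. objective f c g t l (y(\<tau> := \<eta>)) v) (y \<tau>)
      = grad (if \<tau> < l then f (t + \<tau>) else g) (y \<tau>)" if "\<tau> \<le> l" for \<tau>
  proof (cases "\<tau> < l")
    case True
    have "(\<Sum>\<sigma><l. f (t + \<sigma>) ((y(\<tau> := \<eta>)) \<sigma>))
        = f (t + \<tau>) \<eta> + (\<Sum>\<sigma>\<in>{..<l} - {\<tau>}. f (t + \<sigma>) (y \<sigma>))" for \<eta>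
      using True by (subst sum.remove[of _ \<tau>]) (auto intro!: sum.cong)
    then have "objective f c g t l (y(\<tau> := \<eta>)) v = f (t + \<tau>) \<eta>
        + ((\<Sum>\<sigma>\<in>{..<l} - {\<tau>}. f (t + \<sigma>) (y \<sigma>)) + (\<Sum>\<tau>=1..l. c (t + \<tau>) (v (\<tau> - 1))) + g (y l))" for \<eta>
      using True by (simp add: objective_def)
    from grad_add_const[OF df[OF True] this] show ?thesis using True by simp
  next
    case False
    then have "\<tau> = l" using that by simp
    then have "objective f c g t l (y(\<tau> := \<eta>)) v = g \<eta>
        + ((\<Sum>\<sigma><l. f (t + \<sigma>) (y \<sigma>)) + (\<Sum>\<tau>=1..l. c (t + \<tau>) (v (\<tau> - 1))))" for \<eta>
      by (simp add: objective_def)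
    from grad_add_const[OF dg this] show ?thesis using False by simp
  qed
  have gv: "grad (\<lambda>\<eta>. objective f c g t l y (v(\<tau> := \<eta>))) (v \<tau>) = grad (c (t + Suc \<tau>)) (v \<tau>)"
    if "\<tau> < l" for \<tau>
  proof -
    have "(\<Sum>\<sigma><l. c (t + Suc \<sigma>) ((v(\<tau> := \<eta>)) \<sigma>))
        = c (t + Suc \<tau>) \<eta> + (\<Sum>\<sigma>\<in>{..<l} - {\<tau>}. c (t + Suc \<sigma>) (v \<sigma>))" for \<eta>
      using that by (subst sum.remove[of _ \<tau>]) (auto intro!: sum.cong)
    then have "objective f c g t l y (v(\<tau> := \<eta>)) = c (t + Suc \<tau>) \<eta>
        + ((\<Sum>\<sigma>\<in>{..<l} - {\<tau>}. c (t + Suc \<sigma>) (v \<sigma>)) + (\<Sum>\<sigma><l. f (t + \<sigma>) (y \<sigma>)) + g (y l))" for \<eta>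
      unfolding objective_def c_sum by simp
    from grad_add_const[OF dc[OF that] this] show ?thesis .
  qed
  show ?thesis
    using sol gy Jy gv Jv
    by (simp add: optimality_system_def primal_dual_solution_def minimizer_def stationary_def)
qed

section \<open>Bounds on primal-dual solutions by their data\<close>

lemma separable_secant_family:
  fixes h :: "nat \<Rightarrow> real^'a::finite \<Rightarrow> real" and own :: "'a \<Rightarrow> 'n::finite"
  assumes "\<And>\<tau>. \<tau> < n \<Longrightarrow> regular_cost \<mu> L (h \<tau>)" "\<And>\<tau>. \<tau> < n \<Longrightarrow> node_separable own (h \<tau>)"
  shows "\<exists>G. \<forall>\<tau><n. hessian_like \<mu> L (G \<tau>)
    \<and> G \<tau> (a \<tau> - b \<tau>) = grad (h \<tau>) (a \<tau>) - grad (h \<tau>) (b \<tau>)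
    \<and> (\<forall>S z. keep own S (G \<tau> z) = G \<tau> (keep own S z))"
proof -
  have "\<exists>G. hessian_like \<mu> L G \<and> G (a \<tau> - b \<tau>) = grad (h \<tau>) (a \<tau>) - grad (h \<tau>) (b \<tau>)
      \<and> (\<forall>S z. keep own S (G z) = G (keep own S z))" if "\<tau> < n" for \<tau>
    by (rule separable_secant[OF assms(1)[OF that] assms(2)[OF that], of "a \<tau>" "b \<tau>"])
       (unfold hessian_like_def, blast)
  then show ?thesis by metis
qed

lemma mu_H_bounds:
  assumes "0 < \<gamma>" "\<gamma> < 1" "1 < L" "0 < \<mu>"
  shows "0 < mu_H L \<gamma> \<mu>" "mu_H L \<gamma> \<mu> < 1"
proof -
  have J: "0 < mu_J L \<gamma>" "mu_J L \<gamma> < 1 / 2" using mu_J_bounds assms by auto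
  have LH: "3 < L_H L" using assms by (simp add: L_H_def)
  define X where "X = 1 + 2 * L_H L / \<mu> + (L_H L)\<^sup>2 / \<mu>\<^sup>2"
  have "0 \<le> 2 * L_H L / \<mu>" "0 \<le> (L_H L)\<^sup>2 / \<mu>\<^sup>2" using LH assms by auto
  then have X: "1 \<le> X" unfolding X_def by linarith
  have "1 < L_H L / mu_J L \<gamma>" using J LH by (simp add: less_divide_eq)
  moreover from this have "1 * (L_H L / mu_J L \<gamma>) \<le> X * (L_H L / mu_J L \<gamma>)"
    using X by (intro mult_right_mono) auto
  ultimately have "1 < X * (L_H L / mu_J L \<gamma>)" by linarith
  then have "1 < 1 / \<mu> + X * (L_H L / mu_J L \<gamma>)" using assms by (simp add: add_strict_increasing)
  then show "0 < mu_H L \<gamma> \<mu>" "mu_H L \<gamma> \<mu> < 1"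
    unfolding mu_H_def X_def[symmetric] by (auto intro: inverse_less_1_iff[THEN iffD2])
qed

lemma (in saddle) mu_H_lower:
  assumes "0 < \<gamma>" "\<gamma> < 1" and m: "m = mu_J L \<gamma>" and q: "q \<in> U \<times> W"
  shows "mu_H L \<gamma> \<mu> * norm q \<le> norm (H q)"
proof -
  have "norm q \<le> inverse (mu_H L \<gamma> \<mu>) * norm (H q)"
    using H_lower[OF q] unfolding mu_H_def m inverse_inverse_eq .
  then show ?thesis
    using mu_H_bounds(1)[OF assms(1,2) pos(2) pos(1)] by (simp add: field_simps)
qed

lemma norm_trunc_data_le:
  "norm (trunc (Suc l) (\<lambda>\<tau>. case \<tau> of 0 \<Rightarrow> keep own R x | Suc \<sigma> \<Rightarrow> keep own R (\<zeta> \<sigma>)))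
    \<le> norm x + (\<Sum>\<tau><l. norm (\<zeta> \<tau>))"
proof -
  let ?b = "\<lambda>\<tau>. case \<tau> of 0 \<Rightarrow> keep own R x | Suc \<sigma> \<Rightarrow> keep own R (\<zeta> \<sigma>)"
  have "norm (trunc (Suc l) ?b) \<le> (\<Sum>\<tau><Suc l. norm (?b \<tau>))"
    unfolding norm_trunc by (rule L2_set_le_sum) simp
  also have "\<dots> = norm (keep own R x) + (\<Sum>\<tau><l. norm (keep own R (\<zeta> \<tau>)))"
    by (subst sum.lessThan_Suc_shift) simp
  also have "\<dots> \<le> norm x + (\<Sum>\<tau><l. norm (\<zeta> \<tau>))"
    by (intro add_mono sum_mono norm_keep_le)
  finally show ?thesis .
qed

abbreviation packed :: "nat \<Rightarrow> (nat \<Rightarrow> 'a) \<Rightarrow> (nat \<Rightarrow> 'b) \<Rightarrow> (nat \<Rightarrow> 'a) \<Rightarrow>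
    ((nat \<Rightarrow>\<^sub>0 'a::zero) \<times> (nat \<Rightarrow>\<^sub>0 'b::zero)) \<times> (nat \<Rightarrow>\<^sub>0 'a)" where
  "packed l y v lam \<equiv> ((trunc (Suc l) y, trunc l v), trunc (Suc l) lam)"

text \<open>The secant operators are taken between the solution and the zero trajectory. All
  gradients vanish there, so the solution satisfies a linear saddle point system whose right-hand
  side is the data alone, and \<open>mu_H_lower\<close> applies.\<close>

lemma optimality_system_norm_le:
  fixes A :: "real^'s^'s" and B :: "real^'c^'s"
    and xn :: "'s \<Rightarrow> 'n::finite" and un :: "'c \<Rightarrow> 'n"
  assumes sys: "optimality_system hy hv A B l x \<zeta> y v lam"
    and AB: "opnorm A \<le> L" "opnorm B \<le> L" "stabilizable L \<gamma> A B"
    and params: "1 < L" "0 < \<gamma>" "\<gamma> < 1" "0 < \<mu>"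
    and hy: "\<And>\<tau>. \<tau> \<le> l \<Longrightarrow> regular_cost \<mu> L (hy \<tau>)" "\<And>\<tau>. \<tau> \<le> l \<Longrightarrow> node_separable xn (hy \<tau>)"
      "\<And>\<tau>. \<tau> \<le> l \<Longrightarrow> grad (hy \<tau>) 0 = 0"
    and hv: "\<And>\<tau>. \<tau> < l \<Longrightarrow> regular_cost \<mu> L (hv \<tau>)" "\<And>\<tau>. \<tau> < l \<Longrightarrow> node_separable un (hv \<tau>)"
      "\<And>\<tau>. \<tau> < l \<Longrightarrow> grad (hv \<tau>) 0 = 0"
  shows "mu_H L \<gamma> \<mu> * norm (packed l y v lam)
    \<le> norm (trunc (Suc l) (\<lambda>\<tau>. case \<tau> of 0 \<Rightarrow> x | Suc \<sigma> \<Rightarrow> \<zeta> \<sigma>))"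
proof -
  have "\<exists>G. \<forall>\<tau><Suc l. hessian_like \<mu> L (G \<tau>)
      \<and> G \<tau> (y \<tau> - 0) = grad (hy \<tau>) (y \<tau>) - grad (hy \<tau>) 0
      \<and> (\<forall>S z. keep xn S (G \<tau> z) = G \<tau> (keep xn S z))"
    by (rule separable_secant_family) (simp_all add: hy)
  then obtain Gy where Gy: "\<And>\<tau>. \<tau> \<le> l \<Longrightarrow> hessian_like \<mu> L (Gy \<tau>)"
    "\<And>\<tau>. \<tau> \<le> l \<Longrightarrow> Gy \<tau> (y \<tau> - 0) = grad (hy \<tau>) (y \<tau>) - grad (hy \<tau>) 0"
    unfolding less_Suc_eq_le by blast
  have "\<exists>G. \<forall>\<tau><l. hessian_like \<mu> L (G \<tau>)
      \<and> G \<tau> (v \<tau> - 0) = grad (hv \<tau>) (v \<tau>) - grad (hv \<tau>) 0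
      \<and> (\<forall>S z. keep un S (G \<tau> z) = G \<tau> (keep un S z))"
    by (rule separable_secant_family) (simp_all add: hv)
  then obtain Gv where Gv: "\<And>\<tau>. \<tau> < l \<Longrightarrow> hessian_like \<mu> L (Gv \<tau>)"
    "\<And>\<tau>. \<tau> < l \<Longrightarrow> Gv \<tau> (v \<tau> - 0) = grad (hv \<tau>) (v \<tau>) - grad (hv \<tau>) 0"
    by blast
  interpret saddle "G_op Gy Gv l" "J_op A B l" "Jt_op A B l" "supported (Suc l) \<times> supported l"
    "supported (Suc l)" \<mu> L "1 + sqrt 2 * L" "mu_J L \<gamma>"
    using AB params Gy(1) Gv(1) by (intro saddle_op)
  have feas: "y 0 = x" "\<And>\<tau>. \<tau> < l \<Longrightarrow> y (Suc \<tau>) = A *v y \<tau> + B *v v \<tau> + \<zeta> \<tau>"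
    and stat: "\<And>\<tau>. \<tau> \<le> l \<Longrightarrow> grad (hy \<tau>) (y \<tau>) + (lam \<tau> - (if \<tau> < l then transpose A *v lam (Suc \<tau>) else 0)) = 0"
      "\<And>\<tau>. \<tau> < l \<Longrightarrow> grad (hv \<tau>) (v \<tau>) - transpose B *v lam (Suc \<tau>) = 0"
    using sys by (auto simp: optimality_system_def feasible_def)
  have "H (packed l y v lam) = (0, trunc (Suc l) (\<lambda>\<tau>. case \<tau> of 0 \<Rightarrow> x | Suc \<sigma> \<Rightarrow> \<zeta> \<sigma>))"
  proof (intro prod_eqI poly_mapping_eqI)
    fix \<tau>
    show "lookup (fst (fst (H (packed l y v lam)))) \<tau>
        = lookup (fst (fst (0, trunc (Suc l) (\<lambda>\<tau>. case \<tau> of 0 \<Rightarrow> x | Suc \<sigma> \<Rightarrow> \<zeta> \<sigma>)))) \<tau>"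
      using Gy(2)[of \<tau>] hy(3)[of \<tau>] stat(1)[of \<tau>]
      by (auto simp: kkt_def G_op_def Jt_op_def lookup_add split: if_splits)
    show "lookup (snd (fst (H (packed l y v lam)))) \<tau>
        = lookup (snd (fst (0, trunc (Suc l) (\<lambda>\<tau>. case \<tau> of 0 \<Rightarrow> x | Suc \<sigma> \<Rightarrow> \<zeta> \<sigma>)))) \<tau>"
      using Gv(2)[of \<tau>] hv(3)[of \<tau>] stat(2)[of \<tau>]
      by (auto simp: kkt_def G_op_def Jt_op_def lookup_add)
    show "lookup (snd (H (packed l y v lam))) \<tau>
        = lookup (snd (0, trunc (Suc l) (\<lambda>\<tau>. case \<tau> of 0 \<Rightarrow> x | Suc \<sigma> \<Rightarrow> \<zeta> \<sigma>))) \<tau>"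
      using feas by (cases \<tau>) (auto simp: kkt_def J_op_def)
  qed
  then show ?thesis
    using mu_H_lower[OF params(2,3) refl, of "packed l y v lam"] by (simp add: norm_Pair)
qed

section \<open>The truncation error\<close>

text \<open>These are the sets \<open>Z n\<close> for \<open>banded_inverse_decay\<close>; the
  condition concerns space only and is imposed at every time.\<close>

definition vanishing :: "('n \<times> 'n) set \<Rightarrow> ('s::finite \<Rightarrow> 'n) \<Rightarrow> ('c::finite \<Rightarrow> 'n) \<Rightarrow> 'n \<Rightarrow> nat \<Rightarrow>
    (((nat \<Rightarrow>\<^sub>0 real^'s) \<times> (nat \<Rightarrow>\<^sub>0 real^'c)) \<times> (nat \<Rightarrow>\<^sub>0 real^'s)) set" where
  "vanishing E xn un i n = {q. \<forall>\<tau>. keep xn (dist_less E i n) (lookup (fst (fst q)) \<tau>) = 0 \<and>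
     keep un (dist_less E i n) (lookup (snd (fst q)) \<tau>) = 0 \<and>
     keep xn (dist_less E i n) (lookup (snd q) \<tau>) = 0}"

lemma keep_zero_subset: "keep own S z = 0 \<Longrightarrow> R \<subseteq> S \<Longrightarrow> keep own R z = 0"
  by (metis Int_absorb2 keep_keep keep_simps(1))

lemma subspace_vanishing: "subspace (vanishing E xn un i n)"
  by (simp add: subspace_def vanishing_def lookup_add)

lemma vanishing_Suc: "vanishing E xn un i (Suc n) \<subseteq> vanishing E xn un i n"
  unfolding vanishing_def
  by (auto intro: keep_zero_subset[OF _ dist_less_mono[of n "Suc n" E i]])

text \<open>\<open>G\<close> acts node by node and costs nothing; \<open>J\<close> and its adjoint
  each look one edge away, the adjoint because \<open>E\<close> is symmetric.\<close>

lemma vanishing_kkt: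
  fixes A :: "real^'s^'s" and B :: "real^'c^'s"
  assumes E: "sym E" and A: "graph_structured E xn xn A" and B: "graph_structured E xn un B"
    and Gy: "\<And>\<tau> S z. \<tau> \<le> l \<Longrightarrow> keep xn S (Gy \<tau> z) = Gy \<tau> (keep xn S z)" "\<And>\<tau>. \<tau> \<le> l \<Longrightarrow> Gy \<tau> 0 = 0"
    and Gv: "\<And>\<tau> S z. \<tau> < l \<Longrightarrow> keep un S (Gv \<tau> z) = Gv \<tau> (keep un S z)" "\<And>\<tau>. \<tau> < l \<Longrightarrow> Gv \<tau> 0 = 0"
    and q: "q \<in> vanishing E xn un i (Suc n)"
  shows "kkt (G_op Gy Gv l) (J_op A B l) (Jt_op A B l) q \<in> vanishing E xn un i n"
proof -
  let ?D = "dist_less E i n" and ?D' = "dist_less E i (Suc n)"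
  have sub: "?D \<subseteq> ?D'" by (rule dist_less_mono) simp
  have nb: "nbhd E j \<subseteq> ?D'" if "j \<in> ?D" for j
    using dist_less_neighbour[OF that] by (simp add: dist_less_Suc)
  obtain y v lam where qe: "q = ((y, v), lam)" by (metis prod.collapse)
  have van: "keep xn ?D' (lookup y \<tau>) = 0" "keep un ?D' (lookup v \<tau>) = 0"
      "keep xn ?D' (lookup lam \<tau>) = 0" for \<tau>
    using q by (auto simp: vanishing_def qe)
  note van' = van[THEN keep_zero_subset[OF _ sub]]
  have Ay: "keep xn ?D (A *v lookup y \<tau>) = 0" for \<tau>
    by (rule graph_structured_local[OF A nb van(1)])
  have Bv: "keep xn ?D (B *v lookup v \<tau>) = 0" for \<tau>
    by (rule graph_structured_local[OF B nb van(2)])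
  have Al: "keep xn ?D (transpose A *v lookup lam \<tau>) = 0" for \<tau>
    by (rule graph_structured_local[OF graph_structured_transpose[OF E A] nb van(3)])
  have Bl: "keep un ?D (transpose B *v lookup lam \<tau>) = 0" for \<tau>
    by (rule graph_structured_local[OF graph_structured_transpose[OF E B] nb van(3)])
  have 1: "keep xn ?D (lookup (fst (fst (kkt (G_op Gy Gv l) (J_op A B l) (Jt_op A B l) q))) \<tau>) = 0" for \<tau>
    by (simp add: kkt_def qe G_op_def Jt_op_def lookup_add van' Gy Al del: transpose_matrix_vector)
  have 2: "keep un ?D (lookup (snd (fst (kkt (G_op Gy Gv l) (J_op A B l) (Jt_op A B l) q))) \<tau>) = 0" for \<tau>
    by (simp add: kkt_def qe G_op_def Jt_op_def lookup_add van' Gv Bl del: transpose_matrix_vector)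
  have 3: "keep xn ?D (lookup (snd (kkt (G_op Gy Gv l) (J_op A B l) (Jt_op A B l) q)) \<tau>) = 0" for \<tau>
    by (cases \<tau>) (simp_all add: kkt_def qe J_op_def van' Ay Bv)
  show ?thesis unfolding vanishing_def using 1 2 3 by blast
qed

section \<open>The residual: formula, norm and decay\<close>

lemma norm_packed_le: "norm (packed l y v lam) \<le> norm (trunc (Suc l) y) + norm (trunc l v) + norm (trunc (Suc l) lam)"
  using norm_Pair_le[of "(trunc (Suc l) y, trunc l v)" "trunc (Suc l) lam"]
    norm_Pair_le[of "trunc (Suc l) y" "trunc l v"] by linarith

lemma norm_packed_components:
  "norm (trunc (Suc l) y) \<le> norm (packed l y v lam)" "norm (trunc l v) \<le> norm (packed l y v lam)"
  "norm (trunc (Suc l) lam) \<le> norm (packed l y v lam)"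
  using norm_fst_le[of "(trunc (Suc l) y, trunc l v)" "trunc (Suc l) lam"]
    norm_snd_le[of "trunc (Suc l) lam" "(trunc (Suc l) y, trunc l v)"]
    norm_fst_le[of "trunc (Suc l) y" "trunc l v"] norm_snd_le[of "trunc l v" "trunc (Suc l) y"]
  by linarith+

lemma norm_trunc_Suc_le: "norm (trunc l (\<lambda>\<tau>. f (Suc \<tau>))) \<le> norm (trunc (Suc l) f)"
  for f :: "nat \<Rightarrow> 'a::real_inner"
proof -
  have "norm (trunc (Suc l) (shift (\<lambda>\<tau>. f (Suc \<tau>)))) \<le> 1 * norm (trunc (Suc l) f)"
    by (rule norm_trunc_le) (auto split: nat.split)
  then show ?thesis unfolding norm_trunc_shift by simp
qed

lemma node_norm_packed:
  "node_norm xn un i l y v lam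
    = norm (packed l (\<lambda>\<tau>. keep xn {i} (y \<tau>)) (\<lambda>\<tau>. keep un {i} (v \<tau>)) (\<lambda>\<tau>. keep xn {i} (lam \<tau>)))"
  unfolding node_norm_def norm_Pair norm_trunc L2_set_def
  by (simp add: sum_nonneg lessThan_Suc_atMost add_nonneg_nonneg del: sum.lessThan_Suc)

lemma packed_lookup:
  "q \<in> (supported (Suc l) \<times> supported l) \<times> supported (Suc l) \<Longrightarrow>
    packed l (lookup (fst (fst q))) (lookup (snd (fst q))) (lookup (snd q)) = q"
  by (auto simp: trunc_lookup)

text \<open>
  Restricting to the component \<open>C\<close> of \<open>i\<close> makes the stabilizability assumption applicable when the
  graph is disconnected.
\<close>

lemma truncation_residual:
  fixes A :: "real^'s^'s" and B :: "real^'c^'s" and C N :: "'n set"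
    and xn :: "'s \<Rightarrow> 'n" and un :: "'c \<Rightarrow> 'n"
  assumes E: "sym E" and A: "graph_structured E xn xn A" and B: "graph_structured E xn un B"
    and C: "\<And>j. j \<in> C \<Longrightarrow> nbhd E j \<subseteq> C" and NC: "N \<subseteq> C"
    and c: "optimality_system hy hv A B l x \<zeta> yc vc lamc"
    and d: "optimality_system hy hv (keep_rows xn N A) (keep_rows xn N B) l
      (keep xn N x) (\<lambda>\<tau>. keep xn N (\<zeta> \<tau>)) yd vd lamd"
    and Gy: "\<And>\<tau>. \<tau> \<le> l \<Longrightarrow> Gy \<tau> (yc \<tau> - yd \<tau>) = grad (hy \<tau>) (yc \<tau>) - grad (hy \<tau>) (yd \<tau>)"
      "\<And>\<tau> S z. \<tau> \<le> l \<Longrightarrow> keep xn S (Gy \<tau> z) = Gy \<tau> (keep xn S z)"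
    and Gv: "\<And>\<tau>. \<tau> < l \<Longrightarrow> Gv \<tau> (vc \<tau> - vd \<tau>) = grad (hv \<tau>) (vc \<tau>) - grad (hv \<tau>) (vd \<tau>)"
      "\<And>\<tau> S z. \<tau> < l \<Longrightarrow> keep un S (Gv \<tau> z) = Gv \<tau> (keep un S z)"
  shows "kkt (G_op Gy Gv l) (J_op (keep_rows xn C A) (keep_rows xn C B) l)
      (Jt_op (keep_rows xn C A) (keep_rows xn C B) l)
      (packed l (\<lambda>\<tau>. keep xn C (yc \<tau> - yd \<tau>)) (\<lambda>\<tau>. keep un C (vc \<tau> - vd \<tau>))
        (\<lambda>\<tau>. keep xn C (lamc \<tau> - lamd \<tau>)))
    = packed l (\<lambda>\<tau>. if \<tau> < l then transpose A *v keep xn (C - N) (lamd (Suc \<tau>)) else 0)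
        (\<lambda>\<tau>. transpose B *v keep xn (C - N) (lamd (Suc \<tau>)))
        (\<lambda>\<tau>. (case \<tau> of 0 \<Rightarrow> keep xn (C - N) x | Suc \<sigma> \<Rightarrow> keep xn (C - N) (\<zeta> \<sigma>))
          + shift (\<lambda>\<sigma>. keep xn (C - N) (A *v yd \<sigma> + B *v vd \<sigma>)) \<tau>)"
    (is "kkt ?G ?J ?Jt ?e = ?r")
proof -
  have keepA: "keep xn C (A *v z) = A *v keep xn C z" for z
    using keep_matvec_commute[OF A E C] .
  have keepB: "keep xn C (B *v z) = B *v keep un C z" for z
    using keep_matvec_commute[OF B E C] .
  have keepAt: "keep xn C (transpose A *v z) = transpose A *v keep xn C z" for z
    using keep_matvec_commute[OF graph_structured_transpose[OF E A] E C] .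
  have keepBt: "keep un C (transpose B *v z) = transpose B *v keep xn C z" for z
    using keep_matvec_commute[OF graph_structured_transpose[OF E B] E C] .
  \<comment> \<open>Everything on \<open>C\<close> splits into a part on \<open>N\<close>, where the
    two problems have the same equations and the terms cancel, and a part on \<open>C - N\<close>,
    which is left over as the residual.\<close>
  have CN: "C \<inter> N = N" "C \<inter> (C - N) = C - N" "keep xn C z = keep xn N z + keep xn (C - N) z" for z :: "real^'s"
    using NC by (auto simp: vec_eq_iff)
  have fc: "yc 0 = x" "\<And>\<tau>. \<tau> < l \<Longrightarrow> yc (Suc \<tau>) = A *v yc \<tau> + B *v vc \<tau> + \<zeta> \<tau>"
    and fd: "yd 0 = keep xn N x"
      "\<And>\<tau>. \<tau> < l \<Longrightarrow> yd (Suc \<tau>) = keep xn N (A *v yd \<tau>) + keep xn N (B *v vd \<tau>) + keep xn N (\<zeta> \<tau>)"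
    using c d by (auto simp: optimality_system_def feasible_def keep_rows_matvec)
  have sc: "grad (hy \<tau>) (yc \<tau>) = (if \<tau> < l then transpose A *v lamc (Suc \<tau>) else 0) - lamc \<tau>" if "\<tau> \<le> l" for \<tau>
    using c that by (simp add: optimality_system_def eq_neg_iff_add_eq_0 algebra_simps del: transpose_matrix_vector)
  have sd: "grad (hy \<tau>) (yd \<tau>) = (if \<tau> < l then transpose A *v keep xn N (lamd (Suc \<tau>)) else 0) - lamd \<tau>" if "\<tau> \<le> l" for \<tau>
    using d that unfolding optimality_system_def transpose_keep_rows_matvec
    by (simp add: eq_neg_iff_add_eq_0 algebra_simps del: transpose_matrix_vector)
  have svc: "grad (hv \<tau>) (vc \<tau>) = transpose B *v lamc (Suc \<tau>)" if "\<tau> < l" for \<tau>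
    using c that by (simp add: optimality_system_def del: transpose_matrix_vector)
  have svd: "grad (hv \<tau>) (vd \<tau>) = transpose B *v keep xn N (lamd (Suc \<tau>))" if "\<tau> < l" for \<tau>
    using d that unfolding optimality_system_def transpose_keep_rows_matvec
    by (simp del: transpose_matrix_vector)
  note lin = matrix_vector_right_distrib matrix_vector_mult_diff_distrib
  show ?thesis
  proof (intro prod_eqI poly_mapping_eqI)
    fix \<tau>
    show "lookup (fst (fst (kkt ?G ?J ?Jt ?e))) \<tau> = lookup (fst (fst ?r)) \<tau>"
    proof (cases "\<tau> \<le> l")
      case True
      have "Gy \<tau> (keep xn C (yc \<tau> - yd \<tau>)) = keep xn C (grad (hy \<tau>) (yc \<tau>) - grad (hy \<tau>) (yd \<tau>))"
        using Gy[OF True] by metis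
      also have "\<dots> = (if \<tau> < l then transpose A *v keep xn C (lamc (Suc \<tau>)) - transpose A *v keep xn N (lamd (Suc \<tau>)) else 0)
          - keep xn C (lamc \<tau> - lamd \<tau>)"
        unfolding sc[OF True] sd[OF True]
        by (simp add: keepAt CN(1) del: transpose_matrix_vector)
      finally have G: "Gy \<tau> (keep xn C (yc \<tau> - yd \<tau>)) = \<dots>" .
      show ?thesis
        using True
        by (simp add: kkt_def G_op_def Jt_op_def lookup_add G transpose_keep_rows_matvec lin
            CN(3)[of "lamd (Suc \<tau>)"] del: transpose_matrix_vector keep_simps)
           (simp add: CN(3)[of "lamd (Suc \<tau>)"] lin del: transpose_matrix_vector)
    qed (simp add: kkt_def G_op_def Jt_op_def lookup_add)
    show "lookup (snd (fst (kkt ?G ?J ?Jt ?e))) \<tau> = lookup (snd (fst ?r)) \<tau>"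
    proof (cases "\<tau> < l")
      case True
      have "Gv \<tau> (keep un C (vc \<tau> - vd \<tau>)) = keep un C (grad (hv \<tau>) (vc \<tau>) - grad (hv \<tau>) (vd \<tau>))"
        using Gv[OF True] by metis
      also have "\<dots> = transpose B *v keep xn C (lamc (Suc \<tau>)) - transpose B *v keep xn N (lamd (Suc \<tau>))"
        unfolding svc[OF True] svd[OF True]
        by (simp add: keepBt CN(1) del: transpose_matrix_vector)
      finally have G: "Gv \<tau> (keep un C (vc \<tau> - vd \<tau>)) = \<dots>" .
      show ?thesis
        using True
        by (simp add: kkt_def G_op_def Jt_op_def lookup_add G transpose_keep_rows_matvec
            del: transpose_matrix_vector keep_simps)
           (simp add: CN(3)[of "lamd (Suc \<tau>)"] lin del: transpose_matrix_vector)
    qed (simp add: kkt_def G_op_def Jt_op_def lookup_add)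
    show "lookup (snd (kkt ?G ?J ?Jt ?e)) \<tau> = lookup (snd ?r) \<tau>"
    proof (cases \<tau>)
      case 0
      then show ?thesis
        by (simp add: kkt_def J_op_def fc fd CN(1) CN(3)[of x])
    next
      case (Suc \<sigma>)
      show ?thesis
      proof (cases "\<sigma> < l")
        case True
        have "keep xn C (yc (Suc \<sigma>) - yd (Suc \<sigma>))
            = A *v keep xn C (yc \<sigma>) + B *v keep un C (vc \<sigma>) + keep xn C (\<zeta> \<sigma>)
              - (keep xn N (A *v yd \<sigma>) + keep xn N (B *v vd \<sigma>) + keep xn N (\<zeta> \<sigma>))"
          unfolding fc(2)[OF True] fd(2)[OF True] by (simp add: keepA keepB CN(1))
        then have "keep xn C (yc (Suc \<sigma>) - yd (Suc \<sigma>))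
            - (keep xn C (A *v keep xn C (yc \<sigma> - yd \<sigma>)) + keep xn C (B *v keep un C (vc \<sigma> - vd \<sigma>)))
            = keep xn (C - N) (\<zeta> \<sigma>) + keep xn (C - N) (A *v yd \<sigma> + B *v vd \<sigma>)"
          using CN(3)[of "A *v yd \<sigma>"] CN(3)[of "B *v vd \<sigma>"] CN(3)[of "\<zeta> \<sigma>"]
          by (simp add: keepA keepB CN(1,2) lin algebra_simps)
        then show ?thesis
          using True Suc by (simp add: kkt_def J_op_def keep_rows_matvec del: keep_simps)
      qed (use Suc in \<open>simp add: kkt_def J_op_def\<close>)
    qed
  qed
qed

text \<open>The factor \<open>4 * L\<close> counts four matrix products: the two transposes applied
  to \<open>lam\<close>, and \<open>A\<close> and \<open>B\<close> applied to the states and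
  controls.\<close>

lemma truncation_residual_norm_le:
  fixes A :: "real^'s^'s" and B :: "real^'c^'s" and xn :: "'s \<Rightarrow> 'n"
  assumes AB: "opnorm A \<le> L" "opnorm B \<le> L"
  shows "norm (packed l (\<lambda>\<tau>. if \<tau> < l then transpose A *v keep xn S (lam (Suc \<tau>)) else 0)
        (\<lambda>\<tau>. transpose B *v keep xn S (lam (Suc \<tau>)))
        (\<lambda>\<tau>. (case \<tau> of 0 \<Rightarrow> keep xn S x | Suc \<sigma> \<Rightarrow> keep xn S (\<zeta> \<sigma>))
          + shift (\<lambda>\<sigma>. keep xn S (A *v y \<sigma> + B *v v \<sigma>)) \<tau>))
    \<le> norm x + (\<Sum>\<tau><l. norm (\<zeta> \<tau>)) + 4 * L * norm (packed l y v lam)"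
    (is "norm (packed l ?ry ?rv ?rl) \<le> _")
proof -
  let ?q = "norm (packed l y v lam)" and ?lam = "trunc l (\<lambda>\<tau>. lam (Suc \<tau>))"
  have L0: "0 \<le> L" using AB opnorm_nonneg order_trans by blast
  have lam_le: "L * norm ?lam \<le> L * ?q"
    using L0 norm_trunc_Suc_le[of l lam] norm_packed_components(3)[of l lam y v]
    by (intro mult_left_mono) auto
  have keep_le: "L * norm (keep xn S z) \<le> L * norm z" for z
    using L0 norm_keep_le by (intro mult_left_mono) auto
  have "norm (trunc (Suc l) ?ry) \<le> L * norm ?lam"
  proof (rule norm_trunc_le)
    show "norm (?ry \<tau>) \<le> L * norm (lookup ?lam \<tau>)" for \<tau>
      using order_trans[OF norm_transpose_matvec_le[OF AB(1)] keep_le, of "lam (Suc \<tau>)"]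
      by (simp del: transpose_matrix_vector)
  qed (rule L0)
  then have 1: "norm (trunc (Suc l) ?ry) \<le> L * ?q" using lam_le by linarith
  have "norm (trunc l ?rv) \<le> L * norm ?lam"
  proof (rule norm_trunc_le)
    show "norm (?rv \<tau>) \<le> L * norm (lookup ?lam \<tau>)" if "\<tau> < l" for \<tau>
      using that order_trans[OF norm_transpose_matvec_le[OF AB(2)] keep_le, of "lam (Suc \<tau>)"]
      by (simp del: transpose_matrix_vector)
  qed (rule L0)
  then have 2: "norm (trunc l ?rv) \<le> L * ?q" using lam_le by linarith
  have A_le: "norm (trunc l (\<lambda>\<sigma>. keep xn S (A *v y \<sigma>))) \<le> L * norm (trunc (Suc l) y)"
  proof (rule norm_trunc_le)
    show "norm (keep xn S (A *v y \<sigma>)) \<le> L * norm (lookup (trunc (Suc l) y) \<sigma>)" if "\<sigma> < l" for \<sigma>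
      using that order_trans[OF norm_keep_le norm_matvec_le[OF AB(1)], of xn S "y \<sigma>"] by simp
  qed (rule L0)
  have B_le: "norm (trunc l (\<lambda>\<sigma>. keep xn S (B *v v \<sigma>))) \<le> L * norm (trunc l v)"
  proof (rule norm_trunc_le)
    show "norm (keep xn S (B *v v \<sigma>)) \<le> L * norm (lookup (trunc l v) \<sigma>)" if "\<sigma> < l" for \<sigma>
      using that order_trans[OF norm_keep_le norm_matvec_le[OF AB(2)], of xn S "v \<sigma>"] by simp
  qed (rule L0)
  have "norm (trunc (Suc l) (shift (\<lambda>\<sigma>. keep xn S (A *v y \<sigma> + B *v v \<sigma>))))
      = norm (trunc l (\<lambda>\<sigma>. keep xn S (A *v y \<sigma>)) + trunc l (\<lambda>\<sigma>. keep xn S (B *v v \<sigma>)))"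
    unfolding norm_trunc_shift keep_simps(2) trunc_add ..
  also have "\<dots> \<le> L * norm (trunc (Suc l) y) + L * norm (trunc l v)"
    using norm_triangle_ineq A_le B_le by (meson add_mono order_trans)
  also have "\<dots> \<le> L * ?q + L * ?q"
    using L0 norm_packed_components[of l] by (intro add_mono mult_left_mono) auto
  finally have 3: "norm (trunc (Suc l) (shift (\<lambda>\<sigma>. keep xn S (A *v y \<sigma> + B *v v \<sigma>)))) \<le> L * ?q + L * ?q" .
  have "norm (trunc (Suc l) ?rl)
      \<le> norm (trunc (Suc l) (\<lambda>\<tau>. case \<tau> of 0 \<Rightarrow> keep xn S x | Suc \<sigma> \<Rightarrow> keep xn S (\<zeta> \<sigma>)))
        + norm (trunc (Suc l) (shift (\<lambda>\<sigma>. keep xn S (A *v y \<sigma> + B *v v \<sigma>))))"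
    unfolding trunc_add by (rule norm_triangle_ineq)
  also have "\<dots> \<le> (norm x + (\<Sum>\<tau><l. norm (\<zeta> \<tau>))) + (L * ?q + L * ?q)"
    by (rule add_mono[OF norm_trunc_data_le 3])
  finally show ?thesis using norm_packed_le[of l ?ry ?rv ?rl] 1 2 by linarith
qed

text \<open>\<open>mu_H\<close> is used twice: to bound the truncated solution, and with it the
  residual, by the data, and to bound the error by the residual. For \<open>C = N\<close> no
  residual is left. The set \<open>C\<close> is later the component of \<open>i\<close>.\<close>

lemma truncation_error:
  fixes A :: "real^'s^'s" and B :: "real^'c^'s" and C N :: "'n::finite set"
    and xn :: "'s \<Rightarrow> 'n" and un :: "'c \<Rightarrow> 'n"
  assumes N_def: "N = nbhd_k E \<kappa> i" and E: "sym E" and A: "graph_structured E xn xn A" and B: "graph_structured E xn un B"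
    and C: "\<And>j. j \<in> C \<Longrightarrow> nbhd E j \<subseteq> C" and NC: "N \<subseteq> C" and i: "i \<in> C"
    and AB: "opnorm A \<le> L" "opnorm B \<le> L"
    and stab: "stabilizable L \<gamma> (keep_rows xn N A) (keep_rows xn N B)"
      "stabilizable L \<gamma> (keep_rows xn C A) (keep_rows xn C B)"
    and params: "1 < L" "0 < \<gamma>" "\<gamma> < 1" "0 < \<mu>"
    and hy: "\<And>\<tau>. \<tau> \<le> l \<Longrightarrow> regular_cost \<mu> L (hy \<tau>)" "\<And>\<tau>. \<tau> \<le> l \<Longrightarrow> node_separable xn (hy \<tau>)"
      "\<And>\<tau>. \<tau> \<le> l \<Longrightarrow> grad (hy \<tau>) 0 = 0"
    and hv: "\<And>\<tau>. \<tau> < l \<Longrightarrow> regular_cost \<mu> L (hv \<tau>)" "\<And>\<tau>. \<tau> < l \<Longrightarrow> node_separable un (hv \<tau>)"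
      "\<And>\<tau>. \<tau> < l \<Longrightarrow> grad (hv \<tau>) 0 = 0"
    and c: "optimality_system hy hv A B l x \<zeta> yc vc lamc"
    and d: "optimality_system hy hv (keep_rows xn N A) (keep_rows xn N B) l
      (keep xn N x) (\<lambda>\<tau>. keep xn N (\<zeta> \<tau>)) yd vd lamd"
  shows "mu_H L \<gamma> \<mu> * node_norm xn un i l (\<lambda>\<tau>. yc \<tau> - yd \<tau>) (\<lambda>\<tau>. vc \<tau> - vd \<tau>) (\<lambda>\<tau>. lamc \<tau> - lamd \<tau>)
    \<le> ((decay_rho L \<gamma> \<mu>)\<^sup>2) ^ (\<kappa> div 2)
      * (if C = N then 0 else (1 + 4 * L / mu_H L \<gamma> \<mu>) * (norm x + (\<Sum>\<tau><l. norm (\<zeta> \<tau>))))"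
proof -
  let ?m = "mu_H L \<gamma> \<mu>" and ?M = "L_H L" and ?X = "norm x + (\<Sum>\<tau><l. norm (\<zeta> \<tau>))"
  have m: "0 < ?m" "?m < 1" using mu_H_bounds params by auto
  have M: "3 < ?M" using params by (simp add: L_H_def)
  have "\<exists>G. \<forall>\<tau><Suc l. hessian_like \<mu> L (G \<tau>)
      \<and> G \<tau> (yc \<tau> - yd \<tau>) = grad (hy \<tau>) (yc \<tau>) - grad (hy \<tau>) (yd \<tau>)
      \<and> (\<forall>S z. keep xn S (G \<tau> z) = G \<tau> (keep xn S z))"
    by (rule separable_secant_family) (simp_all add: hy)
  then obtain Gy where Gy: "\<And>\<tau>. \<tau> \<le> l \<Longrightarrow> hessian_like \<mu> L (Gy \<tau>)"
    "\<And>\<tau>. \<tau> \<le> l \<Longrightarrow> Gy \<tau> (yc \<tau> - yd \<tau>) = grad (hy \<tau>) (yc \<tau>) - grad (hy \<tau>) (yd \<tau>)"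
    "\<And>\<tau> S z. \<tau> \<le> l \<Longrightarrow> keep xn S (Gy \<tau> z) = Gy \<tau> (keep xn S z)"
    unfolding less_Suc_eq_le by blast
  have "\<exists>G. \<forall>\<tau><l. hessian_like \<mu> L (G \<tau>)
      \<and> G \<tau> (vc \<tau> - vd \<tau>) = grad (hv \<tau>) (vc \<tau>) - grad (hv \<tau>) (vd \<tau>)
      \<and> (\<forall>S z. keep un S (G \<tau> z) = G \<tau> (keep un S z))"
    by (rule separable_secant_family) (simp_all add: hv)
  then obtain Gv where Gv: "\<And>\<tau>. \<tau> < l \<Longrightarrow> hessian_like \<mu> L (Gv \<tau>)"
    "\<And>\<tau>. \<tau> < l \<Longrightarrow> Gv \<tau> (vc \<tau> - vd \<tau>) = grad (hv \<tau>) (vc \<tau>) - grad (hv \<tau>) (vd \<tau>)"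
    "\<And>\<tau> S z. \<tau> < l \<Longrightarrow> keep un S (Gv \<tau> z) = Gv \<tau> (keep un S z)"
    by blast
  interpret saddle "G_op Gy Gv l" "J_op (keep_rows xn C A) (keep_rows xn C B) l"
    "Jt_op (keep_rows xn C A) (keep_rows xn C B) l" "supported (Suc l) \<times> supported l"
    "supported (Suc l)" \<mu> L "1 + sqrt 2 * L" "mu_J L \<gamma>"
    using opnorm_keep_rows_le[OF AB(1)] opnorm_keep_rows_le[OF AB(2)] stab(2) params Gy(1) Gv(1)
    by (intro saddle_op)
  let ?V = "(supported (Suc l) \<times> supported l) \<times> supported (Suc l)
    :: (((nat \<Rightarrow>\<^sub>0 real^'s) \<times> (nat \<Rightarrow>\<^sub>0 real^'c)) \<times> (nat \<Rightarrow>\<^sub>0 real^'s)) set"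
  define e where "e = packed l (\<lambda>\<tau>. keep xn C (yc \<tau> - yd \<tau>)) (\<lambda>\<tau>. keep un C (vc \<tau> - vd \<tau>))
        (\<lambda>\<tau>. keep xn C (lamc \<tau> - lamd \<tau>))"
  define r where "r = packed l (\<lambda>\<tau>. if \<tau> < l then transpose A *v keep xn (C - N) (lamd (Suc \<tau>)) else 0)
        (\<lambda>\<tau>. transpose B *v keep xn (C - N) (lamd (Suc \<tau>)))
        (\<lambda>\<tau>. (case \<tau> of 0 \<Rightarrow> keep xn (C - N) x | Suc \<sigma> \<Rightarrow> keep xn (C - N) (\<zeta> \<sigma>))
          + shift (\<lambda>\<sigma>. keep xn (C - N) (A *v yd \<sigma> + B *v vd \<sigma>)) \<tau>)"
  have He: "H e = r"
    unfolding e_def r_def by (rule truncation_residual[OF E A B C NC c d Gy(2,3) Gv(2,3)])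
  have eV: "e \<in> ?V" by (simp add: e_def)
  have r_norm: "norm r \<le> (if C = N then 0 else (1 + 4 * L / ?m) * ?X)"
  proof (cases "C = N")
    case True
    then have "r = 0" by (auto simp: r_def zero_prod_def poly_mapping_eq_iff fun_eq_iff split: nat.split)
    then show ?thesis using True by simp
  next
    case False
    have "?m * norm (packed l yd vd lamd)
        \<le> norm (trunc (Suc l) (\<lambda>\<tau>. case \<tau> of 0 \<Rightarrow> keep xn N x | Suc \<sigma> \<Rightarrow> keep xn N (\<zeta> \<sigma>)))"
      by (rule optimality_system_norm_le[OF d opnorm_keep_rows_le[OF AB(1)] opnorm_keep_rows_le[OF AB(2)]
          stab(1) params hy hv])
    also have "\<dots> \<le> ?X" by (rule norm_trunc_data_le)
    finally have "norm (packed l yd vd lamd) \<le> ?X / ?m" using m by (simp add: field_simps)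
    then have "4 * L * norm (packed l yd vd lamd) \<le> 4 * L * (?X / ?m)"
      using params by (intro mult_left_mono) auto
    moreover have "norm r \<le> ?X + 4 * L * norm (packed l yd vd lamd)"
      unfolding r_def by (rule truncation_residual_norm_le[OF AB])
    moreover have "?X + 4 * L * (?X / ?m) = (1 + 4 * L / ?m) * ?X"
      by (simp add: algebra_simps add_divide_distrib)
    ultimately show ?thesis using False by simp
  qed
  let ?D = "dist_less E i \<kappa>"
  \<comment> \<open>Quantities on \<open>C - N\<close> live at distance at least
    \<open>\<kappa> + 1\<close>. The transposed matrices carry them at most one edge inward, so
    everything below distance \<open>\<kappa>\<close> stays zero.\<close>
  have rZ: "r \<in> vanishing E xn un i \<kappa>"
  proof -
    have nb: "nbhd E j \<subseteq> N" if "j \<in> ?D" for j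
      using dist_less_neighbour[OF that] by (simp add: N_def)
    have "?D \<subseteq> N" using dist_less_mono[of \<kappa> "Suc \<kappa>" E i] by (simp add: dist_less_Suc N_def)
    then have D: "?D \<inter> (C - N) = {}" "N \<inter> (C - N) = {}" by auto
    have 1: "keep xn ?D (transpose A *v keep xn (C - N) z) = 0" for z
      by (rule graph_structured_local[OF graph_structured_transpose[OF E A] nb]) (simp_all add: D)
    have 2: "keep un ?D (transpose B *v keep xn (C - N) z) = 0" for z
      by (rule graph_structured_local[OF graph_structured_transpose[OF E B] nb]) (simp_all add: D)
    have "keep xn ?D (lookup (snd r) \<tau>) = 0" for \<tau>
      by (cases \<tau>) (simp_all only: r_def snd_conv lookup_trunc if_distrib[of "keep xn ?D"] keep_simps
        nat.case keep_keep D keep_empty add_0 if_cancel add_0_right)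
    then show ?thesis
      using 1 2 by (simp add: vanishing_def r_def del: transpose_matrix_vector)
  qed
  have G0: "Gy \<tau> 0 = 0" if "\<tau> \<le> l" for \<tau>
    using Gy(1)[OF that] by (simp add: hessian_like_def linear_0)
  have G0': "Gv \<tau> 0 = 0" if "\<tau> < l" for \<tau>
    using Gv(1)[OF that] by (simp add: hessian_like_def linear_0)
  obtain e' where e': "e' \<in> ?V" "e - e' \<in> vanishing E xn un i 1"
    "norm e' \<le> ((?M\<^sup>2 - ?m\<^sup>2) / (?M\<^sup>2 + ?m\<^sup>2)) ^ (\<kappa> div 2) * norm e"
  proof (rule banded_inverse_decay[OF linear_H subspace_UW H_maps H_sym])
    show "?m * norm q \<le> norm (H q)" if "q \<in> ?V" for q
      by (rule mu_H_lower[OF params(2,3) refl that])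
    show "norm (H q) \<le> ?M * norm q" if "q \<in> ?V" for q by (rule H_upper[OF that])
    show "0 < ?m" "0 \<le> ?M" using m M by auto
    show "subspace (vanishing E xn un i n)" for n by (rule subspace_vanishing)
    show "vanishing E xn un i (Suc n) \<subseteq> vanishing E xn un i n" for n by (rule vanishing_Suc)
    show "H q \<in> vanishing E xn un i n" if "q \<in> vanishing E xn un i (Suc n)" for n q
      by (rule vanishing_kkt[OF E graph_structured_keep_rows[OF A] graph_structured_keep_rows[OF B]
          Gy(3) G0 Gv(3) G0' that])
    show "e \<in> ?V" by (rule eV)
    show "H e \<in> vanishing E xn un i \<kappa>" unfolding He by (rule rZ)
    show "2 * (\<kappa> div 2) \<le> \<kappa>" by simp
  qed (assumption | rule that)+
  \<comment> \<open>Vanishing on this set means that \<open>e\<close> and \<open>e'\<close> have the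
    same block at \<open>i\<close>, and \<open>e'\<close> is small as a whole.\<close>
  have iD: "{i} \<subseteq> dist_less E i 1"
    by (simp add: dist_less_def gdist_self zero_enat_def)
  have van: "keep xn {i} (lookup (fst (fst (e - e'))) \<tau>) = 0"
    "keep un {i} (lookup (snd (fst (e - e'))) \<tau>) = 0"
    "keep xn {i} (lookup (snd (e - e')) \<tau>) = 0" for \<tau>
    using e'(2) keep_zero_subset[OF _ iD] unfolding vanishing_def by blast+
  let ?y = "lookup (fst (fst e'))" and ?v = "lookup (snd (fst e'))" and ?l = "lookup (snd e')"
  have "{i} \<inter> C = {i}" using i by auto
  then have eq: "\<tau> < Suc l \<Longrightarrow> keep xn {i} (yc \<tau> - yd \<tau>) = keep xn {i} (?y \<tau>)"
    "\<tau> < l \<Longrightarrow> keep un {i} (vc \<tau> - vd \<tau>) = keep un {i} (?v \<tau>)"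
    "\<tau> < Suc l \<Longrightarrow> keep xn {i} (lamc \<tau> - lamd \<tau>) = keep xn {i} (?l \<tau>)" for \<tau>
    using van[of \<tau>] by (simp_all add: e_def lookup_minus)
  have trunc_cong: "trunc n f = trunc n g" if "\<And>k. k < n \<Longrightarrow> f k = g k" for n and f g :: "nat \<Rightarrow> real^'d"
    using that by (intro poly_mapping_eqI) simp
  have keep_le: "norm (trunc n (\<lambda>\<tau>. keep own {i} (f \<tau>))) \<le> norm (trunc n f)"
    for n and own :: "'d::finite \<Rightarrow> 'n" and f
    using norm_trunc_le[of n "\<lambda>\<tau>. keep own {i} (f \<tau>)" 1 "trunc n f"] by (simp add: norm_keep_le)
  have "node_norm xn un i l (\<lambda>\<tau>. yc \<tau> - yd \<tau>) (\<lambda>\<tau>. vc \<tau> - vd \<tau>) (\<lambda>\<tau>. lamc \<tau> - lamd \<tau>)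
      = norm (packed l (\<lambda>\<tau>. keep xn {i} (?y \<tau>)) (\<lambda>\<tau>. keep un {i} (?v \<tau>)) (\<lambda>\<tau>. keep xn {i} (?l \<tau>)))"
    unfolding node_norm_packed
    by (intro arg_cong[where f = norm] arg_cong2[where f = Pair] trunc_cong eq)
  also have "\<dots> \<le> norm (packed l ?y ?v ?l)"
    unfolding norm_Pair real_sqrt_le_iff
    by (simp add: add_mono keep_le)
  also have "packed l ?y ?v ?l = e'" by (rule packed_lookup[OF e'(1)])
  finally have node: "node_norm xn un i l (\<lambda>\<tau>. yc \<tau> - yd \<tau>) (\<lambda>\<tau>. vc \<tau> - vd \<tau>) (\<lambda>\<tau>. lamc \<tau> - lamd \<tau>) \<le> norm e'" .
  have ratio: "0 \<le> (?M\<^sup>2 - ?m\<^sup>2) / (?M\<^sup>2 + ?m\<^sup>2)"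
    using m M by (intro divide_nonneg_nonneg) (auto intro: power_mono)
  then have rho: "(decay_rho L \<gamma> \<mu>)\<^sup>2 = (?M\<^sup>2 - ?m\<^sup>2) / (?M\<^sup>2 + ?m\<^sup>2)"
    by (simp add: decay_rho_def)
  have "?m * norm e' \<le> ?m * (((decay_rho L \<gamma> \<mu>)\<^sup>2) ^ (\<kappa> div 2) * norm e)"
    using e'(3) m unfolding rho by (intro mult_left_mono) auto
  also have "\<dots> = ((decay_rho L \<gamma> \<mu>)\<^sup>2) ^ (\<kappa> div 2) * (?m * norm e)" by simp
  also have "\<dots> \<le> ((decay_rho L \<gamma> \<mu>)\<^sup>2) ^ (\<kappa> div 2) * norm r"
    using mu_H_lower[OF params(2,3) refl eV] unfolding He by (intro mult_left_mono) auto
  also have "\<dots> \<le> ((decay_rho L \<gamma> \<mu>)\<^sup>2) ^ (\<kappa> div 2) * (if C = N then 0 else (1 + 4 * L / ?m) * ?X)"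
    using r_norm by (intro mult_left_mono) auto
  finally show ?thesis
    using node m by (meson mult_left_mono less_imp_le order_trans)
qed

section \<open>Constants\<close>

lemma decay_rho_bounds:
  assumes "1 < L" "0 < \<gamma>" "\<gamma> < 1" "0 < \<mu>"
  shows "0 < decay_rho L \<gamma> \<mu>" "decay_rho L \<gamma> \<mu> < 1"
proof -
  have m: "0 < mu_H L \<gamma> \<mu>" "mu_H L \<gamma> \<mu> < 1" using mu_H_bounds assms by auto
  have M: "3 < L_H L" using assms by (simp add: L_H_def)
  have "(mu_H L \<gamma> \<mu>)\<^sup>2 < (L_H L)\<^sup>2" using m M by (intro power_strict_mono) auto
  moreover have "0 < (mu_H L \<gamma> \<mu>)\<^sup>2" using m by simp
  moreover from calculation have "0 < (L_H L)\<^sup>2 + (mu_H L \<gamma> \<mu>)\<^sup>2" by linarith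
  ultimately have "0 < ((L_H L)\<^sup>2 - (mu_H L \<gamma> \<mu>)\<^sup>2) / ((L_H L)\<^sup>2 + (mu_H L \<gamma> \<mu>)\<^sup>2)"
    "((L_H L)\<^sup>2 - (mu_H L \<gamma> \<mu>)\<^sup>2) / ((L_H L)\<^sup>2 + (mu_H L \<gamma> \<mu>)\<^sup>2) < 1"
    by (auto intro!: divide_pos_pos simp: divide_less_eq)
  then show "0 < decay_rho L \<gamma> \<mu>" "decay_rho L \<gamma> \<mu> < 1"
    unfolding decay_rho_def by simp_all
qed

text \<open>Rounding in \<open>\<kappa> div 2\<close> costs at most a factor
  \<open>1 / \<rho>\<close>, and \<open>(1 + 4 * L / m) / m\<close> is at most
  \<open>5 * L / m\<^sup>2\<close>. Both fit into the square of \<open>decay_alpha\<close>, which is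
  the square of \<open>L_H L / (m\<^sup>2 * \<rho>)\<close>, because
  \<open>m\<^sup>2 * \<rho> \<le> 1\<close>. Finally \<open>\<delta> > 1 / 2\<close> makes
  \<open>4 * \<delta> / (1 - \<delta>)\<^sup>2\<close> at least 8.\<close>

lemma decay_rate_bound:
  assumes params: "1 < L" "0 < \<gamma>" "\<gamma> < 1" "0 < \<mu>"
  defines "\<rho> \<equiv> decay_rho L \<gamma> \<mu>" and "\<delta> \<equiv> delta_S L \<gamma> \<mu>" and "m \<equiv> mu_H L \<gamma> \<mu>"
  shows "(\<rho>\<^sup>2) ^ (\<kappa> div 2) * ((1 + 4 * L / m) / m)
    \<le> 4 * (decay_alpha L \<gamma> \<mu>)\<^sup>2 * \<delta> * L / (1 - \<delta>)\<^sup>2 * \<delta> ^ \<kappa>"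
proof -
  have rho: "0 < \<rho>" "\<rho> < 1" unfolding \<rho>_def using decay_rho_bounds params by auto
  have m: "0 < m" "m < 1" unfolding m_def using mu_H_bounds params by auto
  have M: "3 < L_H L" using params by (simp add: L_H_def)
  have \<delta>: "\<rho> < \<delta>" "\<delta> < 1" "1 / 2 < \<delta>" using rho by (auto simp: \<delta>_def delta_S_def \<rho>_def[symmetric])
  have "\<rho> * (\<rho>\<^sup>2) ^ (\<kappa> div 2) \<le> \<rho> ^ (\<kappa> mod 2) * (\<rho>\<^sup>2) ^ (\<kappa> div 2)"
  proof (rule mult_right_mono)
    show "\<rho> \<le> \<rho> ^ (\<kappa> mod 2)" using rho by (cases "even \<kappa>") (auto simp: even_iff_mod_2_eq_zero odd_iff_mod_2_eq_one)
  qed simp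
  also have "\<dots> = \<rho> ^ (\<kappa> mod 2 + 2 * (\<kappa> div 2))" by (simp only: power_add power_mult)
  also have "\<dots> = \<rho> ^ \<kappa>" by simp
  also have "\<dots> \<le> \<delta> ^ \<kappa>" using rho \<delta> by (intro power_mono) auto
  finally have pow: "(\<rho>\<^sup>2) ^ (\<kappa> div 2) \<le> \<delta> ^ \<kappa> / \<rho>" using rho by (simp add: field_simps)
  have pos: "0 \<le> (1 + 4 * L / m) / m" using m params by (intro divide_nonneg_nonneg add_nonneg_nonneg) auto
  have "(1 + 4 * L / m) / m / \<rho> \<le> 8 * (decay_alpha L \<gamma> \<mu>)\<^sup>2 * L"
  proof -
    have "(1 + 4 * L / m) / m / \<rho> = (m + 4 * L) / (m\<^sup>2 * \<rho>)"
      using m rho by (simp add: field_simps power2_eq_square)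
    also have "\<dots> \<le> 5 * L / (m\<^sup>2 * \<rho>)"
      using m rho params by (intro divide_right_mono) auto
    also have "\<dots> \<le> 5 * L / (m\<^sup>2 * \<rho>)\<^sup>2"
    proof (rule divide_left_mono)
      have "m\<^sup>2 * \<rho> \<le> 1" using m rho by (intro mult_le_one power_le_one) auto
      then show "(m\<^sup>2 * \<rho>)\<^sup>2 \<le> m\<^sup>2 * \<rho>"
        using m rho by (simp add: power2_eq_square[of "m\<^sup>2 * \<rho>"] mult_left_le)
    qed (use m rho params in auto)
    also have "\<dots> \<le> 8 * (L_H L)\<^sup>2 * L / (m\<^sup>2 * \<rho>)\<^sup>2"
    proof (rule divide_right_mono)
      have "1 \<le> (L_H L)\<^sup>2" using M by (simp add: one_le_power)
      then have "1 * L \<le> (L_H L)\<^sup>2 * L" using params by (intro mult_right_mono) auto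
      then show "5 * L \<le> 8 * (L_H L)\<^sup>2 * L" using params by simp
    qed simp
    also have "\<dots> = 8 * (decay_alpha L \<gamma> \<mu>)\<^sup>2 * L"
      by (simp add: decay_alpha_def m_def \<rho>_def power_divide)
    finally show ?thesis .
  qed
  also have "\<dots> \<le> 4 * (decay_alpha L \<gamma> \<mu>)\<^sup>2 * \<delta> * L / (1 - \<delta>)\<^sup>2"
  proof -
    have "(1 - \<delta>)\<^sup>2 \<le> (1 / 2)\<^sup>2" using \<delta> by (intro power_mono) auto
    then have d4: "(1 - \<delta>)\<^sup>2 \<le> 1 / 4" by (simp add: power2_eq_square)
    have K: "0 \<le> (decay_alpha L \<gamma> \<mu>)\<^sup>2 * L" using params by simp
    have "8 * (1 - \<delta>)\<^sup>2 \<le> 4 * \<delta>" using d4 \<delta> by linarith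
    then have "((decay_alpha L \<gamma> \<mu>)\<^sup>2 * L) * (8 * (1 - \<delta>)\<^sup>2) \<le> ((decay_alpha L \<gamma> \<mu>)\<^sup>2 * L) * (4 * \<delta>)"
      using K by (rule mult_left_mono)
    moreover have "0 < (1 - \<delta>)\<^sup>2" using \<delta> by simp
    ultimately show ?thesis by (simp add: le_divide_eq mult_ac)
  qed
  finally have main: "(1 + 4 * L / m) / m / \<rho> \<le> 4 * (decay_alpha L \<gamma> \<mu>)\<^sup>2 * \<delta> * L / (1 - \<delta>)\<^sup>2" .
  have "(\<rho>\<^sup>2) ^ (\<kappa> div 2) * ((1 + 4 * L / m) / m) \<le> \<delta> ^ \<kappa> / \<rho> * ((1 + 4 * L / m) / m)"
    using pow pos by (rule mult_right_mono)
  also have "\<dots> = (1 + 4 * L / m) / m / \<rho> * \<delta> ^ \<kappa>" by (simp add: mult_ac)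
  also have "\<dots> \<le> 4 * (decay_alpha L \<gamma> \<mu>)\<^sup>2 * \<delta> * L / (1 - \<delta>)\<^sup>2 * \<delta> ^ \<kappa>"
    using main \<delta> by (intro mult_right_mono) auto
  finally show ?thesis .
qed

text \<open>Boundedness is what allows a single term to be compared with the real supremum in
  \<open>Gamma_const\<close>. The logarithm of a term is \<open>d\<close> times a quantity tending
  to \<open>ln q < 0\<close>, so only finitely many terms exceed 1.\<close>

lemma subexponential_bounded:
  assumes p: "subexponential p" and q: "0 < q" "q < 1"
  shows "bdd_above (range (\<lambda>d. q ^ d * p d))"
proof -
  have "(\<lambda>d. ln (p d) / real d) \<longlonglongrightarrow> 0" and pos: "\<And>d. 0 < p d"
    using p by (auto simp: subexponential_def)
  then have "\<forall>\<^sub>F d in sequentially. ln (p d) / real d < - ln q"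
    using q by (intro order_tendstoD) auto
  then have "\<forall>\<^sub>F d in sequentially. q ^ d * p d \<le> 1"
    using eventually_gt_at_top[of 0]
  proof eventually_elim
    case (elim d)
    then have "ln (p d) + real d * ln q < 0" by (simp add: divide_less_eq algebra_simps)
    moreover have "ln (q ^ d * p d) = real d * ln q + ln (p d)"
      using q pos[of d] by (simp add: ln_mult ln_realpow)
    ultimately have "ln (q ^ d * p d) < 0" by simp
    then show ?case using q pos[of d] by simp
  qed
  then obtain n where n: "\<And>d. n \<le> d \<Longrightarrow> q ^ d * p d \<le> 1"
    by (auto simp: eventually_sequentially)
  have "range (\<lambda>d. q ^ d * p d) \<subseteq> (\<lambda>d. q ^ d * p d) ` {..n} \<union> {..1}"
  proof
    fix z assume "z \<in> range (\<lambda>d. q ^ d * p d)"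
    then obtain d where "z = q ^ d * p d" by blast
    then show "z \<in> (\<lambda>d. q ^ d * p d) ` {..n} \<union> {..1}"
      using n[of d] by (cases "d \<le> n") auto
  qed
  moreover have "bdd_above ((\<lambda>d. q ^ d * p d) ` {..n} \<union> {..1})" by simp
  ultimately show ?thesis by (rule bdd_above_mono[rotated])
qed

section \<open>Assembly of the error bound\<close>

theorem theorem3:
  fixes E :: "('n::finite \<times> 'n) set"
    and xn :: "'s::finite \<Rightarrow> 'n" and un :: "'c::finite \<Rightarrow> 'n"
    and A :: "real^'s^'s" and B :: "real^'c^'s"
    and f :: "nat \<Rightarrow> real^'s \<Rightarrow> real" and c :: "nat \<Rightarrow> real^'c \<Rightarrow> real"
    and F g :: "real^'s \<Rightarrow> real" and w :: "nat \<Rightarrow> real^'s"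
    and p :: "nat \<Rightarrow> real" and L \<gamma> \<mu> \<sigma> :: real
    and d T t l k \<kappa>0 \<kappa> :: nat and i :: 'n and x :: "real^'s"
    and yc yd lamc lamd :: "nat \<Rightarrow> real^'s" and vc vd :: "nat \<Rightarrow> real^'c"
  assumes graph: "sym E"
    and structured: "graph_structured E xn xn A" "graph_structured E xn un B"
    and separable: "\<And>s. s \<le> T \<Longrightarrow> node_separable xn (f s)"
      "\<And>s. 1 \<le> s \<Longrightarrow> s \<le> T \<Longrightarrow> node_separable un (c s)"
    and params: "1 < L" "0 < \<gamma>" "\<gamma> < 1" "0 < \<mu>" "0 < \<sigma>"
    and bounds: "opnorm A \<le> L" "opnorm B \<le> L" "opnorm (pinv B) \<le> L"
    and controllable: "is_ctrb_index A B d" "\<sigma> \<le> ctrb_sigma_min A B d"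
    and kappa0: "enat \<kappa>0 < diam E"
    and stable: "\<And>j \<kappa>'. \<kappa>0 \<le> \<kappa>' \<Longrightarrow>
        stabilizable L \<gamma> (keep_rows xn (nbhd_k E \<kappa>' j) A) (keep_rows xn (nbhd_k E \<kappa>' j) B)"
    and costs_f: "\<And>s. s \<le> T \<Longrightarrow> regular_cost \<mu> L (f s)"
      "\<And>s z. s \<le> T \<Longrightarrow> 0 \<le> f s z" "\<And>s. s \<le> T \<Longrightarrow> f s 0 = 0"
    and costs_c: "\<And>s. 1 \<le> s \<Longrightarrow> s \<le> T \<Longrightarrow> regular_cost \<mu> L (c s)"
      "\<And>s z. 1 \<le> s \<Longrightarrow> s \<le> T \<Longrightarrow> 0 \<le> c s z" "\<And>s. 1 \<le> s \<Longrightarrow> s \<le> T \<Longrightarrow> c s 0 = 0"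
    and costs_F: "regular_cost \<mu> L F" "K_function F"
    and growth: "subexponential p"
      "\<And>j e. real (card {j'. gdist E j j' = enat e}) \<le> p e"
    and terminal: "g = F \<or> g = f T" "g = F \<Longrightarrow> node_separable xn F"
    and horizon: "l \<le> k" "t + l \<le> T"
    and disturbance: "\<And>s. T \<le> s \<Longrightarrow> w s = 0"
    and kappa: "\<kappa>0 \<le> \<kappa>"
    and centralized: "primal_dual_solution f c g A B t l x (\<lambda>\<tau>. w (t + \<tau>)) yc vc lamc"
    and truncated: "primal_dual_solution f c g
        (keep_rows xn (nbhd_k E \<kappa> i) A) (keep_rows xn (nbhd_k E \<kappa> i) B) t l
        (keep xn (nbhd_k E \<kappa> i) x) (\<lambda>\<tau>. keep xn (nbhd_k E \<kappa> i) (w (t + \<tau>))) yd vd lamd"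
  shows "node_norm xn un i l (\<lambda>\<tau>. yc \<tau> - yd \<tau>) (\<lambda>\<tau>. vc \<tau> - vd \<tau>) (\<lambda>\<tau>. lamc \<tau> - lamd \<tau>)
    \<le> Gamma_const L \<gamma> \<mu> p * (norm x + dist_budget w T l) * delta_S L \<gamma> \<mu> ^ \<kappa>"
proof -
  define N where "N = nbhd_k E \<kappa> i"
  define C where "C = {j. \<exists>m. (i, j) \<in> E ^^ m}"
  obtain \<kappa>' where \<kappa>': "\<kappa> \<le> \<kappa>'" "nbhd_k E \<kappa>' i = C"
    using component_eq_nbhd_k unfolding C_def .
  have NC: "N \<subseteq> C" unfolding N_def C_def nbhd_k_def gdist_le_iff by blast
  have iC: "i \<in> C" unfolding C_def by (auto intro: exI[of _ 0])
  have C_closed: "nbhd E j \<subseteq> C" if "j \<in> C" for j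
    using that unfolding C_def nbhd_def by (auto intro: relpow_Suc_I)
  \<comment> \<open>Minimality at 0 gives a vanishing gradient there, as needed for the comparison
    with the zero trajectory. For \<open>F\<close> it comes from monotonicity in the norm, for
    \<open>f T\<close> from nonnegativity.\<close>
  have reg_g: "regular_cost \<mu> L g" and sep_g: "node_separable xn g" and g_min: "\<And>z. g 0 \<le> g z"
  proof -
    have "F 0 \<le> F z" for z
    proof -
      obtain \<beta> where "strict_mono_on {0..} \<beta>" "\<And>z. F z = \<beta> (norm z)"
        using costs_F(2) by (auto simp: K_function_def)
      then show ?thesis by (simp add: strict_mono_on_leD)
    qed
    moreover have "f T 0 \<le> f T z" for z using costs_f(2,3)[of T] by simp
    ultimately show "\<And>z. g 0 \<le> g z" using terminal(1) by blast
    show "regular_cost \<mu> L g" using terminal(1) costs_F(1) costs_f(1)[of T] by auto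
    show "node_separable xn g" using terminal separable(1)[of T] by auto
  qed
  have diff: "h differentiable (at z)" if "regular_cost \<mu> L h" for h :: "'b::euclidean_space \<Rightarrow> real" and z
    using that by (simp add: regular_cost_def smooth_def)
  let ?hy = "\<lambda>\<tau>. if \<tau> < l then f (t + \<tau>) else g" and ?hv = "\<lambda>\<tau>. c (t + Suc \<tau>)"
  have hy: "regular_cost \<mu> L (?hy \<tau>)" "node_separable xn (?hy \<tau>)" "grad (?hy \<tau>) 0 = 0" if "\<tau> \<le> l" for \<tau>
  proof -
    have "t + \<tau> \<le> T" using that horizon(2) by simp
    then show reg: "regular_cost \<mu> L (?hy \<tau>)" and "node_separable xn (?hy \<tau>)"
      using costs_f(1) separable(1) reg_g sep_g by auto
    have "?hy \<tau> 0 \<le> ?hy \<tau> z" for z using \<open>t + \<tau> \<le> T\<close> costs_f(2,3) g_min by simp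
    then show "grad (?hy \<tau>) 0 = 0" by (intro grad_minimum diff[OF reg])
  qed
  have hv: "regular_cost \<mu> L (?hv \<tau>)" "node_separable un (?hv \<tau>)" "grad (?hv \<tau>) 0 = 0" if "\<tau> < l" for \<tau>
  proof -
    have T: "1 \<le> t + Suc \<tau>" "t + Suc \<tau> \<le> T" using that horizon(2) by auto
    then show reg: "regular_cost \<mu> L (?hv \<tau>)" and "node_separable un (?hv \<tau>)"
      using costs_c(1) separable(2) by auto
    have "?hv \<tau> 0 \<le> ?hv \<tau> z" for z using costs_c(2,3)[OF T] by simp
    then show "grad (?hv \<tau>) 0 = 0" by (intro grad_minimum diff[OF reg])
  qed
  have df: "f (t + \<tau>) differentiable (at z)" if "\<tau> < l" for \<tau> z
    using that horizon(2) by (intro diff costs_f(1)) auto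
  have dc: "c (t + Suc \<tau>) differentiable (at z)" if "\<tau> < l" for \<tau> z
    using that horizon(2) by (intro diff costs_c(1)) auto
  let ?m = "mu_H L \<gamma> \<mu>" and ?\<rho> = "decay_rho L \<gamma> \<mu>" and ?\<delta> = "delta_S L \<gamma> \<mu>"
  let ?X = "norm x + (\<Sum>\<tau><l. norm (w (t + \<tau>)))" and ?Y = "norm x + dist_budget w T l"
  let ?err = "node_norm xn un i l (\<lambda>\<tau>. yc \<tau> - yd \<tau>) (\<lambda>\<tau>. vc \<tau> - vd \<tau>) (\<lambda>\<tau>. lamc \<tau> - lamd \<tau>)"
  have bound: "?m * ?err \<le> (?\<rho>\<^sup>2) ^ (\<kappa> div 2) * (if C = N then 0 else (1 + 4 * L / ?m) * ?X)"
  proof (rule truncation_error[OF N_def graph structured C_closed NC iC bounds(1,2) _ _ params(1-4) hy hv])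
    show "stabilizable L \<gamma> (keep_rows xn N A) (keep_rows xn N B)"
      unfolding N_def by (rule stable[OF kappa])
    show "stabilizable L \<gamma> (keep_rows xn C A) (keep_rows xn C B)"
      using stable[of \<kappa>' i] kappa \<kappa>' by simp
    show "optimality_system ?hy ?hv A B l x (\<lambda>\<tau>. w (t + \<tau>)) yc vc lamc"
      by (rule primal_dual_optimality_system[OF centralized df dc diff[OF reg_g]])
    show "optimality_system ?hy ?hv (keep_rows xn N A) (keep_rows xn N B) l
        (keep xn N x) (\<lambda>\<tau>. keep xn N (w (t + \<tau>))) yd vd lamd"
      unfolding N_def by (rule primal_dual_optimality_system[OF truncated df dc diff[OF reg_g]])
  qed
  have m: "0 < ?m" using mu_H_bounds(1) params by blast
  have \<rho>: "0 < ?\<rho>" "?\<rho> < 1" using decay_rho_bounds params by auto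
  have \<delta>: "?\<rho> < ?\<delta>" "?\<delta> < 1" using \<rho> by (auto simp: delta_S_def)
  have XY: "?X \<le> ?Y"
  proof -
    \<comment> \<open>For \<open>l = 0\<close> the time \<open>t\<close> may equal \<open>T\<close>
      and so lie outside the range of the maximum; the sum is then empty and the index 0 serves
      instead.\<close>
    define s where "s = (if l = 0 then 0 else t)"
    have "(\<Sum>\<tau><l. norm (w (t + \<tau>))) = (\<Sum>\<tau><l. norm (w (s + \<tau>)))" by (simp add: s_def)
    also have "\<dots> \<le> dist_budget w T l"
      unfolding dist_budget_def using horizon(2)
      by (intro Max_ge image_eqI[of _ _ s]) (auto simp: s_def)
    finally show ?thesis by simp
  qed
  have Y0: "0 \<le> ?Y" by (rule order_trans[OF _ XY]) (simp add: sum_nonneg)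
  define S where "S = (SUP d. (?\<rho> / ?\<delta>) ^ d * p d)"
  define K where "K = 4 * (decay_alpha L \<gamma> \<mu>)\<^sup>2 * ?\<delta> * L / (1 - ?\<delta>)\<^sup>2"
  have K0: "0 \<le> K" using \<rho> \<delta> params unfolding K_def by (intro divide_nonneg_nonneg) auto
  have \<Gamma>: "Gamma_const L \<gamma> \<mu> p = K * (S\<^sup>2 * p 1)" by (simp add: Gamma_const_def K_def S_def)
  have p1: "0 < p 1" using growth(1) by (simp add: subexponential_def)
  show ?thesis
  proof (cases "C = N")
    case True
    then have "?err \<le> 0" using bound m by (simp add: mult_le_0_iff)
    also have "0 \<le> Gamma_const L \<gamma> \<mu> p * ?Y * ?\<delta> ^ \<kappa>"
      unfolding \<Gamma> using K0 Y0 p1 \<rho> \<delta> by (intro mult_nonneg_nonneg) auto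
    finally show ?thesis .
  next
    case False
    then obtain j k' where "j \<notin> N" "(i, j) \<in> E ^^ k'" using NC by (auto simp: C_def)
    then obtain a b where "gdist E a b = enat 1" unfolding N_def by (rule sphere_one_nonempty)
    then have "card {j'. gdist E a j' = enat 1} \<noteq> 0" by auto
    then have p1_ge: "1 \<le> p 1" using growth(2)[of a 1] by linarith
    \<comment> \<open>The term \<open>d = 0\<close> already makes the supremum at least 1: it equals
      \<open>p 0\<close>, and \<open>i\<close> is at distance 0 from itself.\<close>
    have "card {j'. gdist E i j' = enat 0} \<noteq> 0"
      using gdist_self[of E i] by (auto simp: zero_enat_def)
    then have "1 \<le> p 0" using growth(2)[of i 0] by linarith
    also have "p 0 = (?\<rho> / ?\<delta>) ^ 0 * p 0" by simp
    also have "\<dots> \<le> S"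
      unfolding S_def using \<rho> \<delta> by (intro cSUP_upper subexponential_bounded[OF growth(1)]) auto
    finally have S: "1 \<le> S" .
    have "1 * 1 \<le> S\<^sup>2 * p 1" using S p1_ge by (intro mult_mono) (auto simp: one_le_power)
    then have K_le: "K * 1 \<le> K * (S\<^sup>2 * p 1)" using K0 by (intro mult_left_mono) auto
    have "?err \<le> (?\<rho>\<^sup>2) ^ (\<kappa> div 2) * ((1 + 4 * L / ?m) / ?m) * ?X"
      using bound False m by (simp add: field_simps)
    also have "\<dots> \<le> K * ?\<delta> ^ \<kappa> * ?X"
      unfolding K_def by (rule mult_right_mono[OF decay_rate_bound[OF params(1-4)]]) (simp add: sum_nonneg)
    also have "\<dots> \<le> Gamma_const L \<gamma> \<mu> p * ?\<delta> ^ \<kappa> * ?Y"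
      unfolding \<Gamma> using K_le K0 XY Y0 \<rho> \<delta> S p1
      by (intro mult_mono mult_nonneg_nonneg mult_right_mono) (auto simp: sum_nonneg)
    finally show ?thesis by (simp add: mult_ac)
  qed
qed

end
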